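(* Let $n\ge1$, $s>0$, $1\le p\le\infty$, and let $1<\lambda_1<\lambda_2$. Then $$\mathcal{L}^{p}_{s+\ln,\lambda_1}(\mathbb R^n)=\mathcal{L}^{p}_{s+\ln,\lambda_2}(\mathbb R^n),$$ and there exists $C=C(n,p,s,\lambda_1,\lambda_2)\ge 1$ such that for all $u\in\mathcal S(\mathbb R^n)$, $$C^{-1}\|u\|_{\mathcal{L}^{p}_{s+\ln,\lambda_2}}\le\|u\|_{\mathcal{L}^{p}_{s+\ln,\lambda_1}}\le C\|u\|_{\mathcal{L}^{p}_{s+\ln,\lambda_2}}.$$
   Context: The Fourier transform is $\widehat u(\xi)=\int_{\mathbb{R}^n}u(x)e^{-2\pi i x\cdot\xi}\,dx$, extended to $\mathcal S'(\mathbb R^n)$. For $s>0$, $\lambda>1$, $(\lambda I-\Delta)^{s+\ln}$ is the Fourier multiplier on $\mathcal S'(\mathbb R^n)$ with symbol $(\lambda+4\pi^2|\xi|^2)^s\ln(\lambda+4\pi^2|\xi|^2)$. The logarithmic Bessel space is $$\mathcal L^{p}_{s+\ln,\lambda}(\mathbb R^n)=\{u\in\mathcal S'(\mathbb R^n):(\lambda I-\Delta)^{s+\ln}u\in L^p(\mathbb R^n)\},\qquad \|u\|_{\mathcal L^{p}_{s+\ln,\lambda}}=\|(\lambda I-\Delta)^{s+\ln}u\|_{L^p(\mathbb R^n)}.$$ *)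

theory Defs
  imports "HOL-Analysis.Analysis" "HOL-Probability.Essential_Supremum"
begin

section \<open>Schwartz functions\<close>

text \<open>\<open>iter_partial [b1, ..., bk] f\<close> is the iterated partial derivative of \<open>f\<close> in the
  coordinate directions \<open>b1, ..., bk\<close>.  Lists over \<^term>\<open>Basis\<close> play the role of multi-indices; for
  smooth functions the order of the entries is irrelevant.\<close>

fun iter_partial ::
    "'a::euclidean_space list \<Rightarrow> ('a \<Rightarrow> complex) \<Rightarrow> 'a \<Rightarrow> complex" where
  "iter_partial [] f = f"
| "iter_partial (b # bs) f = (\<lambda>x. frechet_derivative (iter_partial bs f) (at x) b)"

text \<open>Every iterated partial derivative is required to be Frechet differentiable, hence
  continuous; so this is membership in the class of infinitely differentiable functions.\<close>

definition smooth :: "('a::euclidean_space \<Rightarrow> complex) \<Rightarrow> bool" where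
  "smooth f \<longleftrightarrow>
     (\<forall>bs. set bs \<subseteq> Basis \<longrightarrow> (\<forall>x. iter_partial bs f differentiable (at x)))"

definition schwartz :: "('a::euclidean_space \<Rightarrow> complex) set" where
  "schwartz = {f. smooth f \<and>
     (\<forall>N bs. set bs \<subseteq> Basis \<longrightarrow>
        bdd_above (range (\<lambda>x. (1 + norm x) ^ N * norm (iter_partial bs f x))))}"

definition schwartz_seminorm :: "nat \<Rightarrow> ('a::euclidean_space \<Rightarrow> complex) \<Rightarrow> real" where
  "schwartz_seminorm N f =
     (\<Sum>bs | set bs \<subseteq> Basis \<and> length bs \<le> N.
        SUP x. (1 + norm x) ^ N * norm (iter_partial bs f x))"

section \<open>Tempered distributions\<close>

text \<open>A tempered distribution is a continuous complex-linear functional on \<^term>\<open>schwartz\<close>;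
  since the seminorms above are increasing in \<open>N\<close>, continuity of a linear functional is
  boundedness by a multiple of one of them.  Functionals take the value \<^term>\<open>undefined\<close> outside
  \<^term>\<open>schwartz\<close>, so that equality in HOL is equality of distributions.\<close>

definition tempered_distributions ::
    "(('a::euclidean_space \<Rightarrow> complex) \<Rightarrow> complex) set" where
  "tempered_distributions = {u. u \<in> extensional schwartz \<and>
     (\<forall>\<phi>\<in>schwartz. \<forall>\<psi>\<in>schwartz. \<forall>a b.
        u (\<lambda>x. a * \<phi> x + b * \<psi> x) = a * u \<phi> + b * u \<psi>) \<and>
     (\<exists>C N. \<forall>\<phi>\<in>schwartz. norm (u \<phi>) \<le> C * schwartz_seminorm N \<phi>)}"

definition distr_of_fun ::
    "('a::euclidean_space \<Rightarrow> complex) \<Rightarrow> ('a \<Rightarrow> complex) \<Rightarrow> complex" where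
  "distr_of_fun f = (\<lambda>\<phi>\<in>schwartz. LINT x|lborel. f x * \<phi> x)"

definition fourier :: "('a::euclidean_space \<Rightarrow> complex) \<Rightarrow> 'a \<Rightarrow> complex" where
  "fourier f \<xi> = (LINT x|lborel. f x * exp (- 2 * of_real pi * \<i> * of_real (x \<bullet> \<xi>)))"

definition inv_fourier :: "('a::euclidean_space \<Rightarrow> complex) \<Rightarrow> 'a \<Rightarrow> complex" where
  "inv_fourier f x = (LINT \<xi>|lborel. f \<xi> * exp (2 * of_real pi * \<i> * of_real (x \<bullet> \<xi>)))"

text \<open>The operations on tempered distributions are defined by duality.\<close>

definition distr_fourier ::
    "(('a::euclidean_space \<Rightarrow> complex) \<Rightarrow> complex) \<Rightarrow> ('a \<Rightarrow> complex) \<Rightarrow> complex" where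
  "distr_fourier u = (\<lambda>\<phi>\<in>schwartz. u (fourier \<phi>))"

definition distr_inv_fourier ::
    "(('a::euclidean_space \<Rightarrow> complex) \<Rightarrow> complex) \<Rightarrow> ('a \<Rightarrow> complex) \<Rightarrow> complex" where
  "distr_inv_fourier u = (\<lambda>\<phi>\<in>schwartz. u (inv_fourier \<phi>))"

text \<open>Meaningful for smooth \<open>m\<close> all of whose derivatives have at most polynomial growth.\<close>

definition distr_mult ::
    "('a::euclidean_space \<Rightarrow> complex) \<Rightarrow> (('a \<Rightarrow> complex) \<Rightarrow> complex) \<Rightarrow> ('a \<Rightarrow> complex) \<Rightarrow> complex" where
  "distr_mult m u = (\<lambda>\<phi>\<in>schwartz. u (\<lambda>x. m x * \<phi> x))"

definition fourier_multiplier ::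
    "('a::euclidean_space \<Rightarrow> complex) \<Rightarrow> (('a \<Rightarrow> complex) \<Rightarrow> complex) \<Rightarrow> ('a \<Rightarrow> complex) \<Rightarrow> complex" where
  "fourier_multiplier m u = distr_inv_fourier (distr_mult m (distr_fourier u))"

section \<open>Lebesgue spaces\<close>

definition Lp_space :: "ennreal \<Rightarrow> ('a::euclidean_space \<Rightarrow> complex) set" where
  "Lp_space p = {f \<in> borel_measurable lborel.
     if p = \<infinity> then esssup lborel (\<lambda>x. ennreal (norm (f x))) < \<infinity>
     else (\<integral>\<^sup>+ x. ennreal (norm (f x) powr enn2real p) \<partial>lborel) < \<infinity>}"

definition Lp_norm :: "ennreal \<Rightarrow> ('a::euclidean_space \<Rightarrow> complex) \<Rightarrow> real" where
  "Lp_norm p f =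
     (if p = \<infinity> then enn2real (esssup lborel (\<lambda>x. ennreal (norm (f x))))
      else (enn2real (\<integral>\<^sup>+ x. ennreal (norm (f x) powr enn2real p) \<partial>lborel))
             powr (1 / enn2real p))"

definition distr_in_Lp ::
    "ennreal \<Rightarrow> (('a::euclidean_space \<Rightarrow> complex) \<Rightarrow> complex) \<Rightarrow> bool" where
  "distr_in_Lp p u \<longleftrightarrow> (\<exists>f\<in>Lp_space p. u = distr_of_fun f)"

text \<open>The representing function is unique almost everywhere, so the value is well defined for
  distributions in the Lebesgue space; it is unspecified for all others.\<close>

definition distr_Lp_norm ::
    "ennreal \<Rightarrow> (('a::euclidean_space \<Rightarrow> complex) \<Rightarrow> complex) \<Rightarrow> real" where
  "distr_Lp_norm p u = (THE r. \<exists>f\<in>Lp_space p. u = distr_of_fun f \<and> r = Lp_norm p f)"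

section \<open>Logarithmic Bessel spaces\<close>

definition log_bessel_symbol :: "real \<Rightarrow> real \<Rightarrow> 'a::euclidean_space \<Rightarrow> complex" where
  "log_bessel_symbol s lam \<xi> =
     of_real ((lam + 4 * pi\<^sup>2 * (norm \<xi>)\<^sup>2) powr s * ln (lam + 4 * pi\<^sup>2 * (norm \<xi>)\<^sup>2))"

definition log_bessel_op ::
    "real \<Rightarrow> real \<Rightarrow> (('a::euclidean_space \<Rightarrow> complex) \<Rightarrow> complex) \<Rightarrow> ('a \<Rightarrow> complex) \<Rightarrow> complex" where
  "log_bessel_op s lam = fourier_multiplier (log_bessel_symbol s lam)"

definition log_bessel_space ::
    "ennreal \<Rightarrow> real \<Rightarrow> real \<Rightarrow> (('a::euclidean_space \<Rightarrow> complex) \<Rightarrow> complex) set" where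
  "log_bessel_space p s lam = {u \<in> tempered_distributions. distr_in_Lp p (log_bessel_op s lam u)}"

definition log_bessel_norm ::
    "ennreal \<Rightarrow> real \<Rightarrow> real \<Rightarrow> (('a::euclidean_space \<Rightarrow> complex) \<Rightarrow> complex) \<Rightarrow> real" where
  "log_bessel_norm p s lam u = distr_Lp_norm p (log_bessel_op s lam u)"

end

theory Submission
  imports Defs "HOL-Probability.Probability"
begin

text \<open>
  Write \<open>w\<^sub>i = lam\<^sub>i + 4\<pi>\<^sup>2|\<xi>|\<^sup>2\<close> and \<open>m\<^sub>i = w\<^sub>i\<^sup>s ln w\<^sub>i\<close> for \<open>i = 1, 2\<close>.  Everything follows once the quotients
  \<open>m\<^sub>1/m\<^sub>2\<close> and \<open>m\<^sub>2/m\<^sub>1\<close> are known to act boundedly on every Lebesgue space with exponent in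
  \<open>[1, \<infinity>]\<close>, because the operator with symbol \<open>m\<^sub>2\<close> is the one with symbol \<open>m\<^sub>1\<close> followed by the
  multiplier \<open>m\<^sub>2/m\<^sub>1\<close>.  The endpoints \<open>1\<close> and \<open>\<infinity>\<close> leave no room for a multiplier theorem of
  Mikhlin type; the quotients have to be Fourier transforms of finite measures.  The factorizations
  \<open>m\<^sub>1/m\<^sub>2 = (w\<^sub>1/w\<^sub>2)\<^sup>s (1 + ln (w\<^sub>1/w\<^sub>2) / ln w\<^sub>2)\<close> and
  \<open>m\<^sub>2/m\<^sub>1 = (w\<^sub>1/w\<^sub>2)\<^sup>-\<^sup>s (1 - ln (w\<^sub>1/w\<^sub>2) / ln w\<^sub>1)\<close> reduce this to three kinds of factors
  (\<open>Lp_multiplier_symbol_ratio\<close>).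

  Each factor is, up to an additive constant, a Laplace transform \<open>\<integral> w(r) e\<^sup>-\<^sup>r\<^sup>t dr\<close>, taken at
  \<open>t = 4\<pi>\<^sup>2|\<xi>|\<^sup>2\<close>, of an integrable function on the half line.  Since
  \<open>w\<^sub>1/w\<^sub>2 = 1 - q\<close> with \<open>q = (lam\<^sub>2 - lam\<^sub>1)/w\<^sub>2\<close>, powers and the logarithm of \<open>w\<^sub>1/w\<^sub>2\<close> are power
  series in \<open>1/w\<^sub>2\<close>, and \<open>w\<^sub>2\<^sup>-\<^sup>k\<close> is the Laplace transform of a multiple of a gamma density, of total mass
  \<open>lam\<^sub>2\<^sup>-\<^sup>k\<close>; the masses are summable because \<open>0 < lam\<^sub>2 - lam\<^sub>1 < lam\<^sub>2\<close>
  (\<open>laplace_L1_powr_ratio\<close>, \<open>laplace_L1_ln_ratio\<close>).  For the reciprocal logarithm,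
  \<open>1 / ln w = \<integral> w\<^sup>-\<^sup>a da\<close> over \<open>a > 0\<close>, and each \<open>w\<^sup>-\<^sup>a\<close> is again the transform of a gamma density
  (\<open>laplace_L1_inverse_ln\<close>).  The function \<open>e\<^sup>-\<^sup>r\<^sup>t\<close> of \<open>\<xi>\<close> is the Fourier transform of a Gaussian
  probability density, so each factor acts as a weighted average of translations, which is bounded
  on all Lebesgue spaces by Jensen's inequality (\<open>Lp_multiplier_laplace_L1\<close>).  Bounded multipliers
  are closed under sums and products.

  The operators act on distributions by duality, so these statements are read off from the
  action on Schwartz functions.  This takes the invariance of the Schwartz space under the Fourier
  transform and under multiplication by the symbols, and Fourier inversion
  (\<open>osc_transform_schwartz\<close>, \<open>schwartz_symbol_mult\<close>, \<open>osc_transform_inverse\<close>).  The norm of a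
  distribution is the norm of a representing function; it is meaningful because such a function is
  determined almost everywhere by its integrals against Schwartz functions
  (\<open>distr_Lp_norm_distr_of_fun\<close>), and for a Schwartz function \<open>u\<close> it is the norm of an actual
  Schwartz function (\<open>log_bessel_op_schwartz\<close>).
\<close>

section \<open>Schwartz functions\<close>

definition partial :: "'a::euclidean_space \<Rightarrow> ('a \<Rightarrow> complex) \<Rightarrow> 'a \<Rightarrow> complex" where
  "partial b f x = frechet_derivative f (at x) b"

lemma partial_eqI: "(\<And>x. (f has_derivative D x) (at x)) \<Longrightarrow> partial b f = (\<lambda>x. D x b)"
  by (metis frechet_derivative_at partial_def)

lemma iter_partial_Cons_partial: "iter_partial (b # bs) f = partial b (iter_partial bs f)"
  by (simp add: partial_def[abs_def])

text \<open>The recursion of \<open>iter_partial\<close> adds outermost derivatives; closure of the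
  Schwartz space under partial derivatives needs the innermost one to be split off.\<close>

lemma iter_partial_snoc: "iter_partial (bs @ [b]) f = iter_partial bs (partial b f)"
  by (induction bs) (simp_all add: partial_def[abs_def])

text \<open>A set that is stable under a single partial derivative is stable under all iterated
  ones.  Membership in the Schwartz space is therefore proved throughout by exhibiting such a set,
  and no induction over multi-indices or higher Leibniz rule is ever needed.\<close>

lemma schwartz_coinduct:
  assumes "f \<in> A"
    and deriv: "\<And>f. f \<in> A \<Longrightarrow> \<exists>D. (\<forall>x. (f has_derivative D x) (at x)) \<and> (\<forall>b\<in>Basis. (\<lambda>x. D x b) \<in> A)"
    and decay: "\<And>f N. f \<in> A \<Longrightarrow> \<exists>C. \<forall>x. (1 + norm x) ^ N * norm (f x) \<le> C"
  shows "f \<in> schwartz"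
proof -
  have iter: "iter_partial bs f \<in> A" if "set bs \<subseteq> Basis" for bs
    using that
  proof (induction bs)
    case (Cons b bs)
    then obtain D where "\<forall>x. (iter_partial bs f has_derivative D x) (at x)" "(\<lambda>x. D x b) \<in> A"
      using deriv[of "iter_partial bs f"] by auto
    then show ?case
      by (simp only: iter_partial_Cons_partial) (simp add: partial_eqI[of _ D])
  qed (use assms in simp)
  have "smooth f"
    unfolding smooth_def differentiable_def using iter deriv by blast
  moreover have "bdd_above (range (\<lambda>x. (1 + norm x) ^ N * norm (iter_partial bs f x)))"
    if "set bs \<subseteq> Basis" for N bs
    using decay[OF iter[OF that], of N] by (auto simp: bdd_above_def)
  ultimately show ?thesis
    by (simp add: schwartz_def)
qed

lemma schwartz_has_derivative:
  assumes "f \<in> schwartz"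
  shows "(f has_derivative frechet_derivative f (at x)) (at x)"
proof -
  have "iter_partial [] f differentiable (at x)"
    using assms unfolding schwartz_def smooth_def by (metis (mono_tags, lifting) empty_set empty_subsetI mem_Collect_eq)
  then show ?thesis by (simp add: frechet_derivative_works)
qed

lemma schwartz_partial:
  assumes "f \<in> schwartz" "b \<in> Basis"
  shows "partial b f \<in> schwartz"
proof -
  have "iter_partial bs (partial b f) = iter_partial (bs @ [b]) f" for bs
    by (simp add: iter_partial_snoc)
  then show ?thesis
    using assms unfolding schwartz_def smooth_def by (auto simp del: iter_partial.simps)
qed

lemma schwartz_decay:
  assumes "f \<in> schwartz"
  obtains C where "C > 0" "\<And>x. (1 + norm x) ^ N * norm (f x) \<le> C"
proof -
  have "bdd_above (range (\<lambda>x. (1 + norm x) ^ N * norm (iter_partial [] f x)))"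
    using assms unfolding schwartz_def mem_Collect_eq by (metis empty_set empty_subsetI)
  then obtain C where "\<And>x. (1 + norm x) ^ N * norm (f x) \<le> C"
    by (auto simp: bdd_above_def)
  then show ?thesis
    by (intro that[of "max C 1"]) (auto simp: le_max_iff_disj)
qed

lemma schwartz_deriv_ex:
  "f \<in> schwartz \<Longrightarrow> \<exists>D. (\<forall>x. (f has_derivative D x) (at x)) \<and> (\<forall>b\<in>Basis. (\<lambda>x. D x b) \<in> schwartz)"
  using schwartz_has_derivative schwartz_partial unfolding partial_def by fast

lemma schwartz_continuous: "f \<in> schwartz \<Longrightarrow> continuous_on UNIV f"
  using schwartz_has_derivative has_derivative_continuous
  by (metis continuous_at_imp_continuous_on)

lemma schwartz_measurable [measurable_dest]: "f \<in> schwartz \<Longrightarrow> f \<in> borel_measurable borel"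
  using schwartz_continuous by (rule borel_measurable_continuous_onI)

section \<open>Slowly increasing symbols\<close>

abbreviation shifted_square :: "real \<Rightarrow> 'a::real_normed_vector \<Rightarrow> real" where
  "shifted_square lam x \<equiv> lam + 4 * pi\<^sup>2 * (norm x)\<^sup>2"

text \<open>One class that contains polynomials, both Bessel symbols and all factors of their
  quotient.  It is generated so as to be visibly stable under partial derivatives.  The condition
  \<open>1 < lam\<close> keeps the argument of the logarithm away from \<open>1\<close>, so that the
  reciprocal logarithm is smooth and bounded.\<close>

inductive_set symbols :: "('a::euclidean_space \<Rightarrow> complex) set" where
  const: "(\<lambda>x. c) \<in> symbols"
| coord: "b \<in> Basis \<Longrightarrow> (\<lambda>x. of_real (x \<bullet> b)) \<in> symbols"
| powr: "1 < lam \<Longrightarrow> (\<lambda>x. of_real ((shifted_square lam x) powr a)) \<in> symbols"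
| ln: "1 < lam \<Longrightarrow> (\<lambda>x. of_real (ln (shifted_square lam x))) \<in> symbols"
| inverse_ln: "1 < lam \<Longrightarrow> (\<lambda>x. of_real (inverse (ln (shifted_square lam x)))) \<in> symbols"
| add: "f \<in> symbols \<Longrightarrow> g \<in> symbols \<Longrightarrow> (\<lambda>x. f x + g x) \<in> symbols"
| mult: "f \<in> symbols \<Longrightarrow> g \<in> symbols \<Longrightarrow> (\<lambda>x. f x * g x) \<in> symbols"

lemma shifted_square_gt_1:
  fixes x :: "'a::real_normed_vector" and lam :: real
  shows "1 < lam \<Longrightarrow> 1 < shifted_square lam x"
  by (smt (verit) mult_nonneg_nonneg zero_le_power2)

lemma radial_has_derivative:
  fixes x :: "'a::euclidean_space" and \<phi> :: "real \<Rightarrow> real"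
  assumes "(\<phi> has_real_derivative d) (at (shifted_square lam x))"
  shows "((\<lambda>x. complex_of_real (\<phi> (shifted_square lam x))) has_derivative
           (\<lambda>h. of_real d * (of_real (8 * pi\<^sup>2) * of_real (x \<bullet> h)))) (at x)"
proof -
  have "((\<lambda>x. lam + 4 * pi\<^sup>2 * (x \<bullet> x)) has_derivative (\<lambda>h. 8 * pi\<^sup>2 * (x \<bullet> h))) (at x)"
    by (auto intro!: derivative_eq_intros simp: inner_commute)
  moreover have "(\<phi> has_derivative (\<lambda>h. d * h)) (at (lam + 4 * pi\<^sup>2 * (x \<bullet> x)))"
    using assms by (simp add: has_field_derivative_def power2_norm_eq_inner)
  ultimately have "((\<lambda>x. \<phi> (lam + 4 * pi\<^sup>2 * (x \<bullet> x))) has_derivative (\<lambda>h. d * (8 * pi\<^sup>2 * (x \<bullet> h)))) (at x)"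
    by (rule has_derivative_compose)
  from has_derivative_of_real[OF this] show ?thesis
    by (simp add: power2_norm_eq_inner)
qed

lemma symbols_has_derivative:
  assumes "f \<in> symbols"
  shows "\<exists>D. (\<forall>x. (f has_derivative D x) (at x)) \<and> (\<forall>b\<in>Basis. (\<lambda>x. D x b) \<in> symbols)"
  using assms
proof induction
  case (const c)
  show ?case
    by (intro exI[of _ "\<lambda>x h. 0"]) (auto intro: symbols.const)
next
  case (coord b)
  show ?case
    by (intro exI[of _ "\<lambda>x h. of_real (h \<bullet> b)"])
       (auto intro!: symbols.const derivative_eq_intros)
next
  case (powr lam a)
  define D where "D x h = of_real (a * (shifted_square lam x) powr (a - 1)) *
      (of_real (8 * pi\<^sup>2) * of_real (x \<bullet> h) :: complex)" for x h :: 'a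
  have "(\<lambda>x. D x b) \<in> symbols" if "b \<in> Basis" for b
    unfolding D_def of_real_mult by (intro symbols.intros powr that)
  moreover have "((\<lambda>x. of_real ((shifted_square lam x) powr a)) has_derivative D x) (at x)" for x
    unfolding D_def using shifted_square_gt_1[OF powr, of x]
    by (intro radial_has_derivative has_real_derivative_powr) simp
  ultimately show ?case by blast
next
  case (ln lam)
  define D where "D x h = of_real ((shifted_square lam x) powr (-1)) *
      (of_real (8 * pi\<^sup>2) * of_real (x \<bullet> h) :: complex)" for x h :: 'a
  have "(\<lambda>x. D x b) \<in> symbols" if "b \<in> Basis" for b
    unfolding D_def of_real_mult by (intro symbols.intros ln that)
  moreover have "((\<lambda>x. of_real (Transcendental.ln (shifted_square lam x))) has_derivative D x) (at x)" for x
    unfolding D_def using shifted_square_gt_1[OF ln, of x]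
    by (intro radial_has_derivative) (auto intro!: derivative_eq_intros simp: powr_minus_divide)
  ultimately show ?case by blast
next
  case (inverse_ln lam)
  define D where "D x h = of_real ((-1) * inverse (Transcendental.ln (shifted_square lam x)) *
      inverse (Transcendental.ln (shifted_square lam x)) * (shifted_square lam x) powr (-1)) *
      (of_real (8 * pi\<^sup>2) * of_real (x \<bullet> h) :: complex)" for x h :: 'a
  have "(\<lambda>x. D x b) \<in> symbols" if "b \<in> Basis" for b
    unfolding D_def of_real_mult by (intro symbols.intros inverse_ln that)
  moreover have "((\<lambda>x. of_real (inverse (Transcendental.ln (shifted_square lam x)))) has_derivative D x) (at x)" for x
    unfolding D_def using shifted_square_gt_1[OF inverse_ln, of x]
    by (intro radial_has_derivative)
       (auto intro!: derivative_eq_intros simp: powr_minus_divide field_simps power2_eq_square)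
  ultimately show ?case by blast
next
  case (add f g)
  then obtain D E where D: "\<forall>x. (f has_derivative D x) (at x)" "\<forall>b\<in>Basis. (\<lambda>x. D x b) \<in> symbols"
    and E: "\<forall>x. (g has_derivative E x) (at x)" "\<forall>b\<in>Basis. (\<lambda>x. E x b) \<in> symbols"
    by blast
  then show ?case
    by (intro exI[of _ "\<lambda>x h. D x h + E x h"]) (auto intro!: has_derivative_add symbols.add)
next
  case (mult f g)
  then obtain D E where D: "\<forall>x. (f has_derivative D x) (at x)" "\<forall>b\<in>Basis. (\<lambda>x. D x b) \<in> symbols"
    and E: "\<forall>x. (g has_derivative E x) (at x)" "\<forall>b\<in>Basis. (\<lambda>x. E x b) \<in> symbols"
    by blast
  then show ?case using mult.hyps
    by (intro exI[of _ "\<lambda>x h. f x * E x h + D x h * g x"])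
       (auto intro!: has_derivative_mult symbols.add symbols.mult)
qed

lemma shifted_square_le:
  fixes x :: "'a::real_normed_vector"
  assumes "1 < lam"
  shows "shifted_square lam x \<le> (lam + 4 * pi\<^sup>2) * (1 + norm x)\<^sup>2"
  unfolding distrib_right using assms
  by (intro add_mono mult_left_mono power_mono) (auto simp: power2_eq_square algebra_simps)

lemma symbols_slowly_increasing:
  assumes "f \<in> symbols"
  shows "\<exists>C N. C \<ge> 0 \<and> (\<forall>x. norm (f x) \<le> C * (1 + norm x) ^ N)"
  using assms
proof induction
  case (const c)
  show ?case by (intro exI[of _ "norm c"] exI[of _ 0]) auto
next
  case (coord b)
  show ?case
  proof (intro exI[of _ 1] exI[of _ "1::nat"] conjI allI)
    fix x :: 'a
    show "norm (of_real (x \<bullet> b) :: complex) \<le> 1 * (1 + norm x) ^ 1"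
      using Basis_le_norm[OF coord, of x] by simp
  qed simp
next
  case (powr lam a)
  define w where "w x = shifted_square lam x" for x :: 'a
  have w: "w x > 1" for x
    unfolding w_def by (rule shifted_square_gt_1[OF powr])
  define M where "M = nat \<lceil>a\<rceil>"
  have "norm (of_real (w x powr a) :: complex) \<le> (lam + 4 * pi\<^sup>2) ^ M * (1 + norm x) ^ (2 * M)" for x
  proof -
    have "w x powr a \<le> w x powr (real M)"
      using w[of x] by (intro powr_mono) (auto simp: M_def of_nat_ceiling)
    also have "\<dots> = w x ^ M" using w[of x] by (simp add: powr_realpow)
    also have "w x \<le> (lam + 4 * pi\<^sup>2) * (1 + norm x)\<^sup>2"
      unfolding w_def by (rule shifted_square_le[OF powr])
    then have "w x ^ M \<le> ((lam + 4 * pi\<^sup>2) * (1 + norm x)\<^sup>2) ^ M"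
      using w[of x] by (intro power_mono) auto
    finally show ?thesis by (simp add: power_mult_distrib power_mult)
  qed
  then show ?case unfolding w_def using powr
    by (intro exI[of _ "(lam + 4 * pi\<^sup>2) ^ M"] exI[of _ "2*M"]) auto
next
  case (ln lam)
  define w where "w x = shifted_square lam x" for x :: 'a
  have w: "w x > 1" for x
    unfolding w_def by (rule shifted_square_gt_1[OF ln])
  have "norm (of_real (Transcendental.ln (w x)) :: complex) \<le> (lam + 4 * pi\<^sup>2) * (1 + norm x)\<^sup>2" for x
  proof -
    have "0 \<le> Transcendental.ln (w x)"
      using w[of x] by simp
    have "Transcendental.ln (w x) \<le> w x"
      using w[of x] ln_le_minus_one[of "w x"] by simp
    also have "w x \<le> (lam + 4 * pi\<^sup>2) * (1 + norm x)\<^sup>2"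
      unfolding w_def by (rule shifted_square_le[OF ln])
    finally show ?thesis using \<open>0 \<le> _\<close> by simp
  qed
  then show ?case unfolding w_def using ln
    by (intro exI[of _ "(lam + 4 * pi\<^sup>2)"] exI[of _ "2"]) auto
next
  case (inverse_ln lam)
  have "norm (of_real (inverse (Transcendental.ln (shifted_square lam x))) :: complex) \<le> inverse (Transcendental.ln lam)"
    for x :: 'a
  proof -
    have *: "Transcendental.ln lam > 0" "Transcendental.ln lam \<le> Transcendental.ln (shifted_square lam x)"
      using inverse_ln by (auto intro!: ln_mono)
    then show ?thesis
      by (simp only: norm_of_real) (simp add: le_imp_inverse_le abs_of_pos)
  qed
  then show ?case using inverse_ln
    by (intro exI[of _ "inverse (Transcendental.ln lam)"] exI[of _ 0]) auto
next
  case (add f g)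
  then obtain C N D M where C: "C \<ge> 0" "\<forall>x. norm (f x) \<le> C * (1 + norm x) ^ N"
    and D: "D \<ge> 0" "\<forall>x. norm (g x) \<le> D * (1 + norm x) ^ M"
    by blast
  have "norm (f x + g x) \<le> (C + D) * (1 + norm x) ^ (N + M)" for x
  proof -
    have "norm (f x) \<le> C * (1 + norm x) ^ (N + M)"
      using C(2)[rule_format, of x] by (rule order.trans) (intro mult_left_mono power_increasing C; simp)
    moreover have "norm (g x) \<le> D * (1 + norm x) ^ (N + M)"
      using D(2)[rule_format, of x] by (rule order.trans) (intro mult_left_mono power_increasing D; simp)
    ultimately show ?thesis
      by (auto intro!: norm_triangle_le simp: distrib_right)
  qed
  then show ?case using C D by (intro exI[of _ "C + D"] exI[of _ "N + M"]) auto
next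
  case (mult f g)
  then obtain C N D M where C: "C \<ge> 0" "\<forall>x. norm (f x) \<le> C * (1 + norm x) ^ N"
    and D: "D \<ge> 0" "\<forall>x. norm (g x) \<le> D * (1 + norm x) ^ M"
    by blast
  have "norm (f x * g x) \<le> (C * D) * (1 + norm x) ^ (N + M)" for x
    unfolding norm_mult
    by (rule order.trans[OF mult_mono[OF C(2)[rule_format] D(2)[rule_format]]]) (use C in \<open>auto simp: power_add\<close>)
  then show ?case using C D by (intro exI[of _ "C * D"] exI[of _ "N + M"]) auto
qed

text \<open>By the product rule this set is stable under partial derivatives, so coinduction shows
  that it is no larger than the Schwartz space.\<close>

inductive_set schwartz_module :: "('a::euclidean_space \<Rightarrow> complex) set" where
  base: "f \<in> schwartz \<Longrightarrow> f \<in> schwartz_module"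
| add: "f \<in> schwartz_module \<Longrightarrow> g \<in> schwartz_module \<Longrightarrow> (\<lambda>x. f x + g x) \<in> schwartz_module"
| mult: "m \<in> symbols \<Longrightarrow> f \<in> schwartz_module \<Longrightarrow> (\<lambda>x. m x * f x) \<in> schwartz_module"

lemma schwartz_module_subset: "f \<in> schwartz_module \<Longrightarrow> f \<in> schwartz"
proof (erule schwartz_coinduct)
  show "\<exists>D. (\<forall>x. (f has_derivative D x) (at x)) \<and> (\<forall>b\<in>Basis. (\<lambda>x. D x b) \<in> schwartz_module)"
    if "f \<in> schwartz_module" for f :: "'a \<Rightarrow> complex"
    using that
  proof induction
    case (base f)
    then show ?case using schwartz_deriv_ex schwartz_module.base by blast
  next
    case (add f g)
    then obtain D E where D: "\<forall>x. (f has_derivative D x) (at x)" "\<forall>b\<in>Basis. (\<lambda>x. D x b) \<in> schwartz_module"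
      and E: "\<forall>x. (g has_derivative E x) (at x)" "\<forall>b\<in>Basis. (\<lambda>x. E x b) \<in> schwartz_module"
      by blast
    then show ?case
      by (intro exI[of _ "\<lambda>x h. D x h + E x h"]) (auto intro!: has_derivative_add schwartz_module.add)
  next
    case (mult f g)
    then obtain E where E: "\<forall>x. (g has_derivative E x) (at x)" "\<forall>b\<in>Basis. (\<lambda>x. E x b) \<in> schwartz_module"
      by blast
    obtain D where D: "\<forall>x. (f has_derivative D x) (at x)" "\<forall>b\<in>Basis. (\<lambda>x. D x b) \<in> symbols"
      using symbols_has_derivative[OF mult(1)] by blast
    show ?case using mult.hyps D E
      by (intro exI[of _ "\<lambda>x h. f x * E x h + D x h * g x"])
         (auto intro!: has_derivative_mult schwartz_module.add schwartz_module.mult)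
  qed
  show "\<exists>C. \<forall>x. (1 + norm x) ^ N * norm (f x) \<le> C" if "f \<in> schwartz_module" for f :: "'a \<Rightarrow> complex" and N
    using that
  proof (induction arbitrary: N)
    case (base f)
    then show ?case using schwartz_decay by metis
  next
    case (add f g)
    then obtain C D where C: "\<And>x. (1 + norm x) ^ N * norm (f x) \<le> C"
      and D: "\<And>x. (1 + norm x) ^ N * norm (g x) \<le> D" by metis
    have "(1 + norm x) ^ N * norm (f x + g x) \<le> C + D" for x
      by (rule order.trans[OF mult_left_mono[OF norm_triangle_ineq]])
         (use C[of x] D[of x] in \<open>auto simp: distrib_left\<close>)
    then show ?case by blast
  next
    case (mult m f)
    obtain C M where C: "C \<ge> 0" "\<And>x. norm (m x) \<le> C * (1 + norm x) ^ M"
      using symbols_slowly_increasing[OF mult(1)] by blast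
    obtain D where D: "\<And>x. (1 + norm x) ^ (N + M) * norm (f x) \<le> D"
      using mult.IH by blast
    have "(1 + norm x) ^ N * norm (m x * f x) \<le> C * D" for x
    proof -
      have "(1 + norm x) ^ N * norm (m x * f x) \<le> (1 + norm x) ^ N * (C * (1 + norm x) ^ M * norm (f x))"
        unfolding norm_mult by (intro mult_left_mono mult_right_mono C) auto
      also have "\<dots> = C * ((1 + norm x) ^ (N + M) * norm (f x))" by (simp add: power_add mult_ac)
      also have "\<dots> \<le> C * D" by (intro mult_left_mono D C)
      finally show ?thesis .
    qed
    then show ?case by blast
  qed
qed

lemma schwartz_symbol_mult: "m \<in> symbols \<Longrightarrow> f \<in> schwartz \<Longrightarrow> (\<lambda>x. m x * f x) \<in> schwartz"
  by (rule schwartz_module_subset[OF schwartz_module.mult[OF _ schwartz_module.base]])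

text \<open>The derivatives of \<open>m e\<^sup>-\<^sup>P\<close> with a symbol \<open>m\<close>
  have the same form, and the Gaussian decay of \<open>e\<^sup>-\<^sup>P\<close> absorbs every power
  of \<open>1 + |x|\<close>, since \<open>(1 + |x|)\<^sup>K \<le>
  e\<^sup>K\<^sup>|\<^sup>x\<^sup>|\<close>.  This supplies both Gaussians and the smooth
  approximations of indicator functions of cubes used below.\<close>

lemma schwartz_exp_minus:
  fixes P :: "'a::euclidean_space \<Rightarrow> complex"
  assumes P: "P \<in> symbols" and "a > 0" and lower: "\<And>x. a * (norm x)\<^sup>2 - d \<le> Re (P x)"
  shows "(\<lambda>x. exp (- P x)) \<in> schwartz"
proof (rule schwartz_coinduct[of _ "{\<lambda>x. m x * exp (- P x) | m. m \<in> symbols}"])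
  show "(\<lambda>x. exp (- P x)) \<in> {\<lambda>x. m x * exp (- P x) | m. m \<in> symbols}"
    using symbols.const[of 1] by force
next
  fix f assume "f \<in> {\<lambda>x. m x * exp (- P x) | m. m \<in> symbols}"
  then obtain m where m: "m \<in> symbols" "f = (\<lambda>x. m x * exp (- P x))" by blast
  obtain D where D: "\<forall>x. (m has_derivative D x) (at x)" "\<forall>b\<in>Basis. (\<lambda>x. D x b) \<in> symbols"
    using symbols_has_derivative[OF m(1)] by blast
  obtain E where E: "\<forall>x. (P has_derivative E x) (at x)" "\<forall>b\<in>Basis. (\<lambda>x. E x b) \<in> symbols"
    using symbols_has_derivative[OF P] by blast
  have "(f has_derivative (\<lambda>h. (D x h + (-1) * m x * E x h) * exp (- P x))) (at x)" for x
  proof -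
    have "((\<lambda>x. exp (- P x)) has_derivative (\<lambda>h. (- E x h) * exp (- P x))) (at x)"
    proof (rule has_derivative_compose[where g = exp and f = "\<lambda>x. - P x" and g' = "\<lambda>h. h * exp (- P x)", simplified])
      show "((\<lambda>x. - P x) has_derivative (\<lambda>h. - E x h)) (at x)"
        using E(1) by (intro has_derivative_minus) simp
      show "(exp has_derivative (\<lambda>h. h * exp (- P x))) (at (- P x))"
        using DERIV_exp[of "- P x"] unfolding has_field_derivative_def by (rule has_derivative_eq_rhs) (simp add: fun_eq_iff)
    qed
    from has_derivative_mult[OF D(1)[rule_format] this] show ?thesis
      unfolding m by (simp add: algebra_simps)
  qed
  moreover have "(\<lambda>x. (D x b + (-1) * m x * E x b)) \<in> symbols" if "b \<in> Basis" for b
    by (rule symbols.add[OF D(2)[rule_format, OF that]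
          symbols.mult[OF symbols.mult[OF symbols.const m(1)] E(2)[rule_format, OF that]]])
  ultimately show "\<exists>D. (\<forall>x. (f has_derivative D x) (at x)) \<and>
      (\<forall>b\<in>Basis. (\<lambda>x. D x b) \<in> {\<lambda>x. m x * exp (- P x) | m. m \<in> symbols})"
    by (intro exI[of _ "\<lambda>x h. (D x h + (-1) * m x * E x h) * exp (- P x)"] conjI allI ballI CollectI exI[of _ "\<lambda>x. D x b + (-1) * m x * E x b" for b]) auto
next
  fix f N assume "f \<in> {\<lambda>x. m x * exp (- P x) | m. m \<in> symbols}"
  then obtain m where m: "m \<in> symbols" "f = (\<lambda>x. m x * exp (- P x))" by blast
  obtain C M where C: "C \<ge> 0" "\<And>x. norm (m x) \<le> C * (1 + norm x) ^ M"
    using symbols_slowly_increasing[OF m(1)] by blast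
  define K where "K = real (N + M)"
  have "(1 + norm x) ^ N * norm (f x) \<le> C * exp (d + K\<^sup>2 / (4 * a))" for x
  proof -
    have "(1 + norm x) ^ (N + M) \<le> exp (norm x) ^ (N + M)"
      by (intro power_mono) (auto simp: exp_ge_add_one_self)
    also have "\<dots> = exp (K * norm x)" unfolding K_def by (rule exp_of_nat_mult[symmetric])
    also have "K * norm x \<le> a * (norm x)\<^sup>2 + K\<^sup>2 / (4 * a)"
    proof -
      have "0 \<le> (2 * a * norm x - K)\<^sup>2 / (4 * a)" using \<open>a > 0\<close> by simp
      also have "\<dots> = a * (norm x)\<^sup>2 + K\<^sup>2 / (4 * a) - K * norm x"
        using \<open>a > 0\<close> by (simp add: field_simps power2_eq_square)
      finally show ?thesis by simp
    qed
    then have "exp (K * norm x) \<le> exp (a * (norm x)\<^sup>2 + K\<^sup>2 / (4 * a))" by simp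
    finally have 1: "(1 + norm x) ^ (N + M) \<le> exp (a * (norm x)\<^sup>2 + K\<^sup>2 / (4 * a))" .
    have "(1 + norm x) ^ N * norm (f x) \<le> (1 + norm x) ^ N * ((C * (1 + norm x) ^ M) * exp (- Re (P x)))"
      unfolding m norm_mult by (intro mult_left_mono mult_mono C) (auto simp: C)
    also have "\<dots> = C * ((1 + norm x) ^ (N + M) * exp (- Re (P x)))" by (simp add: power_add mult_ac)
    also have "\<dots> \<le> C * (exp (a * (norm x)\<^sup>2 + K\<^sup>2 / (4 * a)) * exp (d - a * (norm x)\<^sup>2))"
      using lower[of x] by (intro mult_left_mono mult_mono 1 C) auto
    also have "\<dots> = C * exp (d + K\<^sup>2 / (4 * a))" by (simp flip: exp_add)
    finally show ?thesis .
  qed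
  then show "\<exists>C. \<forall>x. (1 + norm x) ^ N * norm (f x) \<le> C" by blast
qed

section \<open>Integration over Euclidean space\<close>

lemma cis_measurable [measurable]: "cis \<in> borel_measurable borel"
  by (intro borel_measurable_continuous_onI continuous_intros)

lemma norm_cis_diff_le: "norm (cis t - 1 - \<i> * of_real t) \<le> t\<^sup>2 / 2"
  using iexp_approx1[of t 1] by (simp add: cis_conv_exp algebra_simps power2_eq_square)

text \<open>Since \<open>1 + (x \<bullet> b)\<^sup>2 \<le> (1 + |x|)\<^sup>2\<close> in each
  coordinate, the function is dominated by a product of functions of one variable.\<close>

lemma integrable_inverse_power_norm:
  "integrable lborel (\<lambda>x::'a::euclidean_space. inverse ((1 + norm x) ^ (2 * DIM('a))))"
proof (rule integrableI_bounded)
  have int1: "integrable lborel (\<lambda>x::real. inverse (1 + x\<^sup>2))"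
    using integrable_inverse_1_plus_square by (simp add: set_integrable_def einterval_def)
  have "(\<integral>\<^sup>+ x. ennreal (norm (inverse ((1 + norm x) ^ (2 * DIM('a))))) \<partial>(lborel::'a measure))
      \<le> (\<integral>\<^sup>+ x. (\<Prod>b\<in>Basis. ennreal (inverse (1 + (x \<bullet> b)\<^sup>2))) \<partial>(lborel::'a measure))"
  proof (rule nn_integral_mono)
    fix x :: 'a
    have "(\<Prod>b\<in>Basis. 1 + (x \<bullet> b)\<^sup>2) \<le> (\<Prod>b\<in>(Basis::'a set). (1 + norm x)\<^sup>2)"
    proof (rule prod_mono)
      fix b :: 'a assume b: "b \<in> Basis"
      have "(x \<bullet> b)\<^sup>2 \<le> (norm x)\<^sup>2"
        using Basis_le_norm[OF b, of x] by (metis abs_le_square_iff abs_norm_cancel)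
      then show "0 \<le> 1 + (x \<bullet> b)\<^sup>2 \<and> 1 + (x \<bullet> b)\<^sup>2 \<le> (1 + norm x)\<^sup>2"
        by (simp add: power2_sum add_increasing2)
    qed
    also have "\<dots> = (1 + norm x) ^ (2 * DIM('a))"
      by (simp add: power_mult)
    finally have "inverse ((1 + norm x) ^ (2 * DIM('a))) \<le> inverse (\<Prod>b\<in>Basis. 1 + (x \<bullet> b)\<^sup>2)"
      by (intro le_imp_inverse_le prod_pos) (auto simp: add_pos_nonneg)
    then have "ennreal (norm (inverse ((1 + norm x) ^ (2 * DIM('a))))) \<le> ennreal (\<Prod>b\<in>Basis. inverse (1 + (x \<bullet> b)\<^sup>2))"
      by (simp add: prod_inversef[unfolded o_def] ennreal_leI)
    also have "\<dots> = (\<Prod>b\<in>Basis. ennreal (inverse (1 + (x \<bullet> b)\<^sup>2)))"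
      by (intro prod_ennreal[symmetric]) (auto simp: add_nonneg_nonneg)
    finally show "ennreal (norm (inverse ((1 + norm x) ^ (2 * DIM('a))))) \<le> (\<Prod>b\<in>Basis. ennreal (inverse (1 + (x \<bullet> b)\<^sup>2)))" .
  qed
  also have "\<dots> = (\<Prod>b\<in>(Basis::'a set). (\<integral>\<^sup>+ x. ennreal (inverse (1 + x\<^sup>2)) \<partial>lborel))"
    by (rule nn_integral_lborel_prod) auto
  also have "\<dots> < \<infinity>"
  proof -
    have "(\<integral>\<^sup>+ x. ennreal (inverse (1 + x\<^sup>2)) \<partial>lborel) < \<infinity>"
      using int1 by (simp add: integrable_iff_bounded abs_of_pos add_pos_nonneg)
    then show ?thesis by (simp add: power_less_top_ennreal)
  qed
  finally show "(\<integral>\<^sup>+ x. ennreal (norm (inverse ((1 + norm x) ^ (2 * DIM('a))))) \<partial>(lborel::'a measure)) < \<infinity>" .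
qed measurable

lemma schwartz_norm_power_integrable:
  fixes f :: "'a::euclidean_space \<Rightarrow> complex"
  assumes f: "f \<in> schwartz"
  shows "integrable lborel (\<lambda>x. (norm x) ^ N * norm (f x))"
proof -
  note [measurable] = schwartz_measurable[OF f]
  obtain C where C: "C > 0" "\<And>x. (1 + norm x) ^ (N + 2 * DIM('a)) * norm (f x) \<le> C"
    using schwartz_decay[OF f] by metis
  show ?thesis
  proof (rule Bochner_Integration.integrable_bound)
    show "integrable lborel (\<lambda>x::'a. C * inverse ((1 + norm x) ^ (2 * DIM('a))))"
      using integrable_inverse_power_norm[where 'a = 'a] by simp
    have "norm (norm x ^ N * norm (f x)) \<le> norm (C * inverse ((1 + norm x) ^ (2 * DIM('a))))" for x
    proof -
      have "norm x ^ N * norm (f x) \<le> (1 + norm x) ^ N * norm (f x)"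
        by (intro mult_right_mono power_mono) auto
      also have "\<dots> \<le> C * inverse ((1 + norm x) ^ (2 * DIM('a)))"
      proof -
        have "(1 + norm x) ^ N * norm (f x) * (1 + norm x) ^ (2 * DIM('a)) \<le> C"
          using C(2)[of x] by (simp add: power_add mult_ac)
        moreover have "0 < (1 + norm x) ^ (2 * DIM('a))"
          by (intro zero_less_power) (simp add: add_pos_nonneg)
        ultimately show ?thesis by (simp only: divide_inverse[symmetric] pos_le_divide_eq)
      qed
      finally show ?thesis using C(1) by simp
    qed
    then show "AE x in lborel. norm (norm x ^ N * norm (f x)) \<le> norm (C * inverse ((1 + norm x) ^ (2 * DIM('a))))"
      by simp
  qed measurable
qed

lemma schwartz_integrable:
  fixes f :: "'a::euclidean_space \<Rightarrow> complex"
  assumes f: "f \<in> schwartz"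
  shows "integrable lborel f"
proof (rule integrable_norm_cancel)
  show "integrable lborel (\<lambda>x. norm (f x))"
    using schwartz_norm_power_integrable[OF f, of 0] by simp
qed (use schwartz_measurable[OF f] in simp)

lemma integral_lborel_affine:
  fixes g :: "'a::euclidean_space \<Rightarrow> 'b::{banach, second_countable_topology}"
  assumes [measurable]: "g \<in> borel_measurable borel" and c: "c \<noteq> 0"
  shows "(LINT x|lborel. g x) = \<bar>c\<bar> ^ DIM('a) *\<^sub>R (LINT x|lborel. g (t + c *\<^sub>R x))"
  by (subst lborel_affine[OF c, of t])
     (simp add: integral_density integral_distr)

lemma integrable_lborel_affine:
  fixes g :: "'a::euclidean_space \<Rightarrow> 'b::{banach, second_countable_topology}"
  assumes g: "integrable lborel g" and c: "c \<noteq> 0"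
  shows "integrable lborel (\<lambda>x. g (t + c *\<^sub>R x))"
proof -
  have [measurable]: "g \<in> borel_measurable borel" using g by auto
  from g have "integrable (density (distr lborel borel (\<lambda>x. t + c *\<^sub>R x)) (\<lambda>_. ennreal (\<bar>c\<bar> ^ DIM('a)))) g"
    by (subst (asm) lborel_affine[OF c, of t])
  then have "integrable lborel (\<lambda>x. \<bar>c\<bar> ^ DIM('a) *\<^sub>R g (t + c *\<^sub>R x))"
    by (simp add: integrable_density integrable_distr_eq)
  then have "integrable lborel (\<lambda>x. inverse (\<bar>c\<bar> ^ DIM('a)) *\<^sub>R (\<bar>c\<bar> ^ DIM('a) *\<^sub>R g (t + c *\<^sub>R x)))"
    by (rule integrable_scaleR_right)
  then show ?thesis using c by simp
qed

lemma norm_integral_le: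
  fixes f :: "'a \<Rightarrow> 'b::{banach, second_countable_topology}"
  assumes g: "integrable M g" and fg: "\<And>x. norm (f x) \<le> g x"
  shows "norm (LINT x|M. f x) \<le> (LINT x|M. g x)"
proof (cases "integrable M f")
  case True
  then show ?thesis
    by (intro order.trans[OF integral_norm_bound] integral_mono g fg) auto
next
  case False
  have "0 \<le> g x" for x using fg[of x] norm_ge_zero[of "f x"] by linarith
  then show ?thesis using False by (simp add: not_integrable_integral_eq)
qed

section \<open>The Fourier transform on Schwartz functions\<close>

text \<open>A single real parameter covers the Fourier transform, its inverse, and the Gaussian
  integrals with varying frequency.\<close>

definition osc_transform :: "real \<Rightarrow> ('a::euclidean_space \<Rightarrow> complex) \<Rightarrow> 'a \<Rightarrow> complex" where
  "osc_transform \<sigma> f \<xi> = (LINT x|lborel. f x * cis (\<sigma> * (x \<bullet> \<xi>)))"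

lemma fourier_eq_osc: "fourier = osc_transform (- 2 * pi)"
  by (simp add: fun_eq_iff fourier_def osc_transform_def cis_conv_exp mult_ac)

lemma inv_fourier_eq_osc: "inv_fourier = osc_transform (2 * pi)"
  by (simp add: fun_eq_iff inv_fourier_def osc_transform_def cis_conv_exp mult_ac inner_commute)

lemma integrable_mult_cis:
  "integrable M f \<Longrightarrow> g \<in> borel_measurable M \<Longrightarrow> integrable M (\<lambda>x. f x * cis (g x))"
  by (rule Bochner_Integration.integrable_bound[of M f])
     (auto simp: norm_mult intro!: borel_measurable_times measurable_compose[OF _ cis_measurable])

lemma norm_osc_transform_le: "norm (osc_transform \<sigma> f \<xi>) \<le> (LINT x|lborel. norm (f x))"
  unfolding osc_transform_def
  by (rule order.trans[OF integral_norm_bound]) (simp add: norm_mult)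

lemma schwartz_coord_mult: "f \<in> schwartz \<Longrightarrow> b \<in> Basis \<Longrightarrow> (\<lambda>x. of_real (x \<bullet> b) * f x) \<in> schwartz"
  by (rule schwartz_symbol_mult[OF symbols.coord])

lemma schwartz_cmult: "f \<in> schwartz \<Longrightarrow> (\<lambda>x. c * f x) \<in> schwartz"
  by (rule schwartz_symbol_mult[OF symbols.const])

text \<open>The remainder of the linear approximation is \<open>\<integral> f(x)
  e\<^sup>i\<^sup>\<theta> (e\<^sup>i\<^sup>\<eta> - 1 - i\<eta>) dx\<close> with \<open>\<theta> =
  \<sigma> (x \<bullet> \<xi>)\<close> and \<open>\<eta> = \<sigma> (x \<bullet> h)\<close>; as
  \<open>|e\<^sup>i\<^sup>\<eta> - 1 - i\<eta>| \<le> \<eta>\<^sup>2/2\<close>, it is at most a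
  multiple of \<open>|h|\<^sup>2\<close> times the second moment of \<open>|f|\<close>.\<close>

lemma osc_transform_has_derivative:
  fixes f :: "'a::euclidean_space \<Rightarrow> complex"
  assumes f: "f \<in> schwartz"
  shows "(osc_transform \<sigma> f has_derivative
           (\<lambda>h. osc_transform \<sigma> (\<lambda>x. \<i> * of_real (\<sigma> * (x \<bullet> h)) * f x) \<xi>)) (at \<xi>)"
proof (rule has_derivativeI_sandwich[of 1])
  let ?D = "\<lambda>h. osc_transform \<sigma> (\<lambda>x. \<i> * of_real (\<sigma> * (x \<bullet> h)) * f x) \<xi>"
  note [measurable] = schwartz_measurable[OF f]
  define K where "K = (LINT x|lborel. norm x * norm (f x))"
  define L where "L = (LINT x|lborel. (norm x)\<^sup>2 * norm (f x))"
  note int1 = schwartz_norm_power_integrable[OF f, of 1, simplified]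
  note int2 = schwartz_norm_power_integrable[OF f, of 2]
  have int: "integrable lborel (\<lambda>x. \<i> * of_real (\<sigma> * (x \<bullet> h)) * f x)" for h
  proof (rule Bochner_Integration.integrable_bound)
    show "integrable lborel (\<lambda>x. \<bar>\<sigma>\<bar> * norm h * (norm x * norm (f x)))"
      using int1 by simp
    have "norm (\<i> * of_real (\<sigma> * (x \<bullet> h)) * f x) \<le> norm (\<bar>\<sigma>\<bar> * norm h * (norm x * norm (f x)))" for x
      using mult_left_mono[OF Cauchy_Schwarz_ineq2[of x h], of "\<bar>\<sigma>\<bar> * norm (f x)"]
      by (simp add: norm_mult abs_mult mult_ac)
    then show "AE x in lborel. norm (\<i> * of_real (\<sigma> * (x \<bullet> h)) * f x) \<le> norm (\<bar>\<sigma>\<bar> * norm h * (norm x * norm (f x)))"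
      by simp
  qed measurable
  note int_cis = integrable_mult_cis[OF int, of "\<lambda>x. \<sigma> * (x \<bullet> \<xi>)", simplified]
  show "bounded_linear (\<lambda>h. ?D h)"
  proof (rule bounded_linear_intro[where K = "\<bar>\<sigma>\<bar> * K"])
    fix h k :: 'a
    show "osc_transform \<sigma> (\<lambda>x. \<i> * of_real (\<sigma> * (x \<bullet> (h + k))) * f x) \<xi> =
        ?D h +
        osc_transform \<sigma> (\<lambda>x. \<i> * of_real (\<sigma> * (x \<bullet> k)) * f x) \<xi>"
      unfolding osc_transform_def
      by (subst Bochner_Integration.integral_add[symmetric])
         (use int_cis in \<open>auto intro!: Bochner_Integration.integral_cong simp: inner_add_right algebra_simps\<close>)
  next
    fix r :: real and h :: 'a
    show "osc_transform \<sigma> (\<lambda>x. \<i> * of_real (\<sigma> * (x \<bullet> (r *\<^sub>R h))) * f x) \<xi> =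
        r *\<^sub>R ?D h"
      unfolding osc_transform_def
      by (subst integral_scaleR_right[symmetric])
         (auto intro!: Bochner_Integration.integral_cong simp: scaleR_conv_of_real algebra_simps)
  next
    fix h :: 'a
    have "norm (?D h)
        \<le> (LINT x|lborel. norm (\<i> * of_real (\<sigma> * (x \<bullet> h)) * f x))"
      by (rule norm_osc_transform_le)
    also have "\<dots> \<le> (LINT x|lborel. \<bar>\<sigma>\<bar> * norm h * (norm x * norm (f x)))"
    proof (rule integral_mono)
      show "norm (\<i> * of_real (\<sigma> * (x \<bullet> h)) * f x) \<le> \<bar>\<sigma>\<bar> * norm h * (norm x * norm (f x))" for x
        using mult_left_mono[OF Cauchy_Schwarz_ineq2[of x h], of "\<bar>\<sigma>\<bar> * norm (f x)"]
        by (simp add: norm_mult abs_mult mult_ac)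
    qed (use int int1 in auto)
    also have "\<dots> = norm h * (\<bar>\<sigma>\<bar> * K)"
      unfolding K_def by simp
    finally show "norm (?D h) \<le> norm h * (\<bar>\<sigma>\<bar> * K)" .
  qed
  fix \<eta> :: 'a assume "\<eta> \<noteq> \<xi>"
  define h where "h = \<eta> - \<xi>"
  have "norm (osc_transform \<sigma> f \<eta> - osc_transform \<sigma> f \<xi> - ?D h)
      = norm (LINT x|lborel. f x * cis (\<sigma> * (x \<bullet> \<xi>)) * (cis (\<sigma> * (x \<bullet> h)) - 1 - \<i> * of_real (\<sigma> * (x \<bullet> h))))"
  proof -
    have f1: "integrable lborel (\<lambda>x. f x * cis (\<sigma> * (x \<bullet> \<zeta>)))" for \<zeta>
      by (intro integrable_mult_cis schwartz_integrable f) measurable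
    have "(LINT x|lborel. f x * cis (\<sigma> * (x \<bullet> \<xi>)) * (cis (\<sigma> * (x \<bullet> h)) - 1 - \<i> * of_real (\<sigma> * (x \<bullet> h))))
      = (LINT x|lborel. f x * cis (\<sigma> * (x \<bullet> \<eta>)) - f x * cis (\<sigma> * (x \<bullet> \<xi>))
            - \<i> * of_real (\<sigma> * (x \<bullet> h)) * f x * cis (\<sigma> * (x \<bullet> \<xi>)))"
    proof (rule Bochner_Integration.integral_cong)
      fix x
      have "cis (\<sigma> * (x \<bullet> \<eta>)) = cis (\<sigma> * (x \<bullet> \<xi>)) * cis (\<sigma> * (x \<bullet> h))"
        by (simp add: cis_mult h_def inner_diff_right algebra_simps)
      then show "f x * cis (\<sigma> * (x \<bullet> \<xi>)) * (cis (\<sigma> * (x \<bullet> h)) - 1 - \<i> * of_real (\<sigma> * (x \<bullet> h)))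
        = f x * cis (\<sigma> * (x \<bullet> \<eta>)) - f x * cis (\<sigma> * (x \<bullet> \<xi>))
            - \<i> * of_real (\<sigma> * (x \<bullet> h)) * f x * cis (\<sigma> * (x \<bullet> \<xi>))"
        by (simp add: algebra_simps)
    qed simp
    also have "\<dots> = osc_transform \<sigma> f \<eta> - osc_transform \<sigma> f \<xi> - ?D h"
      unfolding osc_transform_def using f1 int_cis by simp
    finally show ?thesis by simp
  qed
  also have "\<dots> \<le> (LINT x|lborel. (\<sigma>\<^sup>2 / 2 * (norm h)\<^sup>2) * ((norm x)\<^sup>2 * norm (f x)))"
  proof (rule norm_integral_le)
    have *: "norm (f x * cis (\<sigma> * (x \<bullet> \<xi>)) * (cis (\<sigma> * (x \<bullet> h)) - 1 - \<i> * of_real (\<sigma> * (x \<bullet> h))))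
        \<le> (\<sigma>\<^sup>2 / 2 * (norm h)\<^sup>2) * ((norm x)\<^sup>2 * norm (f x))" for x
    proof -
      have "norm (cis (\<sigma> * (x \<bullet> h)) - 1 - \<i> * of_real (\<sigma> * (x \<bullet> h))) \<le> (\<sigma> * (x \<bullet> h))\<^sup>2 / 2"
        by (rule norm_cis_diff_le)
      also have "\<dots> \<le> \<sigma>\<^sup>2 / 2 * ((norm x)\<^sup>2 * (norm h)\<^sup>2)"
        using mult_left_mono[OF Cauchy_Schwarz_ineq[of x h], of "\<sigma>\<^sup>2 / 2"]
        by (simp add: power_mult_distrib power2_norm_eq_inner)
      finally have "norm (cis (\<sigma> * (x \<bullet> h)) - 1 - \<i> * of_real (\<sigma> * (x \<bullet> h))) \<le> \<sigma>\<^sup>2 / 2 * ((norm x)\<^sup>2 * (norm h)\<^sup>2)" .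
      from mult_left_mono[OF this, of "norm (f x)"] show ?thesis
        by (simp add: norm_mult mult_ac)
    qed
    then show "norm (f x * cis (\<sigma> * (x \<bullet> \<xi>)) * (cis (\<sigma> * (x \<bullet> h)) - 1 - \<i> * of_real (\<sigma> * (x \<bullet> h))))
        \<le> (\<sigma>\<^sup>2 / 2 * (norm h)\<^sup>2) * ((norm x)\<^sup>2 * norm (f x))" for x .
  qed (use int2 in simp)
  also have "\<dots> = (\<sigma>\<^sup>2 / 2 * (norm h)\<^sup>2) * L"
    unfolding L_def using int2 by simp
  finally show "norm (osc_transform \<sigma> f \<eta> - osc_transform \<sigma> f \<xi> -
      osc_transform \<sigma> (\<lambda>x. \<i> * of_real (\<sigma> * (x \<bullet> (\<eta> - \<xi>))) * f x) \<xi>) / norm (\<eta> - \<xi>) \<le> \<sigma>\<^sup>2 / 2 * L * norm (\<eta> - \<xi>)"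
    using \<open>\<eta> \<noteq> \<xi>\<close> by (simp add: h_def field_simps power2_eq_square)
next
  show "((\<lambda>\<eta>. \<sigma>\<^sup>2 / 2 * (LINT x|lborel. (norm x)\<^sup>2 * norm (f x)) * norm (\<eta> - \<xi>)) \<longlongrightarrow> 0) (at \<xi>)"
    by (auto intro!: tendsto_eq_intros)
qed simp

lemma difference_quotient_tendsto:
  assumes "(f has_derivative D) (at x)" "b \<noteq> 0"
  shows "(\<lambda>k. (f (x + inverse (real (Suc k)) *\<^sub>R b) - f x) /\<^sub>R inverse (real (Suc k))) \<longlonglongrightarrow> D b"
proof -
  define h where "h k = inverse (real (Suc k))" for k
  interpret D: bounded_linear D using assms(1) by (rule has_derivative_bounded_linear)
  have "(\<lambda>k. h k *\<^sub>R b) \<longlonglongrightarrow> 0"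
    unfolding h_def using tendsto_scaleR[OF LIMSEQ_inverse_real_of_nat tendsto_const[of b]] by simp
  then have "filterlim (\<lambda>k. h k *\<^sub>R b) (at 0) sequentially"
    using assms(2) by (intro filterlim_atI) (auto simp: h_def)
  moreover have "((\<lambda>h. norm (f (x + h) - f x - D h) / norm h) \<longlongrightarrow> 0) (at 0)"
    using assms(1) by (simp add: has_derivative_at)
  ultimately have "(\<lambda>k. norm (f (x + h k *\<^sub>R b) - f x - D (h k *\<^sub>R b)) / norm (h k *\<^sub>R b)) \<longlonglongrightarrow> 0"
    by (rule filterlim_compose[rotated])
  then have "(\<lambda>k. norm b * (norm (f (x + h k *\<^sub>R b) - f x - D (h k *\<^sub>R b)) / norm (h k *\<^sub>R b))) \<longlonglongrightarrow> 0"
    by (rule tendsto_mult_right_zero)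
  moreover have "norm b * (norm (f (x + h k *\<^sub>R b) - f x - D (h k *\<^sub>R b)) / norm (h k *\<^sub>R b))
      = norm ((f (x + h k *\<^sub>R b) - f x) /\<^sub>R h k - D b)" for k
  proof -
    have "h k > 0" by (simp add: h_def)
    then have "(f (x + h k *\<^sub>R b) - f x) /\<^sub>R h k - D b = (f (x + h k *\<^sub>R b) - f x - D (h k *\<^sub>R b)) /\<^sub>R h k"
      by (simp add: D.scaleR scaleR_diff_right)
    then have "norm ((f (x + h k *\<^sub>R b) - f x) /\<^sub>R h k - D b) = norm (f (x + h k *\<^sub>R b) - f x - D (h k *\<^sub>R b)) / h k"
      using \<open>h k > 0\<close> by (simp only: norm_scaleR) (simp add: divide_inverse mult.commute)
    then show ?thesis using assms(2) \<open>h k > 0\<close> by simp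
  qed
  ultimately show ?thesis
    unfolding h_def[symmetric] by (simp add: tendsto_norm_zero_iff LIM_zero_iff)
qed

text \<open>Supplies the integrable majorant for difference quotients.  It is the mean value theorem
  together with the remark that \<open>1 + |x| \<le> 2 (1 + |y|)\<close> for \<open>y\<close> at
  distance at most \<open>1\<close> from \<open>x\<close>.\<close>

lemma schwartz_difference_quotient_bound:
  fixes f :: "'a::euclidean_space \<Rightarrow> complex"
  assumes f: "f \<in> schwartz" and b: "b \<in> Basis"
  obtains C where "C > 0"
    "\<And>x h. 0 < h \<Longrightarrow> h \<le> 1 \<Longrightarrow> norm ((f (x + h *\<^sub>R b) - f x) /\<^sub>R h) \<le> C * inverse ((1 + norm x) ^ N)"
proof -
  obtain C where C: "C > 0" "\<And>x. (1 + norm x) ^ N * norm (partial b f x) \<le> C"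
    using schwartz_decay[OF schwartz_partial[OF f b]] by metis
  have "norm ((f (x + h *\<^sub>R b) - f x) /\<^sub>R h) \<le> (2 ^ N * C) * inverse ((1 + norm x) ^ N)"
    if h: "0 < h" "h \<le> 1" for x h
  proof -
    have bound: "norm (partial b f (x + t *\<^sub>R b)) \<le> (2 ^ N * C) * inverse ((1 + norm x) ^ N)"
      if t: "t \<in> {0..h}" for t
    proof -
      have "norm x \<le> norm (x + t *\<^sub>R b) + norm (t *\<^sub>R b)"
        using norm_triangle_ineq4[of "x + t *\<^sub>R b" "t *\<^sub>R b"] by simp
      then have "1 + norm x \<le> 2 * (1 + norm (x + t *\<^sub>R b))"
        using t h b by simp (smt (verit) norm_ge_zero)
      then have "(1 + norm x) ^ N \<le> (2 * (1 + norm (x + t *\<^sub>R b))) ^ N"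
        by (intro power_mono) auto
      then have "(1 + norm x) ^ N * norm (partial b f (x + t *\<^sub>R b))
          \<le> (2 * (1 + norm (x + t *\<^sub>R b))) ^ N * norm (partial b f (x + t *\<^sub>R b))"
        by (intro mult_right_mono) auto
      also have "\<dots> \<le> 2 ^ N * C"
        unfolding power_mult_distrib using C(2)[of "x + t *\<^sub>R b"] by (simp add: mult.assoc)
      finally show ?thesis by (simp add: field_simps add_pos_nonneg)
    qed
    have "norm (f (x + h *\<^sub>R b) - f (x + 0 *\<^sub>R b)) \<le> (2 ^ N * C) * inverse ((1 + norm x) ^ N) * norm (h - 0)"
    proof (rule differentiable_bound[where S = "{0..h}" and f = "\<lambda>t. f (x + t *\<^sub>R b)"])
      fix t assume t: "t \<in> {0..h}"
      let ?D = "frechet_derivative f (at (x + t *\<^sub>R b))"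
      have D: "(f has_derivative ?D) (at (x + t *\<^sub>R b))"
        by (rule schwartz_has_derivative[OF f])
      have "((\<lambda>t. x + t *\<^sub>R b) has_derivative (\<lambda>s. s *\<^sub>R b)) (at t within {0..h})"
        by (auto intro!: derivative_eq_intros)
      from has_derivative_compose[OF this D]
      show "((\<lambda>t. f (x + t *\<^sub>R b)) has_derivative (\<lambda>s. ?D (s *\<^sub>R b))) (at t within {0..h})" .
      show "onorm (\<lambda>s. ?D (s *\<^sub>R b)) \<le> (2 ^ N * C) * inverse ((1 + norm x) ^ N)"
      proof (rule onorm_le)
        fix s :: real
        have "?D (s *\<^sub>R b) = s *\<^sub>R partial b f (x + t *\<^sub>R b)"
          using linear_cmul[OF bounded_linear.linear[OF has_derivative_bounded_linear[OF D]]]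
          by (simp add: partial_def)
        then show "norm (?D (s *\<^sub>R b)) \<le> (2 ^ N * C) * inverse ((1 + norm x) ^ N) * norm s"
          using mult_left_mono[OF bound[OF t], of "\<bar>s\<bar>"] by (simp add: mult_ac)
      qed
    qed (use h in auto)
    then have "norm (f (x + h *\<^sub>R b) - f x) / h \<le> (2 ^ N * C) * inverse ((1 + norm x) ^ N)"
      using h by (simp add: field_simps)
    then show ?thesis
      using h by (simp only: norm_scaleR) (simp add: divide_inverse mult.commute)
  qed
  then show ?thesis using C by (intro that[of "2 ^ N * C"]) auto
qed

text \<open>Integration by parts without boundary terms or iterated integrals: a translation of
  \<open>f\<close> multiplies its transform by a phase, and the identity is the derivative of this
  relation at translation length zero.\<close>

lemma osc_transform_partial:
  fixes f :: "'a::euclidean_space \<Rightarrow> complex"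
  assumes f: "f \<in> schwartz" and b: "b \<in> Basis"
  shows "osc_transform \<sigma> (partial b f) \<xi> = - \<i> * of_real (\<sigma> * (\<xi> \<bullet> b)) * osc_transform \<sigma> f \<xi>"
proof -
  note [measurable] = schwartz_measurable[OF f] schwartz_measurable[OF schwartz_partial[OF f b]]
  define h where "h k = inverse (real (Suc k))" for k
  have h: "0 < h k" "h k \<le> 1" for k by (auto simp: h_def field_simps)
  define q where "q k x = (f (x + h k *\<^sub>R b) - f x) /\<^sub>R h k" for k x
  obtain C where C: "C > 0" "\<And>x h. 0 < h \<Longrightarrow> h \<le> 1 \<Longrightarrow>
      norm ((f (x + h *\<^sub>R b) - f x) /\<^sub>R h) \<le> C * inverse ((1 + norm x) ^ (2 * DIM('a)))"
    using schwartz_difference_quotient_bound[OF f b] by metis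
  have "(\<lambda>k. LINT x|lborel. q k x * cis (\<sigma> * (x \<bullet> \<xi>))) \<longlonglongrightarrow> (LINT x|lborel. partial b f x * cis (\<sigma> * (x \<bullet> \<xi>)))"
  proof (rule integral_dominated_convergence)
    show "integrable lborel (\<lambda>x::'a. C * inverse ((1 + norm x) ^ (2 * DIM('a))))"
      using integrable_inverse_power_norm[where 'a = 'a] by simp
    have "(\<lambda>k. q k x) \<longlonglongrightarrow> partial b f x" for x
      unfolding q_def h_def partial_def
      by (rule difference_quotient_tendsto[OF schwartz_has_derivative[OF f] nonzero_Basis[OF b]])
    then show "AE x in lborel. (\<lambda>k. q k x * cis (\<sigma> * (x \<bullet> \<xi>))) \<longlonglongrightarrow> partial b f x * cis (\<sigma> * (x \<bullet> \<xi>))"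
      by (intro AE_I2 tendsto_mult tendsto_const)
    show "AE x in lborel. norm (q k x * cis (\<sigma> * (x \<bullet> \<xi>))) \<le> C * inverse ((1 + norm x) ^ (2 * DIM('a)))" for k
      using C(2)[OF h(1)[of k] h(2)[of k]] by (intro AE_I2) (simp add: q_def norm_mult)
  qed (unfold q_def, measurable)
  moreover have "(LINT x|lborel. q k x * cis (\<sigma> * (x \<bullet> \<xi>)))
      = (cis (- \<sigma> * (\<xi> \<bullet> b) * (0 + h k *\<^sub>R 1)) - cis (- \<sigma> * (\<xi> \<bullet> b) * 0)) /\<^sub>R h k * osc_transform \<sigma> f \<xi>" for k
  proof -
    have shift: "(LINT x|lborel. f (x + h k *\<^sub>R b) * cis (\<sigma> * (x \<bullet> \<xi>))) = cis (- \<sigma> * (\<xi> \<bullet> b) * h k) * osc_transform \<sigma> f \<xi>"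
    proof -
      have "(LINT x|lborel. f x * cis (\<sigma> * (x \<bullet> \<xi>)) * cis (- \<sigma> * (\<xi> \<bullet> b) * h k))
          = (LINT x|lborel. f (h k *\<^sub>R b + 1 *\<^sub>R x) * cis (\<sigma> * ((h k *\<^sub>R b + 1 *\<^sub>R x) \<bullet> \<xi>)) * cis (- \<sigma> * (\<xi> \<bullet> b) * h k))"
        by (subst integral_lborel_affine[of _ 1 "h k *\<^sub>R b"]) simp_all
      also have "\<dots> = (LINT x|lborel. f (x + h k *\<^sub>R b) * cis (\<sigma> * (x \<bullet> \<xi>)))"
      proof (rule Bochner_Integration.integral_cong)
        fix x
        have "cis (\<sigma> * ((h k *\<^sub>R b + 1 *\<^sub>R x) \<bullet> \<xi>)) * cis (- \<sigma> * (\<xi> \<bullet> b) * h k) = cis (\<sigma> * (x \<bullet> \<xi>))"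
          by (simp add: cis_mult inner_add_left algebra_simps inner_commute)
        then show "f (h k *\<^sub>R b + 1 *\<^sub>R x) * cis (\<sigma> * ((h k *\<^sub>R b + 1 *\<^sub>R x) \<bullet> \<xi>)) * cis (- \<sigma> * (\<xi> \<bullet> b) * h k)
            = f (x + h k *\<^sub>R b) * cis (\<sigma> * (x \<bullet> \<xi>))"
          by (simp add: mult.assoc add.commute)
      qed simp
      finally show ?thesis by (simp add: osc_transform_def mult.commute)
    qed
    have "integrable lborel (\<lambda>x. f (h k *\<^sub>R b + 1 *\<^sub>R x))"
      by (rule integrable_lborel_affine) (use schwartz_integrable[OF f] in auto)
    then have "integrable lborel (\<lambda>x. f (x + h k *\<^sub>R b))" by (simp add: add.commute)
    then have i1: "integrable lborel (\<lambda>x. f (x + h k *\<^sub>R b) * cis (\<sigma> * (x \<bullet> \<xi>)))"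
      by (rule integrable_mult_cis) measurable
    have i2: "integrable lborel (\<lambda>x. f x * cis (\<sigma> * (x \<bullet> \<xi>)))"
      by (intro integrable_mult_cis schwartz_integrable f) measurable
    have "(LINT x|lborel. q k x * cis (\<sigma> * (x \<bullet> \<xi>)))
        = (LINT x|lborel. (f (x + h k *\<^sub>R b) * cis (\<sigma> * (x \<bullet> \<xi>)) - f x * cis (\<sigma> * (x \<bullet> \<xi>))) /\<^sub>R h k)"
      by (intro Bochner_Integration.integral_cong) (auto simp: q_def left_diff_distrib)
    also have "\<dots> = (cis (- \<sigma> * (\<xi> \<bullet> b) * h k) * osc_transform \<sigma> f \<xi> - osc_transform \<sigma> f \<xi>) /\<^sub>R h k"
      using i1 i2 by (simp add: shift osc_transform_def)
    finally show ?thesis by (simp add: left_diff_distrib)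
  qed
  moreover have "(\<lambda>k. (cis (- \<sigma> * (\<xi> \<bullet> b) * (0 + h k *\<^sub>R 1)) - cis (- \<sigma> * (\<xi> \<bullet> b) * 0)) /\<^sub>R h k * osc_transform \<sigma> f \<xi>)
      \<longlonglongrightarrow> (of_real 1 * (\<i> * of_real (- \<sigma> * (\<xi> \<bullet> b)))) * osc_transform \<sigma> f \<xi>"
    unfolding h_def
  proof (intro tendsto_mult tendsto_const difference_quotient_tendsto)
    let ?a = "- \<sigma> * (\<xi> \<bullet> b)"
    show "((\<lambda>t. cis (?a * t)) has_derivative (\<lambda>t. of_real t * (\<i> * of_real ?a))) (at 0)"
    proof -
      have "((\<lambda>t. \<i> * of_real (?a * t)) has_derivative (\<lambda>t. \<i> * of_real (?a * t))) (at 0)"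
        by (intro has_derivative_mult_right has_derivative_of_real has_derivative_ident)
      moreover have "(exp has_derivative (*) 1) (at (\<i> * complex_of_real (?a * 0)))"
        using DERIV_exp[of "0::complex"] by (simp add: has_field_derivative_def)
      ultimately have "((\<lambda>t. exp (\<i> * complex_of_real (?a * t))) has_derivative (\<lambda>t. 1 * (\<i> * of_real (?a * t)))) (at 0)"
        by (rule has_derivative_compose)
      then show ?thesis by (simp add: cis_conv_exp mult_ac)
    qed
  qed simp
  ultimately show ?thesis
    using LIMSEQ_unique by (fastforce simp: osc_transform_def)
qed

text \<open>Every factor \<open>\<xi> \<bullet> b\<close> can be exchanged for a derivative of
  \<open>f\<close>, whose transform is bounded.\<close>

lemma osc_transform_decay:
  fixes f :: "'a::euclidean_space \<Rightarrow> complex"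
  assumes f: "f \<in> schwartz" and \<sigma>: "\<sigma> \<noteq> 0"
  shows "\<exists>C. \<forall>\<xi>. norm \<xi> ^ N * norm (osc_transform \<sigma> f \<xi>) \<le> C"
  using f
proof (induction N arbitrary: f)
  case 0
  then show ?case using norm_osc_transform_le by auto
next
  case (Suc N)
  have "\<forall>b\<in>Basis. \<exists>C. \<forall>\<xi>. norm \<xi> ^ N * norm (osc_transform \<sigma> (partial b f) \<xi>) \<le> C"
    using Suc schwartz_partial by blast
  then obtain C where C: "\<And>b \<xi>. b \<in> Basis \<Longrightarrow> norm \<xi> ^ N * norm (osc_transform \<sigma> (partial b f) \<xi>) \<le> C b"
    by metis
  have "norm \<xi> ^ Suc N * norm (osc_transform \<sigma> f \<xi>) \<le> (\<Sum>b\<in>Basis. C b) / \<bar>\<sigma>\<bar>" for \<xi> :: 'a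
  proof -
    have "norm \<xi> ^ Suc N * norm (osc_transform \<sigma> f \<xi>) \<le> (\<Sum>b\<in>Basis. \<bar>\<xi> \<bullet> b\<bar>) * (norm \<xi> ^ N * norm (osc_transform \<sigma> f \<xi>))"
      using mult_right_mono[OF norm_le_l1[of \<xi>], of "norm \<xi> ^ N * norm (osc_transform \<sigma> f \<xi>)"]
      by (simp add: mult_ac)
    also have "\<dots> = (\<Sum>b\<in>Basis. norm \<xi> ^ N * norm (osc_transform \<sigma> (partial b f) \<xi>)) / \<bar>\<sigma>\<bar>"
      unfolding sum_distrib_right sum_divide_distrib
      using \<sigma> by (intro sum.cong) (auto simp: osc_transform_partial[OF Suc.prems] norm_mult abs_mult)
    also have "\<dots> \<le> (\<Sum>b\<in>Basis. C b) / \<bar>\<sigma>\<bar>"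
      by (intro divide_right_mono sum_mono C) auto
    finally show ?thesis .
  qed
  then show ?case by blast
qed

lemma osc_transform_schwartz:
  fixes f :: "'a::euclidean_space \<Rightarrow> complex"
  assumes f: "f \<in> schwartz" and \<sigma>: "\<sigma> \<noteq> 0"
  shows "osc_transform \<sigma> f \<in> schwartz"
proof (rule schwartz_coinduct[of _ "osc_transform \<sigma> ` schwartz"])
  fix g :: "'a \<Rightarrow> complex" assume "g \<in> osc_transform \<sigma> ` schwartz"
  then obtain f where f: "f \<in> schwartz" "g = osc_transform \<sigma> f" by blast
  have "(\<lambda>x. \<i> * of_real (\<sigma> * (x \<bullet> b)) * f x) \<in> schwartz" if "b \<in> Basis" for b
    using schwartz_cmult[OF schwartz_coord_mult[OF f(1) that], of "\<i> * of_real \<sigma>"]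
    by (simp add: mult_ac)
  then show "\<exists>D. (\<forall>x. (g has_derivative D x) (at x)) \<and> (\<forall>b\<in>Basis. (\<lambda>x. D x b) \<in> osc_transform \<sigma> ` schwartz)"
    unfolding f(2) using osc_transform_has_derivative[OF f(1), of \<sigma>]
    by (intro exI[of _ "\<lambda>\<xi> h. osc_transform \<sigma> (\<lambda>x. \<i> * of_real (\<sigma> * (x \<bullet> h)) * f x) \<xi>"]) auto
  show "\<exists>C. \<forall>x. (1 + norm x) ^ N * norm (g x) \<le> C" for N
  proof -
    obtain C D where C: "\<And>\<xi>. norm \<xi> ^ 0 * norm (osc_transform \<sigma> f \<xi>) \<le> C"
      and D: "\<And>\<xi>. norm \<xi> ^ N * norm (osc_transform \<sigma> f \<xi>) \<le> D"
      using osc_transform_decay[OF f(1) \<sigma>] by metis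
    have "(1 + norm x) ^ N * norm (g x) \<le> 2 ^ N * (C + D)" for x
    proof -
      have "(1 + norm x) ^ N \<le> 2 ^ N * (1 + norm x ^ N)"
      proof (cases "norm x \<le> 1")
        case True
        then have "(1 + norm x) ^ N \<le> 2 ^ N * 1" by (simp add: power_mono)
        also have "\<dots> \<le> 2 ^ N * (1 + norm x ^ N)" by (intro mult_left_mono) auto
        finally show ?thesis .
      next
        case False
        then have "(1 + norm x) ^ N \<le> (2 * norm x) ^ N" by (intro power_mono) auto
        then show ?thesis by (simp add: power_mult_distrib distrib_left) (smt (verit) zero_le_power)
      qed
      then have "(1 + norm x) ^ N * norm (g x) \<le> 2 ^ N * (1 + norm x ^ N) * norm (g x)"
        by (intro mult_right_mono) auto
      also have "\<dots> \<le> 2 ^ N * (C + D)"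
        using C[of x] D[of x] unfolding f(2) by (simp add: mult.assoc distrib_right)
      finally show ?thesis .
    qed
    then show ?thesis by blast
  qed
qed (use f in blast)

lemma osc_transform_exchange:
  fixes f g :: "'a::euclidean_space \<Rightarrow> complex"
  assumes f: "integrable lborel f" and g: "integrable lborel g"
  shows "(LINT x|lborel. osc_transform \<sigma> f x * g x) = (LINT x|lborel. f x * osc_transform \<sigma> g x)"
proof -
  note [measurable] = borel_measurable_integrable[OF f] borel_measurable_integrable[OF g]
  have "integrable (lborel \<Otimes>\<^sub>M lborel) (\<lambda>(x, y). f x * g y * cis (\<sigma> * (x \<bullet> y)))"
  proof (rule lborel_pair.Fubini_integrable)
    show "integrable lborel (\<lambda>x. LINT y|lborel. norm (case (x, y) of (x, y) \<Rightarrow> f x * g y * cis (\<sigma> * (x \<bullet> y))))"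
      using f by (simp add: norm_mult)
    show "AE x in lborel. integrable lborel (\<lambda>y. case (x, y) of (x, y) \<Rightarrow> f x * g y * cis (\<sigma> * (x \<bullet> y)))"
      using g by (auto intro!: integrable_mult_cis)
  qed measurable
  from lborel_pair.Fubini_integral[OF this]
  have "(LINT y|lborel. LINT x|lborel. f x * g y * cis (\<sigma> * (x \<bullet> y)))
      = (LINT x|lborel. LINT y|lborel. f x * g y * cis (\<sigma> * (x \<bullet> y)))" by simp
  moreover have "(LINT x|lborel. f x * g y * cis (\<sigma> * (x \<bullet> y))) = osc_transform \<sigma> f y * g y" for y
    unfolding osc_transform_def by (subst integral_mult_left_zero[symmetric]) (simp add: mult_ac)
  moreover have "(LINT y|lborel. f x * g y * cis (\<sigma> * (x \<bullet> y))) = f x * osc_transform \<sigma> g x" for x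
    unfolding osc_transform_def by (subst integral_mult_right_zero[symmetric]) (simp add: mult_ac inner_commute)
  ultimately show ?thesis by simp
qed

definition gauss :: "'a::euclidean_space \<Rightarrow> real" where
  "gauss x = exp (- pi * (norm x)\<^sup>2)"

lemma gauss_measurable [measurable]: "gauss \<in> borel_measurable borel"
  unfolding gauss_def[abs_def] by measurable

lemma symbols_sum: "finite A \<Longrightarrow> (\<And>i. i \<in> A \<Longrightarrow> f i \<in> symbols) \<Longrightarrow> (\<lambda>x. \<Sum>i\<in>A. f i x) \<in> symbols"
proof (induction rule: finite_induct)
  case empty
  then show ?case using symbols.const[of 0] by simp
next
  case (insert i A)
  then show ?case using symbols.add[of "f i" "\<lambda>x. \<Sum>i\<in>A. f i x"] by simp
qed

lemma symbols_power: "f \<in> symbols \<Longrightarrow> (\<lambda>x. f x ^ n) \<in> symbols"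
proof (induction n)
  case 0
  show ?case using symbols.const[of 1] by simp
next
  case (Suc n)
  then show ?case using symbols.mult[of f "\<lambda>x. f x ^ n"] by simp
qed

lemma gauss_schwartz: "(\<lambda>x::'a::euclidean_space. complex_of_real (gauss x)) \<in> schwartz"
proof -
  have "(\<lambda>x::'a. of_real pi * (\<Sum>b\<in>Basis. complex_of_real (x \<bullet> b) ^ 2)) \<in> symbols"
    by (intro symbols.mult[OF symbols.const] symbols_sum symbols_power symbols.coord finite_Basis)
  moreover have *: "of_real pi * (\<Sum>b\<in>Basis. complex_of_real (x \<bullet> b) ^ 2) = of_real (pi * (norm x)\<^sup>2)" for x :: 'a
    unfolding power2_norm_eq_inner by (subst euclidean_inner) (simp add: power2_eq_square)
  ultimately have "(\<lambda>x::'a. complex_of_real (pi * (norm x)\<^sup>2)) \<in> symbols" by simp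
  from schwartz_exp_minus[OF this, of pi 0]
  show ?thesis by (simp add: gauss_def exp_of_real[symmetric])
qed

lemma gauss_integral: "(LINT x|lborel. gauss (x::'a::euclidean_space)) = 1"
proof -
  have "has_bochner_integral lborel (\<lambda>x::real. exp (- (0 + sqrt pi * x)\<^sup>2)) (sqrt pi /\<^sub>R \<bar>sqrt pi\<bar>)"
    using has_bochner_integral_even_function[OF gaussian_moment_0]
    by (subst lborel_has_bochner_integral_real_affine_iff[symmetric]) auto
  then have 1: "(\<integral>\<^sup>+ x. ennreal (exp (- pi * x\<^sup>2)) \<partial>(lborel::real measure)) = 1"
    by (subst nn_integral_eq_integral) (auto simp: has_bochner_integral_iff power_mult_distrib)
  have "(\<integral>\<^sup>+ x. ennreal (gauss x) \<partial>(lborel::'a measure)) = (\<integral>\<^sup>+ x. (\<Prod>b\<in>Basis. ennreal (exp (- pi * (x \<bullet> b)\<^sup>2))) \<partial>(lborel::'a measure))"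
  proof (intro nn_integral_cong)
    fix x :: 'a
    have "gauss x = exp (\<Sum>b\<in>Basis. - pi * (x \<bullet> b)\<^sup>2)"
      unfolding gauss_def power2_norm_eq_inner
      by (subst euclidean_inner) (simp add: power2_eq_square sum_distrib_left sum_negf)
    then show "ennreal (gauss x) = (\<Prod>b\<in>Basis. ennreal (exp (- pi * (x \<bullet> b)\<^sup>2)))"
      by (simp add: exp_sum prod_ennreal)
  qed
  also have "\<dots> = 1"
    by (subst nn_integral_lborel_prod) (auto simp: 1[simplified])
  finally have "(\<integral>\<^sup>+ x. ennreal (gauss x) \<partial>(lborel::'a measure)) = 1" .
  then show ?thesis
    by (subst integral_eq_nn_integral) (auto simp: gauss_def)
qed

lemma gauss_has_derivative:
  "((\<lambda>x::'a::euclidean_space. complex_of_real (gauss x)) has_derivative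
     (\<lambda>h. of_real (- 2 * pi * (x \<bullet> h)) * of_real (gauss x))) (at x)"
proof -
  have "(gauss has_derivative (\<lambda>h. - 2 * pi * (x \<bullet> h) * gauss x)) (at x)"
    unfolding gauss_def[abs_def] power2_norm_eq_inner
    by (auto intro!: derivative_eq_intros simp: inner_commute)
  from has_derivative_of_real[OF this] show ?thesis by simp
qed

text \<open>The transform \<open>G\<close> of the Gaussian satisfies the linear equation
  \<open>\<partial>\<^sub>b G = - (\<sigma>\<^sup>2 / 2\<pi>) (\<xi> \<bullet> b) G\<close>, because
  differentiating \<open>G\<close> brings down a factor \<open>x \<bullet> b\<close>, which is a
  derivative of the Gaussian in disguise.  Hence \<open>G\<close> is a multiple of the solution on
  the right, and the factor is the total integral \<open>1\<close>.\<close>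

lemma osc_transform_gauss:
  fixes \<xi> :: "'a::euclidean_space"
  shows "osc_transform \<sigma> (\<lambda>x. of_real (gauss x)) \<xi> = of_real (exp (- (\<sigma>\<^sup>2 * (norm \<xi>)\<^sup>2 / (4 * pi))))"
proof -
  define \<gamma> where "\<gamma> x = complex_of_real (gauss x)" for x :: 'a
  define G where "G = osc_transform \<sigma> \<gamma>"
  have \<gamma>: "\<gamma> \<in> schwartz" unfolding \<gamma>_def[abs_def] by (rule gauss_schwartz)
  define D where "D \<xi> h = osc_transform \<sigma> (\<lambda>x. \<i> * of_real (\<sigma> * (x \<bullet> h)) * \<gamma> x) \<xi>" for \<xi> h
  have D: "(G has_derivative D \<xi>) (at \<xi>)" for \<xi>
    unfolding G_def D_def by (rule osc_transform_has_derivative[OF \<gamma>])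
  have Db: "D \<xi> b = - of_real (\<sigma>\<^sup>2 / (2 * pi)) * of_real (\<xi> \<bullet> b) * G \<xi>" if b: "b \<in> Basis" for \<xi> b
  proof -
    have "partial b \<gamma> = (\<lambda>x. of_real (- 2 * pi * (x \<bullet> b)) * \<gamma> x)"
      unfolding \<gamma>_def[abs_def] by (rule partial_eqI) (rule gauss_has_derivative)
    then have "(\<lambda>x. \<i> * of_real (\<sigma> * (x \<bullet> b)) * \<gamma> x) = (\<lambda>x. (- \<i> * of_real (\<sigma> / (2 * pi))) * partial b \<gamma> x)"
      by (simp add: fun_eq_iff field_simps)
    then have "D \<xi> b = (- \<i> * of_real (\<sigma> / (2 * pi))) * osc_transform \<sigma> (partial b \<gamma>) \<xi>"
      by (simp add: D_def osc_transform_def mult.assoc)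
    then show ?thesis
      by (simp add: osc_transform_partial[OF \<gamma> b] G_def power2_eq_square field_simps)
  qed
  have D': "D \<xi> h = - of_real (\<sigma>\<^sup>2 / (2 * pi)) * of_real (\<xi> \<bullet> h) * G \<xi>" for \<xi> h
  proof -
    interpret bounded_linear "D \<xi>" using D by (rule has_derivative_bounded_linear)
    have "D \<xi> h = D \<xi> (\<Sum>b\<in>Basis. (h \<bullet> b) *\<^sub>R b)" by (simp add: euclidean_representation)
    also have "\<dots> = (\<Sum>b\<in>Basis. (h \<bullet> b) *\<^sub>R D \<xi> b)" by (simp add: sum scaleR)
    also have "\<dots> = (\<Sum>b\<in>Basis. - of_real (\<sigma>\<^sup>2 / (2 * pi)) * of_real ((\<xi> \<bullet> b) * (h \<bullet> b)) * G \<xi>)"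
      by (intro sum.cong) (auto simp: Db scaleR_conv_of_real)
    also have "\<dots> = - of_real (\<sigma>\<^sup>2 / (2 * pi)) * of_real (\<xi> \<bullet> h) * G \<xi>"
      by (subst euclidean_inner[of \<xi> h]) (simp add: sum_distrib_left sum_distrib_right sum_negf sum_divide_distrib mult_ac)
    finally show ?thesis .
  qed
  \<comment> \<open>Integrating factor: the product of \<open>G\<close> and \<open>E\<close> has
    derivative zero.\<close>
  define E where "E \<xi> = complex_of_real (exp (\<sigma>\<^sup>2 / (4 * pi) * (norm \<xi>)\<^sup>2))" for \<xi> :: 'a
  have "((\<lambda>\<xi>. G \<xi> * E \<xi>) has_derivative (\<lambda>h. 0)) (at \<xi>)" for \<xi>
  proof -
    have "((\<lambda>\<xi>. exp (\<sigma>\<^sup>2 / (4 * pi) * (\<xi> \<bullet> \<xi>))) has_derivative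
        (\<lambda>h. \<sigma>\<^sup>2 / (2 * pi) * (\<xi> \<bullet> h) * exp (\<sigma>\<^sup>2 / (4 * pi) * (\<xi> \<bullet> \<xi>)))) (at \<xi>)"
      by (auto intro!: derivative_eq_intros simp: inner_commute field_simps)
    from has_derivative_of_real[OF this]
    have "(E has_derivative (\<lambda>h. of_real (\<sigma>\<^sup>2 / (2 * pi)) * of_real (\<xi> \<bullet> h) * E \<xi>)) (at \<xi>)"
      by (simp only: of_real_mult E_def[abs_def] power2_norm_eq_inner)
    from has_derivative_mult[OF D this] show ?thesis
      by (rule has_derivative_eq_rhs) (simp add: D' fun_eq_iff)
  qed
  then have "\<exists>c. \<forall>\<xi>\<in>UNIV. G \<xi> * E \<xi> = c"
    by (intro has_derivative_zero_constant) auto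
  then have "G \<xi> * E \<xi> = G 0 * E 0" by auto
  also have "G 0 * E 0 = 1"
    by (simp add: G_def E_def osc_transform_def \<gamma>_def gauss_integral)
  finally have "G \<xi> = 1 / E \<xi>" by (simp add: E_def field_simps)
  also have "\<dots> = of_real (exp (- (\<sigma>\<^sup>2 * (norm \<xi>)\<^sup>2 / (4 * pi))))"
    by (simp add: E_def exp_minus inverse_eq_divide)
  finally show ?thesis unfolding G_def \<gamma>_def[abs_def] .
qed

text \<open>The Gaussian is its own transform at \<open>\<sigma> = \<plusminus>2\<pi>\<close>.
  Moving the transform from the Gaussian to \<open>f(x + e \<cdot>)\<close> gives \<open>\<integral>
  f(x + e z) \<gamma>(z) dz = \<integral> F(\<eta>)
  e\<^sup>-\<^sup>i\<^sup>\<sigma>\<^sup>\<eta>\<^sup>x \<gamma>(e \<eta>) d\<eta>\<close>, and for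
  \<open>e\<close> tending to zero the two sides tend to \<open>f x\<close> and to the inverse
  transform.\<close>

theorem osc_transform_inverse:
  fixes f :: "'a::euclidean_space \<Rightarrow> complex"
  assumes f: "f \<in> schwartz" and \<sigma>: "\<sigma>\<^sup>2 = 4 * pi\<^sup>2"
  shows "osc_transform (- \<sigma>) (osc_transform \<sigma> f) x = f x"
proof -
  have \<sigma>0: "\<sigma> \<noteq> 0" using \<sigma> by auto
  define F where "F = osc_transform \<sigma> f"
  have F: "F \<in> schwartz" unfolding F_def by (rule osc_transform_schwartz[OF f \<sigma>0])
  define \<gamma> where "\<gamma> x = complex_of_real (gauss x)" for x :: 'a
  have \<gamma>: "\<gamma> \<in> schwartz" unfolding \<gamma>_def[abs_def] by (rule gauss_schwartz)
  have \<gamma>_self: "osc_transform \<sigma> \<gamma> = \<gamma>"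
    unfolding \<gamma>_def[abs_def]
    by (rule ext) (simp only: osc_transform_gauss \<sigma>, simp add: gauss_def power2_eq_square)
  note [measurable] = schwartz_measurable[OF f] schwartz_measurable[OF F] schwartz_measurable[OF \<gamma>]
  have eq: "(LINT z|lborel. f (x + e *\<^sub>R z) * \<gamma> z) = (LINT \<eta>|lborel. F \<eta> * cis (- \<sigma> * (\<eta> \<bullet> x)) * \<gamma> (e *\<^sub>R \<eta>))"
    if e: "e > 0" for e
  proof -
    have int: "integrable lborel (\<lambda>z. f (x + e *\<^sub>R z))"
      using e by (intro integrable_lborel_affine schwartz_integrable f) auto
    have 1: "osc_transform \<sigma> (\<lambda>z. f (x + e *\<^sub>R z)) (e *\<^sub>R \<eta>) = inverse (e ^ DIM('a)) *\<^sub>R (F \<eta> * cis (- \<sigma> * (\<eta> \<bullet> x)))" for \<eta>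
    proof -
      have "F \<eta> = \<bar>e\<bar> ^ DIM('a) *\<^sub>R (LINT z|lborel. f (x + e *\<^sub>R z) * cis (\<sigma> * ((x + e *\<^sub>R z) \<bullet> \<eta>)))"
        unfolding F_def osc_transform_def by (rule integral_lborel_affine) (use e in auto)
      also have "(LINT z|lborel. f (x + e *\<^sub>R z) * cis (\<sigma> * ((x + e *\<^sub>R z) \<bullet> \<eta>)))
          = (LINT z|lborel. cis (\<sigma> * (\<eta> \<bullet> x)) * (f (x + e *\<^sub>R z) * cis (\<sigma> * (z \<bullet> (e *\<^sub>R \<eta>)))))"
      proof (rule Bochner_Integration.integral_cong)
        fix z
        have "cis (\<sigma> * ((x + e *\<^sub>R z) \<bullet> \<eta>)) = cis (\<sigma> * (\<eta> \<bullet> x)) * cis (\<sigma> * (z \<bullet> (e *\<^sub>R \<eta>)))"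
          by (simp add: cis_mult inner_add_left inner_commute algebra_simps)
        then show "f (x + e *\<^sub>R z) * cis (\<sigma> * ((x + e *\<^sub>R z) \<bullet> \<eta>)) = cis (\<sigma> * (\<eta> \<bullet> x)) * (f (x + e *\<^sub>R z) * cis (\<sigma> * (z \<bullet> (e *\<^sub>R \<eta>))))"
          by simp
      qed simp
      also have "\<dots> = cis (\<sigma> * (\<eta> \<bullet> x)) * osc_transform \<sigma> (\<lambda>z. f (x + e *\<^sub>R z)) (e *\<^sub>R \<eta>)"
        by (simp add: osc_transform_def)
      finally have "F \<eta> * cis (- \<sigma> * (\<eta> \<bullet> x)) = \<bar>e\<bar> ^ DIM('a) *\<^sub>R
          ((cis (\<sigma> * (\<eta> \<bullet> x)) * cis (- \<sigma> * (\<eta> \<bullet> x))) * osc_transform \<sigma> (\<lambda>z. f (x + e *\<^sub>R z)) (e *\<^sub>R \<eta>))"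
        by (simp add: mult_ac)
      then show ?thesis using e by (simp add: cis_mult)
    qed
    have "(LINT z|lborel. f (x + e *\<^sub>R z) * \<gamma> z) = (LINT z|lborel. f (x + e *\<^sub>R z) * osc_transform \<sigma> \<gamma> z)"
      by (simp add: \<gamma>_self)
    also have "\<dots> = (LINT \<xi>|lborel. osc_transform \<sigma> (\<lambda>z. f (x + e *\<^sub>R z)) \<xi> * \<gamma> \<xi>)"
      by (rule osc_transform_exchange[symmetric]) (use int schwartz_integrable[OF \<gamma>] in auto)
    also have "\<dots> = \<bar>e\<bar> ^ DIM('a) *\<^sub>R (LINT \<eta>|lborel. osc_transform \<sigma> (\<lambda>z. f (x + e *\<^sub>R z)) (0 + e *\<^sub>R \<eta>) * \<gamma> (0 + e *\<^sub>R \<eta>))"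
    proof (rule integral_lborel_affine)
      have "osc_transform \<sigma> (\<lambda>z. f (x + e *\<^sub>R z)) = (\<lambda>\<xi>. osc_transform \<sigma> (\<lambda>z. f (x + e *\<^sub>R z)) (e *\<^sub>R (inverse e *\<^sub>R \<xi>)))"
        using e by simp
      also have "\<dots> \<in> borel_measurable borel" unfolding 1 by measurable
      finally have [measurable]: "osc_transform \<sigma> (\<lambda>z. f (x + e *\<^sub>R z)) \<in> borel_measurable borel" .
      show "(\<lambda>\<xi>. osc_transform \<sigma> (\<lambda>z. f (x + e *\<^sub>R z)) \<xi> * \<gamma> \<xi>) \<in> borel_measurable borel" by measurable
    qed (use e in auto)
    also have "\<dots> = (LINT \<eta>|lborel. F \<eta> * cis (- \<sigma> * (\<eta> \<bullet> x)) * \<gamma> (e *\<^sub>R \<eta>))"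
      using e by (simp add: 1)
    finally show ?thesis .
  qed
  define h where "h k = inverse (real (Suc k))" for k
  have h: "0 < h k" for k by (simp add: h_def)
  have h0: "h \<longlonglongrightarrow> 0" unfolding h_def[abs_def] by (rule LIMSEQ_inverse_real_of_nat)
  obtain C where C: "C > 0" "\<And>x. (1 + norm x) ^ 0 * norm (f x) \<le> C"
    using schwartz_decay[OF f] by metis
  have tends: "isCont f y" "isCont \<gamma> y" for y
    using schwartz_continuous[OF f] schwartz_continuous[OF \<gamma>] by (auto simp: continuous_on_eq_continuous_at)
  have "(\<lambda>k. LINT z|lborel. f (x + h k *\<^sub>R z) * \<gamma> z) \<longlonglongrightarrow> (LINT z|lborel. f x * \<gamma> z)"
  proof (rule integral_dominated_convergence)
    show "integrable lborel (\<lambda>z. C * norm (\<gamma> z))"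
      using schwartz_integrable[OF \<gamma>] by simp
    have "(\<lambda>k. f (x + h k *\<^sub>R z)) \<longlonglongrightarrow> f x" for z
      by (rule isCont_tendsto_compose[OF tends(1)]) (auto intro!: tendsto_eq_intros h0)
    then show "AE z in lborel. (\<lambda>k. f (x + h k *\<^sub>R z) * \<gamma> z) \<longlonglongrightarrow> f x * \<gamma> z"
      by (auto intro!: tendsto_mult_right)
    show "AE z in lborel. norm (f (x + h k *\<^sub>R z) * \<gamma> z) \<le> C * norm (\<gamma> z)" for k
      using C by (auto simp: norm_mult intro!: mult_right_mono)
  qed measurable
  also have "(LINT z|lborel. f x * \<gamma> z) = f x"
    by (simp add: \<gamma>_def gauss_integral)
  finally have 1: "(\<lambda>k. LINT z|lborel. f (x + h k *\<^sub>R z) * \<gamma> z) \<longlonglongrightarrow> f x" .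
  have "(\<lambda>k. LINT \<eta>|lborel. F \<eta> * cis (- \<sigma> * (\<eta> \<bullet> x)) * \<gamma> (h k *\<^sub>R \<eta>)) \<longlonglongrightarrow> (LINT \<eta>|lborel. F \<eta> * cis (- \<sigma> * (\<eta> \<bullet> x)))"
  proof (rule integral_dominated_convergence)
    show "integrable lborel (\<lambda>z. norm (F z))"
      using schwartz_integrable[OF F] by simp
    have "(\<lambda>k. \<gamma> (h k *\<^sub>R \<eta>)) \<longlonglongrightarrow> \<gamma> 0" for \<eta>
      by (rule isCont_tendsto_compose[OF tends(2)]) (auto intro!: tendsto_eq_intros h0)
    moreover have "\<gamma> 0 = 1" by (simp add: \<gamma>_def gauss_def)
    ultimately have "(\<lambda>k. F \<eta> * cis (- \<sigma> * (\<eta> \<bullet> x)) * \<gamma> (h k *\<^sub>R \<eta>)) \<longlonglongrightarrow> F \<eta> * cis (- \<sigma> * (\<eta> \<bullet> x)) * 1" for \<eta>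
      by (intro tendsto_mult tendsto_const) auto
    then show "AE \<eta> in lborel. (\<lambda>k. F \<eta> * cis (- \<sigma> * (\<eta> \<bullet> x)) * \<gamma> (h k *\<^sub>R \<eta>)) \<longlonglongrightarrow> F \<eta> * cis (- \<sigma> * (\<eta> \<bullet> x))"
      by simp
    show "AE \<eta> in lborel. norm (F \<eta> * cis (- \<sigma> * (\<eta> \<bullet> x)) * \<gamma> (h k *\<^sub>R \<eta>)) \<le> norm (F \<eta>)" for k
      by (auto simp: norm_mult \<gamma>_def gauss_def intro!: mult_left_le)
  qed measurable
  then have "(\<lambda>k. LINT z|lborel. f (x + h k *\<^sub>R z) * \<gamma> z) \<longlonglongrightarrow> osc_transform (- \<sigma>) F x"
    by (simp add: eq[OF h] osc_transform_def)
  from LIMSEQ_unique[OF this 1] show ?thesis by (simp add: F_def)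
qed

section \<open>Functions determined by their action on Schwartz functions\<close>

text \<open>This space contains the Lebesgue spaces of all exponents in \<open>[1,
  \<infinity>]\<close>, and it is all that pairing with Schwartz functions needs.\<close>

definition L1_plus_Linf :: "('a::euclidean_space \<Rightarrow> complex) set" where
  "L1_plus_Linf = {f \<in> borel_measurable borel. \<exists>a \<ge> 0. \<exists>b. integrable lborel b \<and> (\<forall>x. 0 \<le> b x) \<and>
     (AE x in lborel. norm (f x) \<le> a + b x)}"

lemma L1_plus_Linf_measurable [measurable_dest]: "f \<in> L1_plus_Linf \<Longrightarrow> f \<in> borel_measurable borel"
  by (simp add: L1_plus_Linf_def)

lemma L1_plus_LinfE:
  assumes "f \<in> L1_plus_Linf"
  obtains a b where "a \<ge> 0" "integrable lborel b" "\<And>x. 0 \<le> b x" "AE x in lborel. norm (f x) \<le> a + b x"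
  using assms by (auto simp: L1_plus_Linf_def)

lemma L1_plus_Linf_diff:
  assumes f: "f \<in> L1_plus_Linf" and g: "g \<in> L1_plus_Linf"
  shows "(\<lambda>x. f x - g x) \<in> L1_plus_Linf"
proof -
  note [measurable] = L1_plus_Linf_measurable[OF f] L1_plus_Linf_measurable[OF g]
  obtain a b where ab: "a \<ge> 0" "integrable lborel b" "\<And>x. 0 \<le> b x" "AE x in lborel. norm (f x) \<le> a + b x"
    using L1_plus_LinfE[OF f] by metis
  obtain c d where cd: "c \<ge> 0" "integrable lborel d" "\<And>x. 0 \<le> d x" "AE x in lborel. norm (g x) \<le> c + d x"
    using L1_plus_LinfE[OF g] by metis
  have "AE x in lborel. norm (f x - g x) \<le> (a + c) + (b x + d x)"
    using ab(4) cd(4)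
  proof eventually_elim
    case (elim x)
    then show ?case using norm_triangle_ineq4[of "f x" "g x"] by linarith
  qed
  then show ?thesis
    unfolding L1_plus_Linf_def using ab cd
    by (intro CollectI conjI exI[of _ "a + c"] exI[of _ "\<lambda>x. b x + d x"]) auto
qed

lemma schwartz_bounded:
  assumes "\<phi> \<in> schwartz"
  obtains K where "K > 0" "\<And>x. norm (\<phi> x) \<le> K"
  using schwartz_decay[OF assms, of 0] by auto

lemma L1_plus_Linf_integrable_mult:
  assumes f: "f \<in> L1_plus_Linf" and \<phi>: "\<phi> \<in> schwartz"
  shows "integrable lborel (\<lambda>x. f x * \<phi> x)"
proof -
  note [measurable] = L1_plus_Linf_measurable[OF f] schwartz_measurable[OF \<phi>]
  obtain a b where ab: "a \<ge> 0" "integrable lborel b" "\<And>x. 0 \<le> b x" "AE x in lborel. norm (f x) \<le> a + b x"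
    using L1_plus_LinfE[OF f] by metis
  obtain K where K: "K > 0" "\<And>x. norm (\<phi> x) \<le> K"
    using schwartz_bounded[OF \<phi>] by metis
  show ?thesis
  proof (rule Bochner_Integration.integrable_bound)
    show "integrable lborel (\<lambda>x. a * norm (\<phi> x) + b x * K)"
      using ab schwartz_integrable[OF \<phi>] by auto
    show "AE x in lborel. norm (f x * \<phi> x) \<le> norm (a * norm (\<phi> x) + b x * K)"
      using ab(4)
    proof eventually_elim
      case (elim x)
      have "norm (f x * \<phi> x) \<le> (a + b x) * norm (\<phi> x)"
        unfolding norm_mult by (intro mult_right_mono elim) auto
      also have "\<dots> \<le> a * norm (\<phi> x) + b x * K"
        using K(2)[of x] ab(3)[of x] by (simp add: distrib_right mult_left_mono)
      finally show ?case by simp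
    qed
  qed measurable
qed

lemma L1_plus_Linf_integrable_on_cbox:
  fixes f :: "'a::euclidean_space \<Rightarrow> complex"
  assumes f: "f \<in> L1_plus_Linf"
  shows "set_integrable lborel (cbox l u) f"
proof -
  note [measurable] = L1_plus_Linf_measurable[OF f]
  obtain a b where ab: "a \<ge> 0" "integrable lborel b" "\<And>x. 0 \<le> b x" "AE x in lborel. norm (f x) \<le> a + b x"
    using L1_plus_LinfE[OF f] by metis
  show ?thesis
    unfolding set_integrable_def
  proof (rule Bochner_Integration.integrable_bound)
    have "emeasure lborel (cbox l u) < \<infinity>" by (simp add: emeasure_lborel_cbox_eq)
    then show "integrable lborel (\<lambda>x. a * indicat_real (cbox l u) x + b x)"
      using ab by (intro Bochner_Integration.integrable_add integrable_mult_right integrable_real_indicator) auto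
    show "AE x in lborel. norm (indicat_real (cbox l u) x *\<^sub>R f x) \<le> norm (a * indicat_real (cbox l u) x + b x)"
      using ab(4) by eventually_elim (use ab in \<open>auto simp: indicator_def\<close>)
  qed measurable
qed

lemma le_power_Suc_plus_1:
  fixes z :: real
  assumes "0 \<le> z"
  shows "z \<le> z ^ Suc k + 1"
proof (cases "z \<le> 1")
  case True
  then show ?thesis using assms by (simp add: add_increasing)
next
  case False
  then have "z ^ 1 \<le> z ^ Suc k" by (intro power_increasing) auto
  then show ?thesis by simp
qed

text \<open>These functions converge, for growing \<open>k\<close>, to the indicator function of the
  cube with centre \<open>c\<close> and half side \<open>r\<close>, except on its boundary.  As
  exponentials of polynomials they are Schwartz functions for an elementary reason, unlike compactly
  supported bump functions.\<close>

lemma flat_top_schwartz: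
  fixes c :: "'a::euclidean_space"
  assumes r: "r > 0"
  shows "(\<lambda>x. of_real (exp (- (\<Sum>b\<in>Basis. (((x - c) \<bullet> b) / r) ^ (2 * Suc k))))) \<in> (schwartz :: ('a \<Rightarrow> complex) set)"
proof -
  define P where "P x = (\<Sum>b\<in>Basis. (of_real (1 / r) * (of_real (x \<bullet> b) + of_real (- (c \<bullet> b)))) ^ (2 * Suc k) :: complex)" for x :: 'a
  have P_eq: "P x = of_real (\<Sum>b\<in>Basis. (((x - c) \<bullet> b) / r) ^ (2 * Suc k))" for x
    unfolding P_def of_real_sum by (intro sum.cong) (simp_all add: inner_diff_left del: power_Suc mult_Suc_right)
  have P: "P \<in> symbols"
    unfolding P_def[abs_def]
    by (intro symbols_sum symbols_power symbols.mult[OF symbols.const] symbols.add[OF _ symbols.const] symbols.coord finite_Basis)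
  have "(\<lambda>x. exp (- P x)) \<in> schwartz"
  proof (rule schwartz_exp_minus[OF P, where a = "1 / (2 * r\<^sup>2)" and d = "(norm c)\<^sup>2 / r\<^sup>2 + DIM('a)"])
    fix x :: 'a
    \<comment> \<open>Comparison with the Gaussian centred at the origin.\<close>
    have "(norm x)\<^sup>2 \<le> 2 * (norm (x - c))\<^sup>2 + 2 * (norm c)\<^sup>2"
    proof -
      have "(norm x)\<^sup>2 \<le> (norm (x - c) + norm c)\<^sup>2"
        using norm_triangle_ineq[of "x - c" c] by (intro power_mono) auto
      also have "\<dots> \<le> 2 * (norm (x - c))\<^sup>2 + 2 * (norm c)\<^sup>2"
        using zero_le_power2[of "norm (x - c) - norm c"] by (simp add: power2_eq_square algebra_simps)
      finally show ?thesis .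
    qed
    then have "1 / (2 * r\<^sup>2) * (norm x)\<^sup>2 - (norm c)\<^sup>2 / r\<^sup>2 \<le> (norm (x - c))\<^sup>2 / r\<^sup>2"
    proof -
      from divide_right_mono[OF \<open>(norm x)\<^sup>2 \<le> _\<close>, of "2 * r\<^sup>2"] show ?thesis
        by (simp add: add_divide_distrib)
    qed
    also have "\<dots> = (\<Sum>b\<in>Basis. (((x - c) \<bullet> b) / r)\<^sup>2)"
      unfolding power2_norm_eq_inner
      by (subst euclidean_inner) (simp add: power_divide sum_divide_distrib power2_eq_square)
    also have "\<dots> \<le> (\<Sum>b\<in>(Basis::'a set). (((x - c) \<bullet> b) / r) ^ (2 * Suc k) + 1)"
    proof (rule sum_mono)
      fix b :: 'a
      show "(((x - c) \<bullet> b) / r)\<^sup>2 \<le> (((x - c) \<bullet> b) / r) ^ (2 * Suc k) + 1"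
        unfolding power_mult by (rule le_power_Suc_plus_1) simp
    qed
    finally show "1 / (2 * r\<^sup>2) * (norm x)\<^sup>2 - ((norm c)\<^sup>2 / r\<^sup>2 + DIM('a)) \<le> Re (P x)"
      by (simp add: P_eq sum.distrib)
  qed (use r in auto)
  then show ?thesis unfolding P_eq by (simp only: of_real_minus[symmetric] exp_of_real)
qed

text \<open>A majorant that does not depend on \<open>k\<close> and is itself a multiple of the
  first function of the sequence.\<close>

lemma flat_top_dominated:
  fixes y :: "'a::euclidean_space \<Rightarrow> real"
  shows "exp (- (\<Sum>b\<in>Basis. y b ^ (2 * Suc k))) \<le> exp (DIM('a)) * exp (- (\<Sum>b\<in>Basis. y b ^ (2 * Suc 0)))"
proof -
  have "(\<Sum>b\<in>(Basis::'a set). y b ^ (2 * Suc 0)) \<le> (\<Sum>b\<in>(Basis::'a set). y b ^ (2 * Suc k) + 1)"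
  proof (rule sum_mono)
    fix b :: 'a
    show "y b ^ (2 * Suc 0) \<le> y b ^ (2 * Suc k) + 1"
      using le_power_Suc_plus_1[of "(y b)\<^sup>2" k] unfolding power_mult by simp
  qed
  then show ?thesis by (simp add: sum.distrib flip: exp_add)
qed

text \<open>The flat-top functions converge to the indicator function of the cube almost everywhere,
  and dominated convergence carries the vanishing of the integrals to the limit.\<close>

lemma L1_plus_Linf_integral_cube_eq_0:
  fixes f :: "'a::euclidean_space \<Rightarrow> complex"
  assumes f: "f \<in> L1_plus_Linf" and zero: "\<And>\<phi>. \<phi> \<in> schwartz \<Longrightarrow> (LINT x|lborel. f x * \<phi> x) = 0"
    and h: "h > 0"
  shows "(LINT x:cbox l (l + h *\<^sub>R One)|lborel. f x) = 0"
proof -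
  note [measurable] = L1_plus_Linf_measurable[OF f]
  define u where "u = l + h *\<^sub>R One"
  define r where "r = h / 2"
  define c where "c = l + r *\<^sub>R One"
  have r: "r > 0" using h by (simp add: r_def)
  define y where "y x b = ((x - c) \<bullet> b) / r" for x b :: 'a
  define \<phi> where "\<phi> k x = complex_of_real (exp (- (\<Sum>b\<in>Basis. y x b ^ (2 * Suc k))))" for k and x :: 'a
  have \<phi>: "\<phi> k \<in> schwartz" for k
    using flat_top_schwartz[OF r, of c k] by (simp only: \<phi>_def[abs_def] y_def)
  have inside: "x \<in> box l u \<longleftrightarrow> (\<forall>b\<in>Basis. \<bar>y x b\<bar> < 1)" for x
    unfolding mem_box u_def c_def y_def r_def using h
    by (intro ball_cong refl) (auto simp: inner_add_left inner_diff_left field_simps abs_less_iff)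
  have insidec: "x \<in> cbox l u \<longleftrightarrow> (\<forall>b\<in>Basis. \<bar>y x b\<bar> \<le> 1)" for x
    unfolding mem_box u_def c_def y_def r_def using h
    by (intro ball_cong refl) (auto simp: inner_add_left inner_diff_left field_simps abs_le_iff)
  have lim: "(\<lambda>k. \<phi> k x) \<longlonglongrightarrow> indicator (cbox l u) x" if x: "x \<notin> cbox l u - box l u" for x
  proof (cases "x \<in> box l u")
    case True
    have "(\<lambda>k. y x b ^ (2 * Suc k)) \<longlonglongrightarrow> 0" if "b \<in> Basis" for b
    proof -
      have "\<bar>y x b\<bar> < 1" using True inside that by blast
      then have "norm ((y x b)\<^sup>2) < 1" by (simp add: abs_square_less_1)
      from LIMSEQ_Suc[OF LIMSEQ_power_zero[OF this]] show ?thesis by (simp only: power_mult)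
    qed
    then have "(\<lambda>k. \<phi> k x) \<longlonglongrightarrow> of_real (exp (- (\<Sum>b\<in>(Basis::'a set). 0)))"
      unfolding \<phi>_def by (intro tendsto_of_real tendsto_exp tendsto_minus tendsto_sum)
    moreover have "x \<in> cbox l u" using True box_subset_cbox by blast
    ultimately show ?thesis by simp
  next
    case False
    then have nc: "x \<notin> cbox l u" using x by blast
    then obtain b where b: "b \<in> Basis" "\<bar>y x b\<bar> > 1"
      using insidec by (metis not_le)
    have y1: "(y x b)\<^sup>2 > 1" using b(2) by (metis abs_square_le_1 not_le)
    have lim0: "(\<lambda>k. inverse ((y x b)\<^sup>2 ^ Suc k)) \<longlonglongrightarrow> 0"
      by (rule LIMSEQ_Suc[OF LIMSEQ_inverse_realpow_zero[OF y1]])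
    have "(\<lambda>k. \<phi> k x) \<longlonglongrightarrow> 0"
    proof (rule Lim_null_comparison[OF _ lim0], rule always_eventually, rule allI)
      fix k
      have "y x b ^ (2 * Suc k) \<le> (\<Sum>b\<in>Basis. y x b ^ (2 * Suc k))"
        by (rule member_le_sum[OF b(1) zero_le_even_power' finite_Basis])
      then have "norm (\<phi> k x) \<le> exp (- ((y x b)\<^sup>2 ^ Suc k))"
        unfolding \<phi>_def power_mult[symmetric] norm_of_real by simp
      also have "\<dots> \<le> inverse ((y x b)\<^sup>2 ^ Suc k)"
      proof -
        have pos: "0 < (y x b)\<^sup>2 ^ Suc k" using y1 by (rule zero_less_power[OF less_trans[OF zero_less_one]])
        have "(y x b)\<^sup>2 ^ Suc k \<le> exp ((y x b)\<^sup>2 ^ Suc k)"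
          using exp_ge_add_one_self[of "(y x b)\<^sup>2 ^ Suc k"] by linarith
        then show ?thesis unfolding exp_minus by (rule le_imp_inverse_le[OF _ pos])
      qed
      finally show "norm (\<phi> k x) \<le> inverse ((y x b)\<^sup>2 ^ Suc k)" .
    qed
    then show ?thesis using nc by simp
  qed
  have "emeasure lborel (cbox l u - box l u) = 0"
    using box_subset_cbox[of l u]
    by (subst emeasure_Diff) (auto simp: emeasure_lborel_cbox_eq emeasure_lborel_box_eq)
  then have "AE x in lborel. x \<notin> cbox l u - box l u"
    by (intro AE_not_in) (simp add: null_sets_def)
  then have lim': "AE x in lborel. (\<lambda>k. f x * \<phi> k x) \<longlonglongrightarrow> f x * indicator (cbox l u) x"
    by eventually_elim (intro tendsto_mult tendsto_const lim)
  have "(\<lambda>k. LINT x|lborel. f x * \<phi> k x) \<longlonglongrightarrow> (LINT x|lborel. f x * indicator (cbox l u) x)"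
  proof (rule integral_dominated_convergence[OF _ _ _ lim'])
    show "integrable lborel (\<lambda>x. exp (DIM('a)) * norm (f x * \<phi> 0 x))"
      using L1_plus_Linf_integrable_mult[OF f \<phi>] by (intro integrable_mult_right integrable_norm)
    show "AE x in lborel. norm (f x * \<phi> k x) \<le> exp (DIM('a)) * norm (f x * \<phi> 0 x)" for k
    proof (rule AE_I2)
      fix x
      have "norm (\<phi> k x) \<le> exp (DIM('a)) * norm (\<phi> 0 x)"
        using flat_top_dominated[of "y x" k] by (simp add: \<phi>_def)
      from mult_left_mono[OF this, of "norm (f x)"]
      show "norm (f x * \<phi> k x) \<le> exp (DIM('a)) * norm (f x * \<phi> 0 x)"
        by (simp add: norm_mult mult_ac)
    qed
    show "(\<lambda>x. f x * \<phi> k x) \<in> borel_measurable lborel" for k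
      using schwartz_measurable[OF \<phi>[of k]] by measurable
  qed measurable
  moreover have "(LINT x|lborel. f x * \<phi> k x) = 0" for k
    by (rule zero[OF \<phi>])
  ultimately have "(LINT x|lborel. f x * indicator (cbox l u) x) = 0"
    by (simp add: LIMSEQ_const_iff)
  moreover have "indicat_real (cbox l u) x *\<^sub>R f x = f x * indicator (cbox l u) x" for x
    by (simp add: indicator_def)
  ultimately show ?thesis
    by (simp add: set_lebesgue_integral_def u_def)
qed

text \<open>By the differentiation theorem of Lebesgue, a function whose integrals over all cubes
  vanish is zero almost everywhere.\<close>

lemma L1_plus_Linf_AE_eq_0:
  fixes f :: "'a::euclidean_space \<Rightarrow> complex"
  assumes f: "f \<in> L1_plus_Linf" and zero: "\<And>\<phi>. \<phi> \<in> schwartz \<Longrightarrow> (LINT x|lborel. f x * \<phi> x) = 0"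
  shows "AE x in lborel. f x = 0"
proof -
  note [measurable] = L1_plus_Linf_measurable[OF f]
  have "f integrable_on cbox a b" for a b
    by (rule set_borel_integral_eq_integral(1)[OF L1_plus_Linf_integrable_on_cbox[OF f]])
  then obtain N where N: "negligible N"
    "\<And>x e. \<lbrakk>x \<notin> N; 0 < e\<rbrakk> \<Longrightarrow> \<exists>d>0. \<forall>h. 0 < h \<and> h < d \<longrightarrow>
        norm (integral (cbox x (x + h *\<^sub>R One)) f /\<^sub>R h ^ DIM('a) - f x) < e"
    using integrable_ccontinuous_explicit[of f] by metis
  have "f x = 0" if xN: "x \<notin> N" for x
  proof (rule ccontr)
    assume "f x \<noteq> 0"
    then obtain d where d: "d > 0" "\<And>h. 0 < h \<Longrightarrow> h < d \<Longrightarrow>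
        norm (integral (cbox x (x + h *\<^sub>R One)) f /\<^sub>R h ^ DIM('a) - f x) < norm (f x)"
      using N(2)[OF xN, of "norm (f x)"] by auto
    have "integral (cbox x (x + (d/2) *\<^sub>R One)) f = (LINT y:cbox x (x + (d/2) *\<^sub>R One)|lborel. f y)"
      by (rule set_borel_integral_eq_integral(2)[OF L1_plus_Linf_integrable_on_cbox[OF f], symmetric])
    also have "\<dots> = 0"
      by (rule L1_plus_Linf_integral_cube_eq_0[OF f zero]) (use d in auto)
    finally show False using d(2)[of "d/2"] d(1) by simp
  qed
  moreover have "AE x in lebesgue. x \<notin> N"
    using N(1) by (intro AE_not_in) (simp add: negligible_iff_null_sets)
  ultimately have "AE x in lebesgue. f x = 0" by auto
  then show ?thesis
    by (subst (asm) AE_completion_iff) auto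
qed

lemma distr_of_fun_eq_imp_AE_eq:
  fixes f g :: "'a::euclidean_space \<Rightarrow> complex"
  assumes f: "f \<in> L1_plus_Linf" and g: "g \<in> L1_plus_Linf" and eq: "distr_of_fun f = distr_of_fun g"
  shows "AE x in lborel. f x = g x"
proof -
  have "AE x in lborel. f x - g x = 0"
  proof (rule L1_plus_Linf_AE_eq_0[OF L1_plus_Linf_diff[OF f g]])
    fix \<phi> :: "'a \<Rightarrow> complex" assume \<phi>: "\<phi> \<in> schwartz"
    have "(LINT x|lborel. f x * \<phi> x) = (LINT x|lborel. g x * \<phi> x)"
      using fun_cong[OF eq, of \<phi>] \<phi> by (simp add: distr_of_fun_def)
    then show "(LINT x|lborel. (f x - g x) * \<phi> x) = 0"
      using L1_plus_Linf_integrable_mult[OF f \<phi>] L1_plus_Linf_integrable_mult[OF g \<phi>]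
      by (simp add: left_diff_distrib)
  qed
  then show ?thesis by simp
qed

section \<open>Lebesgue spaces\<close>

abbreviation ess_norm :: "('a::euclidean_space \<Rightarrow> complex) \<Rightarrow> ennreal" where
  "ess_norm f \<equiv> esssup lborel (\<lambda>x. ennreal (norm (f x)))"

abbreviation nn_power_integral :: "real \<Rightarrow> ('a::euclidean_space \<Rightarrow> complex) \<Rightarrow> ennreal" where
  "nn_power_integral q f \<equiv> (\<integral>\<^sup>+ x. ennreal (norm (f x) powr q) \<partial>lborel)"

lemma enn2real_exponent_ge_1: "1 \<le> p \<Longrightarrow> p \<noteq> \<infinity> \<Longrightarrow> 1 \<le> enn2real p"
  by (metis enn2real_1 enn2real_mono infinity_ennreal_def top.not_eq_extremum)

lemma Lp_space_L1_plus_Linf: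
  fixes f :: "'a::euclidean_space \<Rightarrow> complex"
  assumes f: "f \<in> Lp_space p" and p: "1 \<le> p"
  shows "f \<in> L1_plus_Linf"
proof (cases "p = \<infinity>")
  case True
  have [measurable]: "f \<in> borel_measurable borel" using f by (simp add: Lp_space_def)
  define K where "K = ess_norm f"
  have K: "K < \<infinity>" using f True by (simp add: Lp_space_def K_def)
  have "AE x in lborel. ennreal (norm (f x)) \<le> K"
    unfolding K_def by (rule esssup_AE)
  then have "AE x in lborel. norm (f x) \<le> enn2real K + 0"
  proof eventually_elim
    case (elim x)
    have "K = ennreal (enn2real K)" using K by (simp add: less_top)
    with elim show ?case by (metis add.right_neutral enn2real_nonneg ennreal_le_iff)
  qed
  then show ?thesis
    unfolding L1_plus_Linf_def by (intro CollectI conjI exI[of _ "enn2real K"] exI[of _ "\<lambda>_. 0"]) auto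
next
  case False
  have [measurable]: "f \<in> borel_measurable borel" using f by (simp add: Lp_space_def)
  define q where "q = enn2real p"
  have q: "1 \<le> q" unfolding q_def using p False by (rule enn2real_exponent_ge_1)
  have "norm (f x) \<le> 1 + norm (f x) powr q" for x
  proof (cases "norm (f x) \<le> 1")
    case True
    then show ?thesis by (simp add: add_increasing2)
  next
    case False
    then have "norm (f x) powr 1 \<le> norm (f x) powr q" using q by (intro powr_mono) auto
    then show ?thesis using False by simp
  qed
  moreover have "integrable lborel (\<lambda>x. norm (f x) powr q)"
    using f False by (intro integrableI_bounded) (auto simp: Lp_space_def q_def)
  ultimately show ?thesis
    unfolding L1_plus_Linf_def by (intro CollectI conjI exI[of _ 1] exI[of _ "\<lambda>x. norm (f x) powr q"]) auto
qed

text \<open>The integrability of \<open>|f|\<close> and the boundedness of \<open>f\<close> cover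
  all exponents, as \<open>|f|\<^sup>q \<le> K\<^sup>q\<^sup>-\<^sup>1 |f|\<close>.\<close>

lemma schwartz_Lp_space:
  fixes f :: "'a::euclidean_space \<Rightarrow> complex"
  assumes f: "f \<in> schwartz" and p: "1 \<le> p"
  shows "f \<in> Lp_space p"
proof -
  note [measurable] = schwartz_measurable[OF f]
  obtain K where K: "K > 0" "\<And>x. norm (f x) \<le> K"
    using schwartz_bounded[OF f] by metis
  show ?thesis
  proof (cases "p = \<infinity>")
    case True
    have "ess_norm f \<le> ennreal K"
      by (rule esssup_I) (use K in \<open>auto intro!: ennreal_leI\<close>)
    also have "\<dots> < \<infinity>" by simp
    finally show ?thesis using True by (simp add: Lp_space_def)
  next
    case False
    define q where "q = enn2real p"
    have q: "1 \<le> q" unfolding q_def using p False by (rule enn2real_exponent_ge_1)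
    have "nn_power_integral q f \<le> (\<integral>\<^sup>+ x. ennreal (K powr (q - 1) * norm (f x)) \<partial>lborel)"
    proof (intro nn_integral_mono ennreal_leI)
      fix x
      have "norm (f x) powr q = norm (f x) powr (q - 1) * norm (f x)"
        by (cases "f x = 0") (auto simp: powr_mult_base powr_diff)
      also have "\<dots> \<le> K powr (q - 1) * norm (f x)"
        using K q by (intro mult_right_mono powr_mono2) auto
      finally show "norm (f x) powr q \<le> K powr (q - 1) * norm (f x)" .
    qed
    also have "\<dots> < \<infinity>"
      using schwartz_integrable[OF f]
      by (simp add: ennreal_mult nn_integral_cmult integrable_iff_bounded ennreal_mult_less_top)
    finally show ?thesis using False by (simp add: Lp_space_def q_def)
  qed
qed

lemma Lp_norm_AE_cong:
  fixes f g :: "'a::euclidean_space \<Rightarrow> complex"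
  assumes f: "f \<in> borel_measurable borel" and g: "g \<in> borel_measurable borel" and eq: "AE x in lborel. f x = g x"
  shows "Lp_norm p f = Lp_norm p g"
proof -
  note [measurable] = f g
  have "ess_norm f = ess_norm g"
    using eq by (intro esssup_AE_cong) auto
  moreover have "nn_power_integral (enn2real p) f = nn_power_integral (enn2real p) g"
    using eq by (intro nn_integral_cong_AE) auto
  ultimately show ?thesis by (simp add: Lp_norm_def)
qed

text \<open>Representing functions agree almost everywhere, so the definite description in
  \<open>distr_Lp_norm\<close> denotes.\<close>

lemma distr_Lp_norm_distr_of_fun:
  fixes f :: "'a::euclidean_space \<Rightarrow> complex"
  assumes f: "f \<in> Lp_space p" and p: "1 \<le> p"
  shows "distr_Lp_norm p (distr_of_fun f) = Lp_norm p f"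
  unfolding distr_Lp_norm_def
proof (rule the_equality)
  show "\<exists>g\<in>Lp_space p. distr_of_fun f = distr_of_fun g \<and> Lp_norm p f = Lp_norm p g"
    using f by blast
  fix r assume "\<exists>g\<in>Lp_space p. distr_of_fun f = distr_of_fun g \<and> r = Lp_norm p g"
  then obtain g where g: "g \<in> Lp_space p" "distr_of_fun f = distr_of_fun g" "r = Lp_norm p g" by blast
  have fg: "f \<in> L1_plus_Linf" "g \<in> L1_plus_Linf"
    using Lp_space_L1_plus_Linf f g p by blast+
  then show "r = Lp_norm p f"
    using distr_of_fun_eq_imp_AE_eq[OF fg g(2)] g(3)
    by (metis L1_plus_Linf_measurable Lp_norm_AE_cong)
qed

section \<open>Laplace transforms of integrable functions\<close>

text \<open>The modulus in the exponent spares a condition on the support of the density; the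
  densities constructed below vanish on the negative half line.\<close>

definition laplace_L1 :: "(real \<Rightarrow> real) set" where
  "laplace_L1 = {H. \<exists>w. integrable lborel w \<and> (\<forall>t\<ge>0. H t = (LINT r|lborel. w r * exp (- (\<bar>r\<bar> * t))))}"

text \<open>Euler's integral after the substitution of \<open>r x\<close> for the variable.\<close>

lemma nn_integral_gamma_density:
  fixes a x :: real
  assumes a: "a > 0" and x: "x > 0"
  shows "(\<integral>\<^sup>+ r. ennreal (indicator {0<..} r * (r powr (a - 1) * exp (- (r * x)) / Gamma a)) \<partial>lborel)
           = ennreal (x powr (- a))"
proof -
  let ?e = "\<lambda>r. indicator {0..} (0 + x * r) * (0 + x * r) powr (a - 1) / exp (0 + x * r)"
  let ?d = "\<lambda>r. indicator {0<..} r * (r powr (a - 1) * exp (- (r * x)) / Gamma a)"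
  have "ennreal (Gamma a) = (\<integral>\<^sup>+ r. ennreal (indicator {0..} r * r powr (a - 1) / exp r) \<partial>lborel)"
    by (rule Gamma_conv_nn_integral_real[OF a])
  also have "\<dots> = ennreal \<bar>x\<bar> * (\<integral>\<^sup>+ r. ennreal (?e r) \<partial>lborel)"
    using x by (intro nn_integral_real_affine) auto
  also have "\<dots> = (\<integral>\<^sup>+ r. ennreal x * ennreal (?e r) \<partial>lborel)"
    using x by (simp add: nn_integral_cmult)
  also have "\<dots> = (\<integral>\<^sup>+ r. ennreal (Gamma a * x powr a) * ennreal (?d r) \<partial>lborel)"
  proof (intro nn_integral_cong)
    fix r :: real
    have "x * (?e r)
        = Gamma a * x powr a * (?d r)"
    proof (cases "r > 0")
      case True
      have "x * x powr (a - 1) = x powr a" using x by (simp add: powr_mult_base)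
      then show ?thesis
        using True x Gamma_real_pos[OF a] by (simp add: powr_mult exp_minus field_simps)
    next
      case False
      then show ?thesis using x by (cases "r = 0") (auto simp: indicator_def zero_le_mult_iff)
    qed
    then show "ennreal x * ennreal (?e r)
       = ennreal (Gamma a * x powr a) * ennreal (?d r)"
      using x Gamma_real_pos[OF a] by (simp flip: ennreal_mult' del: Gamma_real_pos)
  qed
  also have "\<dots> = ennreal (Gamma a * x powr a) * (\<integral>\<^sup>+ r. ennreal (?d r) \<partial>lborel)"
    by (simp add: nn_integral_cmult)
  finally have eq: "ennreal (Gamma a) = ennreal (Gamma a * x powr a) *
      (\<integral>\<^sup>+ r. ennreal (?d r) \<partial>lborel)" .
  define I where "I = (\<integral>\<^sup>+ r. ennreal (?d r) \<partial>lborel)"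
  have "ennreal (x powr (- a) / Gamma a) * ennreal (Gamma a) = ennreal (x powr (- a) / Gamma a) * ennreal (Gamma a * x powr a) * I"
    unfolding I_def using eq by (simp add: mult.assoc)
  then show ?thesis
    using x Gamma_real_pos[OF a] unfolding I_def[symmetric]
    by (simp add: powr_minus field_simps flip: ennreal_mult')
qed

lemma has_bochner_integral_power_exp:
  fixes x :: real
  assumes x: "x > 0"
  shows "has_bochner_integral lborel (\<lambda>r. indicator {0<..} r * (r ^ k * exp (- (r * x)) / fact k)) (inverse (x ^ Suc k))"
proof (rule has_bochner_integral_nn_integral)
  have Gamma_Suc: "Gamma (real (Suc k)) = fact k"
    using Gamma_fact[of k, where 'a = real] by (simp add: add.commute)
  have "(\<integral>\<^sup>+ r. ennreal (indicator {0<..} r * (r ^ k * exp (- (r * x)) / fact k)) \<partial>lborel)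
      = (\<integral>\<^sup>+ r. ennreal (indicator {0<..} r * (r powr (real (Suc k) - 1) * exp (- (r * x)) / Gamma (real (Suc k)))) \<partial>lborel)"
    by (intro nn_integral_cong) (auto simp: indicator_def powr_realpow Gamma_Suc[simplified])
  also have "\<dots> = ennreal (x powr (- real (Suc k)))"
    using x by (intro nn_integral_gamma_density) auto
  also have "x powr (- real (Suc k)) = inverse (x ^ Suc k)"
    using x by (subst powr_minus) (simp add: powr_realpow del: of_nat_Suc power_Suc)
  finally show "(\<integral>\<^sup>+ r. ennreal (indicator {0<..} r * (r ^ k * exp (- (r * x)) / fact k)) \<partial>lborel) = ennreal (inverse (x ^ Suc k))" .
qed (use x in \<open>auto simp: indicator_def\<close>)

text \<open>The power \<open>(lam + t)\<^sup>-\<^sup>k\<^sup>-\<^sup>1\<close> is the Laplace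
  transform of \<open>r\<^sup>k exp (- lam r) / k!\<close>; the hypothesis is the summability of the
  norms of the summands, so that the series of densities converges in the space of integrable
  functions.\<close>

lemma laplace_L1_power_series:
  fixes c :: "nat \<Rightarrow> real"
  assumes lam: "lam > 0" and c: "summable (\<lambda>k. \<bar>c k\<bar> / lam ^ Suc k)"
  shows "(\<lambda>t. \<Sum>k. c k / (lam + t) ^ Suc k) \<in> laplace_L1"
proof -
  define f where "f t k r = indicator {0<..} r * (c k * r ^ k * exp (- (r * (lam + t))) / fact k)" for t :: real and k :: nat and r :: real
  have f_scaled: "f t k r = c k * (indicator {0<..} r * (r ^ k * exp (- (r * (lam + t))) / fact k))" for t k r
    by (simp add: f_def)
  have f_int: "has_bochner_integral lborel (f t k) (c k * inverse ((lam + t) ^ Suc k))" if "t \<ge> 0" for t k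
    unfolding f_scaled[abs_def] using has_bochner_integral_power_exp[of "lam + t" k] lam that
    by (intro has_bochner_integral_mult_right) auto
  have f_norm: "norm (f t k r) = \<bar>c k\<bar> * (indicator {0<..} r * (r ^ k * exp (- (r * (lam + t))) / fact k))" for t k r
    by (auto simp: f_def indicator_def abs_mult)
  have f_norm_int: "(LINT r|lborel. norm (f t k r)) = \<bar>c k\<bar> * inverse ((lam + t) ^ Suc k)" if "t \<ge> 0" for t k
    unfolding f_norm using has_bochner_integral_power_exp[of "lam + t" k] lam that
    by (intro has_bochner_integral_integral_eq has_bochner_integral_mult_right) auto
  have sm1: "AE r in lborel. summable (\<lambda>k. norm (f t k r))" if "t \<ge> 0" for t
  proof (rule AE_I2)
    fix r :: real
    obtain B where B: "\<And>k. \<bar>c k\<bar> / lam ^ Suc k \<le> B"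
      using summable_imp_Bseq[OF c] lam by (auto simp: Bseq_def)
    show "summable (\<lambda>k. norm (f t k r))"
    proof (rule summable_comparison_test')
      show "summable (\<lambda>k. (B * lam * exp (- (r * (lam + t)))) * (inverse (fact k) * (lam * \<bar>r\<bar>) ^ k))"
        using summable_exp[of "lam * \<bar>r\<bar>"] by (intro summable_mult)
      fix k
      have "\<bar>c k\<bar> \<le> B * lam ^ Suc k" using B[of k] lam by (simp add: pos_divide_le_eq)
      then have "\<bar>c k\<bar> * (\<bar>r\<bar> ^ k * exp (- (r * (lam + t))) / fact k) \<le> B * lam ^ Suc k * (\<bar>r\<bar> ^ k * exp (- (r * (lam + t))) / fact k)"
        by (intro mult_right_mono) auto
      moreover have "norm (f t k r) \<le> \<bar>c k\<bar> * (\<bar>r\<bar> ^ k * exp (- (r * (lam + t))) / fact k)"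
        unfolding f_norm by (intro mult_left_mono) (auto simp: indicator_def)
      ultimately have "norm (f t k r) \<le> B * lam ^ Suc k * (\<bar>r\<bar> ^ k * exp (- (r * (lam + t))) / fact k)"
        by linarith
      also have "\<dots> = (B * lam * exp (- (r * (lam + t)))) * (inverse (fact k) * (lam * \<bar>r\<bar>) ^ k)"
        by (simp add: power_mult_distrib field_simps)
      finally show "norm (norm (f t k r)) \<le> (B * lam * exp (- (r * (lam + t)))) * (inverse (fact k) * (lam * \<bar>r\<bar>) ^ k)"
        by simp
    qed
  qed
  have sm2: "summable (\<lambda>k. LINT r|lborel. norm (f t k r))" if t: "t \<ge> 0" for t
  proof (rule summable_comparison_test'[OF c])
    fix k
    have "lam ^ Suc k \<le> (lam + t) ^ Suc k" using lam t by (intro power_mono) auto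
    then have "inverse ((lam + t) ^ Suc k) \<le> inverse (lam ^ Suc k)"
      by (rule le_imp_inverse_le) (use lam in simp)
    then have "\<bar>c k\<bar> * inverse ((lam + t) ^ Suc k) \<le> \<bar>c k\<bar> / lam ^ Suc k"
      unfolding divide_inverse by (rule mult_left_mono) simp
    moreover have "0 \<le> \<bar>c k\<bar> * inverse ((lam + t) ^ Suc k)"
      using lam t by (simp del: power_Suc)
    ultimately show "norm (LINT r|lborel. norm (f t k r)) \<le> \<bar>c k\<bar> / lam ^ Suc k"
      unfolding f_norm_int[OF t] unfolding real_norm_def by (simp only: abs_of_nonneg)
  qed
  define w where "w r = (\<Sum>k. f 0 k r)" for r
  have w: "integrable lborel w"
    unfolding w_def[abs_def]
    by (rule integrable_suminf) (use f_int[of 0] sm1[of 0] sm2[of 0] in \<open>auto simp: has_bochner_integral_iff\<close>)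
  have "(\<Sum>k. c k / (lam + t) ^ Suc k) = (LINT r|lborel. w r * exp (- (\<bar>r\<bar> * t)))" if t: "t \<ge> 0" for t
  proof -
    have "(\<lambda>k. integral\<^sup>L lborel (f t k)) sums (LINT r|lborel. (\<Sum>k. f t k r))"
      by (rule sums_integral) (use f_int[OF t] sm1[OF t] sm2[OF t] in \<open>auto simp: has_bochner_integral_iff\<close>)
    moreover have "integral\<^sup>L lborel (f t k) = c k / (lam + t) ^ Suc k" for k
      using f_int[OF t, of k] by (simp add: has_bochner_integral_iff divide_inverse)
    ultimately have "(\<Sum>k. c k / (lam + t) ^ Suc k) = (LINT r|lborel. (\<Sum>k. f t k r))"
      by (simp add: sums_iff)
    also have "\<dots> = (LINT r|lborel. w r * exp (- (\<bar>r\<bar> * t)))"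
    proof (rule integral_cong_AE)
      show "AE r in lborel. (\<Sum>k. f t k r) = w r * exp (- (\<bar>r\<bar> * t))"
        using sm1[OF order_refl]
      proof eventually_elim
        case (elim r)
        have "f t k r = f 0 k r * exp (- (\<bar>r\<bar> * t))" for k
          by (auto simp: f_def indicator_def distrib_left exp_add exp_diff exp_minus field_simps)
        then show ?case
          using suminf_mult2[OF summable_norm_cancel[OF elim]] by (simp add: w_def)
      qed
    qed (use w in \<open>auto simp: f_def[abs_def]\<close>)
    finally show ?thesis .
  qed
  then show ?thesis unfolding laplace_L1_def using w by blast
qed

lemma nn_integral_powr_minus:
  fixes x :: real
  assumes x: "x > 1"
  shows "(\<integral>\<^sup>+ a. ennreal (indicator {0<..} a * x powr (- a)) \<partial>lborel) = ennreal (inverse (ln x))"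
proof -
  have "(\<integral>\<^sup>+ a. ennreal (indicator {0<..} a * x powr (- a)) \<partial>lborel)
      = (\<integral>\<^sup>+ a. ennreal (indicator {0<..} a * (a ^ 0 * exp (- (a * ln x)) / fact 0)) \<partial>lborel)"
    using x by (intro nn_integral_cong) (auto simp: powr_def)
  also have "\<dots> = ennreal (inverse (ln x ^ Suc 0))"
    using has_bochner_integral_power_exp[of "ln x" 0] x
    by (subst nn_integral_eq_integral) (auto simp: has_bochner_integral_iff indicator_def)
  finally show ?thesis by simp
qed

lemma Gamma_measurable_pos: "(\<lambda>a. indicator {0<..} a * Gamma a :: real) \<in> borel_measurable borel"
proof -
  have "continuous_on {0<..} (Gamma :: real \<Rightarrow> real)"
    by (intro continuous_on_Gamma) (auto elim!: nonpos_Ints_cases)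
  then have "(\<lambda>a. indicator {0<..} a *\<^sub>R Gamma a :: real) \<in> borel_measurable borel"
    by (rule borel_measurable_continuous_on_indicator[rotated]) auto
  then show ?thesis by simp
qed

text \<open>Superposition over \<open>a > 0\<close> of the densities with transform \<open>(lam +
  t)\<^sup>-\<^sup>a\<close>.  All functions are nonnegative, so Tonelli's theorem gives the
  transform and, at \<open>t = 0\<close>, the finiteness of the total mass; this is where \<open>lam
  > 1\<close> enters.\<close>

lemma laplace_L1_inverse_ln:
  assumes lam: "lam > 1"
  shows "(\<lambda>t. inverse (ln (lam + t))) \<in> laplace_L1"
proof -
  note [measurable] = Gamma_measurable_pos
  define k where "k t r a = indicator {0<..} a * (indicator {0<..} r * (r powr (a - 1) * exp (- (r * (lam + t))) / (indicator {0<..} a * Gamma a)))"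
    for t r a :: real
  have k_nonneg: "0 \<le> k t r a" for t r a
    using Gamma_real_pos[of a] by (auto simp: k_def indicator_def)
  have [measurable]: "(\<lambda>(r, a). k t r a) \<in> borel_measurable (borel \<Otimes>\<^sub>M borel)" for t
    unfolding k_def by measurable
  have inner: "(\<integral>\<^sup>+ r. ennreal (k t r a) \<partial>lborel) = ennreal (indicator {0<..} a * (lam + t) powr (- a))" if "t \<ge> 0" for t a
    using nn_integral_gamma_density[of a "lam + t"] lam that
    by (cases "a > 0") (auto simp: k_def indicator_def)
  define W where "W t r = (\<integral>\<^sup>+ a. ennreal (k t r a) \<partial>lborel)" for t r
  have [measurable]: "W t \<in> borel_measurable borel" for t
    unfolding W_def by measurable
  have W_total: "(\<integral>\<^sup>+ r. W t r \<partial>lborel) = ennreal (inverse (ln (lam + t)))" if t: "t \<ge> 0" for t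
  proof -
    have "(\<integral>\<^sup>+ r. W t r \<partial>lborel) = (\<integral>\<^sup>+ a. (\<integral>\<^sup>+ r. ennreal (k t r a) \<partial>lborel) \<partial>lborel)"
      unfolding W_def by (rule lborel_pair.Fubini'[symmetric]) measurable
    also have "\<dots> = ennreal (inverse (ln (lam + t)))"
      using nn_integral_powr_minus[of "lam + t"] lam t by (simp add: inner)
    finally show ?thesis .
  qed
  have W_exp: "W t r = W 0 r * ennreal (exp (- (\<bar>r\<bar> * t)))" for t r
  proof -
    have "k t r a = k 0 r a * exp (- (\<bar>r\<bar> * t))" for a
      by (auto simp: k_def indicator_def distrib_left exp_diff exp_minus field_simps)
    then show ?thesis
      unfolding W_def by (subst nn_integral_multc[symmetric]) (auto simp: ennreal_mult'' k_nonneg)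
  qed
  define w where "w r = enn2real (W 0 r)" for r
  have [measurable]: "w \<in> borel_measurable borel" unfolding w_def by measurable
  have "(\<integral>\<^sup>+ r. W 0 r \<partial>lborel) \<noteq> \<infinity>" using W_total[of 0] by simp
  then have "AE r in lborel. W 0 r \<noteq> \<infinity>"
    by (intro nn_integral_noteq_infinite) auto
  then have w: "AE r in lborel. ennreal (w r) = W 0 r"
    by eventually_elim (simp add: w_def less_top)
  have total: "(\<integral>\<^sup>+ r. ennreal (w r * exp (- (\<bar>r\<bar> * t))) \<partial>lborel) = ennreal (inverse (ln (lam + t)))" if t: "t \<ge> 0" for t
  proof -
    have "(\<integral>\<^sup>+ r. ennreal (w r * exp (- (\<bar>r\<bar> * t))) \<partial>lborel) = (\<integral>\<^sup>+ r. W t r \<partial>lborel)"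
      using w by (intro nn_integral_cong_AE) (auto simp: ennreal_mult'' W_exp[of t])
    then show ?thesis by (simp add: W_total t)
  qed
  have w_nonneg: "0 \<le> w r" for r by (simp add: w_def)
  have "integrable lborel w"
    using total[of 0] w_nonneg by (intro integrableI_bounded) auto
  moreover have "inverse (ln (lam + t)) = (LINT r|lborel. w r * exp (- (\<bar>r\<bar> * t)))" if t: "t \<ge> 0" for t
    using total[OF t] lam t w_nonneg by (subst integral_eq_nn_integral) auto
  ultimately show ?thesis unfolding laplace_L1_def by blast
qed

text \<open>The binomial series of \<open>(1 - q)\<^sup>a\<close> with \<open>q = (lam2 - lam1) /
  (lam2 + t)\<close>.  Subtracting \<open>1\<close> removes the constant term, which is the
  transform of a point mass and not of a function.\<close>

lemma laplace_L1_powr_ratio: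
  assumes lam: "0 < lam1" "lam1 < lam2"
  shows "(\<lambda>t. ((lam1 + t) / (lam2 + t)) powr a - 1) \<in> laplace_L1"
proof -
  define d where "d = lam2 - lam1"
  define c where "c k = (a gchoose Suc k) * (- d) ^ Suc k" for k
  have d: "0 < d" "d < lam2" using lam by (auto simp: d_def)
  have "(\<lambda>t. \<Sum>k. c k / (lam2 + t) ^ Suc k) \<in> laplace_L1"
  proof (rule laplace_L1_power_series)
    obtain x where x: "d / lam2 < x" "x < 1" using dense[of "d / lam2" 1] d by auto
    have "0 < d / lam2" using d by simp
    have "summable (\<lambda>k. (a gchoose k) * x ^ k)"
      using x \<open>0 < d / lam2\<close> by (intro sums_summable[OF gen_binomial_real[of x a]]) linarith
    then have "summable (\<lambda>k. norm ((a gchoose k) * (d / lam2) ^ k))"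
      by (rule powser_insidea) (use x d in auto)
    then have "summable (\<lambda>k. norm ((a gchoose Suc k) * (d / lam2) ^ Suc k))"
      by (rule summable_Suc_iff[THEN iffD2])
    then show "summable (\<lambda>k. \<bar>c k\<bar> / lam2 ^ Suc k)"
      using d by (simp add: c_def abs_mult power_divide power_abs)
  qed (use lam in auto)
  moreover have "(\<Sum>k. c k / (lam2 + t) ^ Suc k) = ((lam1 + t) / (lam2 + t)) powr a - 1" if t: "t \<ge> 0" for t
  proof -
    have "(\<lambda>k. (a gchoose k) * (- d / (lam2 + t)) ^ k) sums (1 + (- d / (lam2 + t))) powr a"
      using d t by (intro gen_binomial_real) (auto simp: abs_div_pos)
    then have "(\<lambda>k. (a gchoose Suc k) * (- d / (lam2 + t)) ^ Suc k) sums ((1 + (- d / (lam2 + t))) powr a - 1)"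
      by (subst sums_Suc_iff) simp
    moreover have "1 + (- d / (lam2 + t)) = (lam1 + t) / (lam2 + t)"
      using lam t by (simp add: d_def field_simps)
    moreover have "(a gchoose Suc k) * (- d / (lam2 + t)) ^ Suc k = c k / (lam2 + t) ^ Suc k" for k
      by (simp only: c_def power_divide) simp
    ultimately show ?thesis by (simp add: sums_iff)
  qed
  ultimately show ?thesis by (auto simp: laplace_L1_def)
qed

text \<open>The logarithmic series of \<open>ln (1 - q)\<close> with \<open>q = (lam2 - lam1) /
  (lam2 + t)\<close>.\<close>

lemma laplace_L1_ln_ratio:
  assumes lam: "0 < lam1" "lam1 < lam2"
  shows "(\<lambda>t. ln ((lam1 + t) / (lam2 + t))) \<in> laplace_L1"
proof -
  define d where "d = lam2 - lam1"
  define c where "c k = - (d ^ Suc k) / real (Suc k)" for k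
  have d: "0 < d" "d < lam2" using lam by (auto simp: d_def)
  have "(\<lambda>t. \<Sum>k. c k / (lam2 + t) ^ Suc k) \<in> laplace_L1"
  proof (rule laplace_L1_power_series)
    have "summable (\<lambda>k. (d / lam2) ^ Suc k)"
      using d by (subst summable_Suc_iff) (auto intro!: summable_geometric)
    then show "summable (\<lambda>k. \<bar>c k\<bar> / lam2 ^ Suc k)"
    proof (rule summable_comparison_test')
      fix k
      have "\<bar>c k\<bar> = d ^ Suc k / real (Suc k)"
        using d by (simp add: c_def abs_mult)
      also have "\<dots> \<le> d ^ Suc k / 1"
        using d by (intro divide_left_mono) auto
      finally have "\<bar>c k\<bar> \<le> d ^ Suc k" by simp
      then show "norm (\<bar>c k\<bar> / lam2 ^ Suc k) \<le> (d / lam2) ^ Suc k"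
        using d by (simp add: power_divide divide_right_mono del: power_Suc)
    qed
  qed (use lam in auto)
  moreover have "(\<Sum>k. c k / (lam2 + t) ^ Suc k) = ln ((lam1 + t) / (lam2 + t))" if t: "t \<ge> 0" for t
  proof -
    have "(\<lambda>k. - ((- (- d / (lam2 + t))) ^ k) / real k) sums ln (1 + (- d / (lam2 + t)))"
      using d t by (intro ln_series') (auto simp: abs_div_pos)
    then have "(\<lambda>k. - ((- (- d / (lam2 + t))) ^ Suc k) / real (Suc k)) sums ln (1 + (- d / (lam2 + t)))"
      by (subst sums_Suc_iff) simp
    moreover have "1 + (- d / (lam2 + t)) = (lam1 + t) / (lam2 + t)"
      using lam t by (simp add: d_def field_simps)
    moreover have "- ((- (- d / (lam2 + t))) ^ Suc k) / real (Suc k) = c k / (lam2 + t) ^ Suc k" for k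
      by (simp only: c_def minus_divide_left minus_minus power_divide) simp
    ultimately show ?thesis by (simp add: sums_iff)
  qed
  ultimately show ?thesis by (auto simp: laplace_L1_def)
qed

text \<open>For \<open>r \<noteq> 0\<close>, dilating \<open>gauss\<close> by \<open>2 \<surd>(\<pi>
  |r|)\<close> gives a probability density with Fourier transform \<open>exp (- |r| 4\<pi>\<^sup>2
  |\<xi>|\<^sup>2)\<close>, the heat kernel at time \<open>|r|\<close>.  A Laplace transform at
  \<open>4\<pi>\<^sup>2 |\<xi>|\<^sup>2\<close> is thus a superposition of characters over pairs of
  a time and a Gaussian variable.\<close>

lemma laplace_L1_radial:
  fixes \<xi> :: "'a::euclidean_space"
  assumes w: "integrable lborel w"
  shows "integrable lborel (\<lambda>(r, y). complex_of_real (w r * gauss (y::'a)))"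
    and "(LINT (r, y)|lborel. complex_of_real (w r * gauss y) * cis (- 2 * pi * (((2 * sqrt pi * sqrt \<bar>r\<bar>) *\<^sub>R y) \<bullet> \<xi>)))
           = complex_of_real (LINT r|lborel. w r * exp (- (\<bar>r\<bar> * (4 * pi\<^sup>2 * (norm \<xi>)\<^sup>2))))"
proof -
  let ?k = "\<lambda>r y. complex_of_real (w r * gauss y) * cis (- 2 * pi * (((2 * sqrt pi * sqrt \<bar>r\<bar>) *\<^sub>R y) \<bullet> \<xi>))"
  have [measurable]: "w \<in> borel_measurable borel" using w by auto
  have int: "integrable (lborel \<Otimes>\<^sub>M lborel) (\<lambda>(r, y). complex_of_real (w r * gauss (y::'a)))"
  proof (rule lborel_pair.Fubini_integrable)
    have "gauss y \<ge> 0" for y :: 'a by (simp add: gauss_def)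
    then show "integrable lborel (\<lambda>r. LINT y|lborel. norm (case (r, y) of (r, y) \<Rightarrow> complex_of_real (w r * gauss (y::'a))))"
      using w by (simp add: norm_mult gauss_integral)
    show "AE r in lborel. integrable lborel (\<lambda>y. case (r, y) of (r, y) \<Rightarrow> complex_of_real (w r * gauss (y::'a)))"
      by (intro AE_I2) (simp add: schwartz_integrable gauss_schwartz)
  qed measurable
  then show "integrable lborel (\<lambda>(r, y). complex_of_real (w r * gauss (y::'a)))"
    by (simp add: lborel_prod)
  have "integrable (lborel \<Otimes>\<^sub>M lborel) (\<lambda>p. (case p of (r, y) \<Rightarrow> complex_of_real (w r * gauss (y::'a)))
      * cis (- 2 * pi * (((2 * sqrt pi * sqrt \<bar>fst p\<bar>) *\<^sub>R snd p) \<bullet> \<xi>)))"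
    by (intro integrable_mult_cis int) measurable
  then have int': "integrable (lborel \<Otimes>\<^sub>M lborel) (\<lambda>(r, y). ?k r y)"
    by (simp add: case_prod_unfold)
  have "(LINT (r, y)|lborel. ?k r y)
     = (LINT r|lborel. LINT y|lborel. ?k r y)"
    unfolding lborel_prod[symmetric] by (rule lborel_pair.integral_fst[OF int', symmetric])
  also have "\<dots> = (LINT r|lborel. complex_of_real (w r * exp (- (\<bar>r\<bar> * (4 * pi\<^sup>2 * (norm \<xi>)\<^sup>2)))))"
  proof (rule Bochner_Integration.integral_cong)
    fix r :: real
    define \<sigma> where "\<sigma> = - 4 * pi * sqrt pi * sqrt \<bar>r\<bar>"
    have "\<sigma>\<^sup>2 = 16 * pi ^ 3 * \<bar>r\<bar>" unfolding \<sigma>_def power_mult_distrib by (simp add: power3_eq_cube) (simp add: power2_eq_square)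
    then have "\<sigma>\<^sup>2 * (norm \<xi>)\<^sup>2 / (4 * pi) = \<bar>r\<bar> * (4 * pi\<^sup>2 * (norm \<xi>)\<^sup>2)"
      by (simp add: power3_eq_cube power2_eq_square)
    then have g: "osc_transform \<sigma> (\<lambda>y. complex_of_real (gauss y)) \<xi> = of_real (exp (- (\<bar>r\<bar> * (4 * pi\<^sup>2 * (norm \<xi>)\<^sup>2))))"
      by (simp add: osc_transform_gauss)
    have "(LINT y|lborel. ?k r y)
        = (LINT y|lborel. complex_of_real (w r) * (complex_of_real (gauss y) * cis (\<sigma> * (y \<bullet> \<xi>))))"
      by (intro Bochner_Integration.integral_cong) (auto simp: \<sigma>_def mult_ac)
    also have "\<dots> = of_real (w r) * osc_transform \<sigma> (\<lambda>y. complex_of_real (gauss y)) \<xi>"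
      by (simp add: osc_transform_def)
    finally show "(LINT y|lborel. ?k r y)
        = complex_of_real (w r * exp (- (\<bar>r\<bar> * (4 * pi\<^sup>2 * (norm \<xi>)\<^sup>2))))"
      by (simp add: g)
  qed simp
  also have "\<dots> = complex_of_real (LINT r|lborel. w r * exp (- (\<bar>r\<bar> * (4 * pi\<^sup>2 * (norm \<xi>)\<^sup>2))))"
    by (rule integral_complex_of_real)
  finally show "(LINT (r, y)|lborel. ?k r y)
     = complex_of_real (LINT r|lborel. w r * exp (- (\<bar>r\<bar> * (4 * pi\<^sup>2 * (norm \<xi>)\<^sup>2))))" .
qed

section \<open>Multipliers on Lebesgue spaces\<close>

lemma powr_above_tangent:
  fixes h m q :: real
  assumes q: "1 \<le> q" and h: "0 \<le> h" and m: "0 \<le> m"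
  shows "m powr q + q * m powr (q - 1) * (h - m) \<le> h powr q"
proof (cases "m = 0")
  case True
  then show ?thesis by simp
next
  case False
  then have m: "m > 0" using m by simp
  have mq: "m powr q = m powr (q - 1) * m"
    using m by (simp add: powr_diff)
  show ?thesis
  proof (cases "h = 0")
    case True
    have "m powr q \<le> q * m powr q" using q by (simp add: mult_le_cancel_right1)
    then show ?thesis using True q by (simp add: mq algebra_simps)
  next
    case False
    have "q * m powr (q - 1) * (h - m) \<le> h powr q - m powr q"
    proof (rule convex_on_imp_above_tangent[OF powr_convex[OF q]])
      show "((\<lambda>x. x powr q) has_real_derivative q * m powr (q - 1)) (at m within {0<..})"
        by (rule has_field_derivative_at_within[OF has_real_derivative_powr[OF m]])
    qed (use m h False in \<open>auto simp: interior_open\<close>)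
    then show ?thesis by simp
  qed
qed

text \<open>Jensen's inequality for a finite weight, from the tangent line at the mean.  Allowing a
  bound \<open>A\<close> in place of the exact mass avoids a case distinction for the zero
  weight.\<close>

lemma powr_integral_le:
  fixes h w :: "'b \<Rightarrow> real"
  assumes q: "1 \<le> q" and h: "\<And>x. 0 \<le> h x" and w: "\<And>x. 0 \<le> w x"
    and iw: "integrable M w" and ih: "integrable M (\<lambda>x. w x * h x)"
    and ihq: "integrable M (\<lambda>x. w x * h x powr q)"
    and A: "(LINT x|M. w x) \<le> A" "0 < A"
  shows "(LINT x|M. w x * h x) powr q \<le> A powr (q - 1) * (LINT x|M. w x * h x powr q)"
proof -
  define G where "G = (LINT x|M. w x * h x)"
  define m where "m = G / A"
  have G: "0 \<le> G" unfolding G_def using h w by (intro integral_nonneg_AE) auto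
  have m: "0 \<le> m" unfolding m_def using G A by simp
  have mq: "m powr q = m powr (q - 1) * m"
    using m by (cases "m = 0") (simp_all add: powr_diff)
  have "m powr q * A \<le> (LINT x|M. w x) * (m powr q - q * m powr (q - 1) * m) + q * m powr (q - 1) * G"
  proof -
    have "(LINT x|M. w x) * (m powr q * (q - 1)) \<le> A * (m powr q * (q - 1))"
      using A q by (intro mult_right_mono) auto
    moreover have "G = A * m" using A by (simp add: m_def)
    ultimately show ?thesis by (simp add: mq algebra_simps)
  qed
  also have "\<dots> = (LINT x|M. w x * (m powr q - q * m powr (q - 1) * m) + q * m powr (q - 1) * (w x * h x))"
    unfolding G_def using iw ih by simp
  also have "\<dots> \<le> (LINT x|M. w x * h x powr q)"
  proof (rule integral_mono)
    fix x
    show "w x * (m powr q - q * m powr (q - 1) * m) + q * m powr (q - 1) * (w x * h x) \<le> w x * h x powr q"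
      using mult_left_mono[OF powr_above_tangent[OF q h m, of x] w[of x]] by (simp add: algebra_simps)
  qed (use iw ih ihq in auto)
  finally have *: "m powr q * A \<le> (LINT x|M. w x * h x powr q)" .
  have "G powr q = A powr q * m powr q" using A G by (simp add: m_def powr_divide)
  also have "\<dots> = A powr (q - 1) * (m powr q * A)" using A by (simp add: powr_diff)
  also have "\<dots> \<le> A powr (q - 1) * (LINT x|M. w x * h x powr q)"
    by (intro mult_left_mono *) simp
  finally show ?thesis unfolding G_def .
qed

lemma Lp_bound_from_nn_integral:
  fixes f g :: "'a::euclidean_space \<Rightarrow> complex"
  assumes p: "1 \<le> p" "p \<noteq> \<infinity>" and f: "f \<in> Lp_space p" and g: "g \<in> borel_measurable borel" and C: "0 \<le> C"
    and le: "nn_power_integral (enn2real p) g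
      \<le> ennreal (C powr enn2real p) * nn_power_integral (enn2real p) f"
  shows "g \<in> Lp_space p \<and> Lp_norm p g \<le> C * Lp_norm p f"
proof -
  define q where "q = enn2real p"
  have q: "1 \<le> q" unfolding q_def using p by (rule enn2real_exponent_ge_1)
  define I where "I = nn_power_integral q f"
  define J where "J = nn_power_integral q g"
  have I: "I < \<infinity>" using f p by (simp add: Lp_space_def I_def q_def)
  have J: "J \<le> ennreal (C powr q) * I" using le by (simp add: I_def J_def q_def)
  then have J': "J < \<infinity>" using I by (simp add: ennreal_mult_less_top order.strict_trans1)
  have "enn2real J \<le> enn2real (ennreal (C powr q) * I)"
    using J I by (intro enn2real_mono) (auto simp: ennreal_mult_less_top)
  then have "enn2real J \<le> C powr q * enn2real I" by (simp add: enn2real_mult)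
  then have "enn2real J powr (1 / q) \<le> (C powr q * enn2real I) powr (1 / q)"
    using q by (intro powr_mono2) auto
  also have "\<dots> = C * enn2real I powr (1 / q)"
    using q C by (simp add: powr_mult powr_powr)
  finally have "Lp_norm p g \<le> C * Lp_norm p f"
    using p by (simp add: Lp_norm_def I_def J_def q_def)
  then show ?thesis using J' p g by (simp add: Lp_space_def J_def q_def)
qed

text \<open>Any finite constant serves the comparison of norms; this one comes from the pointwise
  bound \<open>|f + g|\<^sup>q \<le> 2\<^sup>q (|f|\<^sup>q + |g|\<^sup>q)\<close>.\<close>

lemma Lp_space_add:
  fixes f g :: "'a::euclidean_space \<Rightarrow> complex"
  assumes p: "1 \<le> p" and f: "f \<in> Lp_space p" and g: "g \<in> Lp_space p"
  shows "(\<lambda>x. f x + g x) \<in> Lp_space p \<and> Lp_norm p (\<lambda>x. f x + g x) \<le> 4 * (Lp_norm p f + Lp_norm p g)"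
proof -
  have [measurable]: "f \<in> borel_measurable borel" "g \<in> borel_measurable borel"
    using f g by (auto simp: Lp_space_def)
  show ?thesis
  proof (cases "p = \<infinity>")
    case True
    define K where "K = ess_norm f"
    define L where "L = ess_norm g"
    have KL: "K < \<infinity>" "L < \<infinity>" using f g True by (simp_all add: Lp_space_def K_def L_def)
    have "AE x in lborel. ennreal (norm (f x)) \<le> K" "AE x in lborel. ennreal (norm (g x)) \<le> L"
      unfolding K_def L_def by (rule esssup_AE)+
    then have "AE x in lborel. ennreal (norm (f x + g x)) \<le> K + L"
    proof eventually_elim
      case (elim x)
      have "ennreal (norm (f x + g x)) \<le> ennreal (norm (f x)) + ennreal (norm (g x))"
        by (simp add: norm_triangle_ineq ennreal_leI flip: ennreal_plus)
      also have "\<dots> \<le> K + L" using elim by (rule add_mono)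
      finally show ?case .
    qed
    then have le: "ess_norm (\<lambda>x. f x + g x) \<le> K + L"
      by (intro esssup_I) auto
    also have "K + L < \<infinity>" using KL by simp
    finally have fin: "ess_norm (\<lambda>x. f x + g x) < \<infinity>" .
    have "enn2real (ess_norm (\<lambda>x. f x + g x)) \<le> enn2real (K + L)"
      using le KL by (intro enn2real_mono) auto
    also have "\<dots> = enn2real K + enn2real L" using KL by (intro enn2real_plus) auto
    also have "\<dots> \<le> 4 * (enn2real K + enn2real L)" using mult_right_mono[of 1 4 "enn2real K + enn2real L"] by simp
    finally show ?thesis using fin True by (simp add: Lp_space_def Lp_norm_def K_def L_def)
  next
    case False
    define q where "q = enn2real p"
    have q: "1 \<le> q" unfolding q_def using p False by (rule enn2real_exponent_ge_1)
    define N where "N h = nn_power_integral q h" for h :: "'a \<Rightarrow> complex"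
    have "N (\<lambda>x. f x + g x) \<le> (\<integral>\<^sup>+ x. ennreal (2 powr q) * (ennreal (norm (f x) powr q) + ennreal (norm (g x) powr q)) \<partial>lborel)"
      unfolding N_def
    proof (intro nn_integral_mono)
      fix x
      define a b where "a = norm (f x)" and "b = norm (g x)"
      have ab: "0 \<le> a" "0 \<le> b" by (auto simp: a_def b_def)
      have "norm (f x + g x) powr q \<le> (2 * max a b) powr q"
        using q norm_triangle_ineq[of "f x" "g x"] by (intro powr_mono2) (auto simp: a_def b_def max_def)
      also have "\<dots> = 2 powr q * max a b powr q" using ab by (simp add: powr_mult)
      also have "\<dots> \<le> 2 powr q * (a powr q + b powr q)"
        by (intro mult_left_mono) (auto simp: max_def)
      finally show "ennreal (norm (f x + g x) powr q) \<le> ennreal (2 powr q) * (ennreal (norm (f x) powr q) + ennreal (norm (g x) powr q))"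
        by (simp add: a_def b_def ennreal_leI flip: ennreal_plus ennreal_mult)
    qed
    also have "\<dots> = ennreal (2 powr q) * (N f + N g)"
      unfolding N_def by (simp add: nn_integral_cmult nn_integral_add)
    finally have le: "N (\<lambda>x. f x + g x) \<le> ennreal (2 powr q) * (N f + N g)" .
    have fin: "N f < \<infinity>" "N g < \<infinity>" using f g False by (auto simp: Lp_space_def N_def q_def)
    then have fin': "N (\<lambda>x. f x + g x) < \<infinity>"
      using le by (simp add: ennreal_mult_less_top order.strict_trans1)
    define I J where "I = enn2real (N f)" and "J = enn2real (N g)"
    have IJ: "0 \<le> I" "0 \<le> J" by (auto simp: I_def J_def)
    have "enn2real (N (\<lambda>x. f x + g x)) \<le> enn2real (ennreal (2 powr q) * (N f + N g))"
      using le fin by (intro enn2real_mono) (auto simp: ennreal_mult_less_top)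
    also have "\<dots> = 2 powr q * (I + J)"
      using fin by (simp add: enn2real_mult enn2real_plus I_def J_def)
    also have "\<dots> \<le> 2 powr q * (2 powr q * max I J)"
    proof (rule mult_left_mono)
      have "I + J \<le> 2 * max I J" by simp
      also have "\<dots> \<le> 2 powr q * max I J"
        using IJ powr_mono[of 1 q 2] q by (intro mult_right_mono) auto
      finally show "I + J \<le> 2 powr q * max I J" .
    qed simp
    finally have "enn2real (N (\<lambda>x. f x + g x)) powr (1 / q) \<le> (2 powr q * (2 powr q * max I J)) powr (1 / q)"
      using q by (intro powr_mono2) auto
    also have "\<dots> = 4 * max I J powr (1 / q)"
      using q IJ by (simp add: powr_mult powr_powr)
    also have "\<dots> \<le> 4 * (I powr (1 / q) + J powr (1 / q))"
      by (auto simp: max_def)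
    finally show ?thesis
      using False fin' by (simp add: Lp_norm_def Lp_space_def N_def I_def J_def q_def)
  qed
qed

lemma Lp_space_cmult:
  fixes f :: "'a::euclidean_space \<Rightarrow> complex"
  assumes p: "1 \<le> p" and f: "f \<in> Lp_space p"
  shows "(\<lambda>x. c * f x) \<in> Lp_space p \<and> Lp_norm p (\<lambda>x. c * f x) \<le> norm c * Lp_norm p f"
proof -
  have [measurable]: "f \<in> borel_measurable borel"
    using f by (auto simp: Lp_space_def)
  show ?thesis
  proof (cases "p = \<infinity>")
    case True
    define K where "K = ess_norm f"
    have K: "K < \<infinity>" using f True by (simp add: Lp_space_def K_def)
    have "AE x in lborel. ennreal (norm (f x)) \<le> K"
      unfolding K_def by (rule esssup_AE)
    then have "AE x in lborel. ennreal (norm (c * f x)) \<le> ennreal (norm c) * K"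
      by eventually_elim (simp add: norm_mult ennreal_mult mult_left_mono)
    then have le: "ess_norm (\<lambda>x. c * f x) \<le> ennreal (norm c) * K"
      by (intro esssup_I) auto
    also have "\<dots> < \<infinity>" using K by (simp add: ennreal_mult_less_top)
    finally have fin: "ess_norm (\<lambda>x. c * f x) < \<infinity>" .
    have "enn2real (ess_norm (\<lambda>x. c * f x)) \<le> enn2real (ennreal (norm c) * K)"
      using le K by (intro enn2real_mono) (auto simp: ennreal_mult_less_top)
    also have "\<dots> = norm c * enn2real K" by (simp add: enn2real_mult)
    finally show ?thesis using fin True by (simp add: Lp_space_def Lp_norm_def K_def)
  next
    case False
    show ?thesis
    proof (rule Lp_bound_from_nn_integral[OF p False f])
      show "nn_power_integral (enn2real p) (\<lambda>x. c * f x)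
        \<le> ennreal (norm c powr enn2real p) * nn_power_integral (enn2real p) f"
        by (simp add: norm_mult powr_mult ennreal_mult nn_integral_cmult)
    qed auto
  qed
qed

text \<open>The function \<open>g\<close> represents the multiplier \<open>\<rho>\<close> applied to
  \<open>f\<close>, in the sense of duality used for distributions.\<close>

abbreviation multiplier_image ::
    "('a::euclidean_space \<Rightarrow> complex) \<Rightarrow> ('a \<Rightarrow> complex) \<Rightarrow> ('a \<Rightarrow> complex) \<Rightarrow> bool" where
  "multiplier_image \<rho> f g \<equiv> (\<forall>\<phi>\<in>schwartz. (LINT x|lborel. g x * \<phi> x) =
     (LINT x|lborel. f x * fourier (\<lambda>\<xi>. \<rho> \<xi> * inv_fourier \<phi> \<xi>) x))"

text \<open>Invariance of the Schwartz space is part of the notion, because without it the test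
  functions that define the image need not be Schwartz functions.\<close>

definition Lp_multiplier :: "ennreal \<Rightarrow> ('a::euclidean_space \<Rightarrow> complex) \<Rightarrow> bool" where
  "Lp_multiplier p \<rho> \<longleftrightarrow> (\<forall>\<psi>\<in>schwartz. (\<lambda>\<xi>. \<rho> \<xi> * \<psi> \<xi>) \<in> schwartz) \<and>
     (\<exists>C\<ge>0. \<forall>f\<in>Lp_space p. \<exists>g\<in>Lp_space p. Lp_norm p g \<le> C * Lp_norm p f \<and> multiplier_image \<rho> f g)"

lemma schwartz_add: "f \<in> schwartz \<Longrightarrow> g \<in> schwartz \<Longrightarrow> (\<lambda>x. f x + g x) \<in> schwartz"
  by (rule schwartz_module_subset[OF schwartz_module.add[OF schwartz_module.base schwartz_module.base]])

lemma fourier_schwartz: "f \<in> schwartz \<Longrightarrow> fourier f \<in> schwartz"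
  unfolding fourier_eq_osc by (rule osc_transform_schwartz) auto

lemma inv_fourier_schwartz: "f \<in> schwartz \<Longrightarrow> inv_fourier f \<in> schwartz"
  unfolding inv_fourier_eq_osc by (rule osc_transform_schwartz) auto

lemma inv_fourier_fourier: "f \<in> schwartz \<Longrightarrow> inv_fourier (fourier f) = f"
  unfolding fourier_eq_osc inv_fourier_eq_osc
  using osc_transform_inverse[of f "- 2 * pi"] by (simp add: fun_eq_iff power_mult_distrib)

lemma fourier_inv_fourier: "f \<in> schwartz \<Longrightarrow> fourier (inv_fourier f) = f"
  unfolding fourier_eq_osc inv_fourier_eq_osc
  using osc_transform_inverse[of f "2 * pi"] by (simp add: fun_eq_iff power_mult_distrib)

lemma fourier_add:
  assumes "f \<in> schwartz" "g \<in> schwartz"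
  shows "fourier (\<lambda>x. f x + g x) = (\<lambda>x. fourier f x + fourier g x)"
proof -
  have "integrable lborel (\<lambda>x. f x * cis (- 2 * pi * (x \<bullet> \<xi>)))" "integrable lborel (\<lambda>x. g x * cis (- 2 * pi * (x \<bullet> \<xi>)))" for \<xi>
    by (intro integrable_mult_cis schwartz_integrable assms; simp)+
  then show ?thesis
    by (simp add: fun_eq_iff fourier_eq_osc osc_transform_def distrib_right)
qed

lemma Lp_multiplier_schwartz:
  "Lp_multiplier p \<rho> \<Longrightarrow> \<psi> \<in> schwartz \<Longrightarrow> (\<lambda>\<xi>. \<rho> \<xi> * \<psi> \<xi>) \<in> schwartz"
  by (simp add: Lp_multiplier_def)

lemma Lp_multiplierE:
  assumes "Lp_multiplier p \<rho>"
  obtains C where "C \<ge> 0" "\<And>f. f \<in> Lp_space p \<Longrightarrow> \<exists>g\<in>Lp_space p. Lp_norm p g \<le> C * Lp_norm p f \<and> multiplier_image \<rho> f g"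
  using assms unfolding Lp_multiplier_def by blast

lemma Lp_multiplier_const:
  fixes c :: complex
  assumes p: "1 \<le> p"
  shows "Lp_multiplier p (\<lambda>\<xi>::'a::euclidean_space. c)"
  unfolding Lp_multiplier_def
proof (intro conjI ballI exI[of _ "norm c"])
  fix f :: "'a \<Rightarrow> complex" assume f: "f \<in> Lp_space p"
  show "\<exists>g\<in>Lp_space p. Lp_norm p g \<le> norm c * Lp_norm p f \<and> multiplier_image (\<lambda>\<xi>. c) f g"
  proof (intro bexI[of _ "\<lambda>x. c * f x"] conjI ballI)
    fix \<phi> :: "'a \<Rightarrow> complex" assume \<phi>: "\<phi> \<in> schwartz"
    have "fourier (\<lambda>\<xi>. c * inv_fourier \<phi> \<xi>) x = c * fourier (inv_fourier \<phi>) x" for x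
      by (simp add: fourier_eq_osc osc_transform_def mult.assoc)
    then show "(LINT x|lborel. c * f x * \<phi> x) = (LINT x|lborel. f x * fourier (\<lambda>\<xi>. c * inv_fourier \<phi> \<xi>) x)"
      by (simp add: fourier_inv_fourier[OF \<phi>] mult_ac)
  qed (use Lp_space_cmult[OF p f] in auto)
qed (auto intro: schwartz_cmult)

lemma Lp_multiplier_add:
  fixes \<rho> \<tau> :: "'a::euclidean_space \<Rightarrow> complex"
  assumes p: "1 \<le> p" and \<rho>: "Lp_multiplier p \<rho>" and \<tau>: "Lp_multiplier p \<tau>"
  shows "Lp_multiplier p (\<lambda>\<xi>. \<rho> \<xi> + \<tau> \<xi>)"
proof -
  obtain C where C: "C \<ge> 0" "\<And>f. f \<in> Lp_space p \<Longrightarrow> \<exists>g\<in>Lp_space p. Lp_norm p g \<le> C * Lp_norm p f \<and> multiplier_image \<rho> f g"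
    by (rule Lp_multiplierE[OF \<rho>]) (rule that; blast)
  obtain D where D: "D \<ge> 0" "\<And>f. f \<in> Lp_space p \<Longrightarrow> \<exists>g\<in>Lp_space p. Lp_norm p g \<le> D * Lp_norm p f \<and> multiplier_image \<tau> f g"
    by (rule Lp_multiplierE[OF \<tau>]) (rule that; blast)
  show ?thesis
    unfolding Lp_multiplier_def
  proof (intro conjI ballI exI[of _ "4 * (C + D)"])
    fix f :: "'a \<Rightarrow> complex" assume f: "f \<in> Lp_space p"
    obtain g where g: "g \<in> Lp_space p" "Lp_norm p g \<le> C * Lp_norm p f" "multiplier_image \<rho> f g"
      using C(2)[OF f] by blast
    obtain h where h: "h \<in> Lp_space p" "Lp_norm p h \<le> D * Lp_norm p f" "multiplier_image \<tau> f h"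
      using D(2)[OF f] by blast
    have L: "f \<in> L1_plus_Linf" "g \<in> L1_plus_Linf" "h \<in> L1_plus_Linf"
      using Lp_space_L1_plus_Linf f g h p by blast+
    show "\<exists>g\<in>Lp_space p. Lp_norm p g \<le> 4 * (C + D) * Lp_norm p f \<and> multiplier_image (\<lambda>\<xi>. \<rho> \<xi> + \<tau> \<xi>) f g"
    proof (intro bexI[of _ "\<lambda>x. g x + h x"] conjI ballI)
      show "Lp_norm p (\<lambda>x. g x + h x) \<le> 4 * (C + D) * Lp_norm p f"
        using Lp_space_add[OF p g(1) h(1)] g(2) h(2) by (simp add: algebra_simps)
      fix \<phi> :: "'a \<Rightarrow> complex" assume \<phi>: "\<phi> \<in> schwartz"
      have S: "(\<lambda>\<xi>. \<rho> \<xi> * inv_fourier \<phi> \<xi>) \<in> schwartz" "(\<lambda>\<xi>. \<tau> \<xi> * inv_fourier \<phi> \<xi>) \<in> schwartz"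
        using Lp_multiplier_schwartz \<rho> \<tau> inv_fourier_schwartz \<phi> by blast+
      note fS = L1_plus_Linf_integrable_mult[OF L(1) fourier_schwartz[OF S(1)]]
        L1_plus_Linf_integrable_mult[OF L(1) fourier_schwartz[OF S(2)]]
      have "(LINT x|lborel. (g x + h x) * \<phi> x) = (LINT x|lborel. g x * \<phi> x) + (LINT x|lborel. h x * \<phi> x)"
        using L1_plus_Linf_integrable_mult[OF L(2) \<phi>] L1_plus_Linf_integrable_mult[OF L(3) \<phi>]
        by (simp add: distrib_right)
      also have "\<dots> = (LINT x|lborel. f x * fourier (\<lambda>\<xi>. \<rho> \<xi> * inv_fourier \<phi> \<xi>) x + f x * fourier (\<lambda>\<xi>. \<tau> \<xi> * inv_fourier \<phi> \<xi>) x)"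
        unfolding g(3)[rule_format, OF \<phi>] h(3)[rule_format, OF \<phi>] using fS by simp
      also have "\<dots> = (LINT x|lborel. f x * fourier (\<lambda>\<xi>. (\<rho> \<xi> + \<tau> \<xi>) * inv_fourier \<phi> \<xi>) x)"
        unfolding distrib_right fourier_add[OF S] distrib_left ..
      finally show "(LINT x|lborel. (g x + h x) * \<phi> x) = (LINT x|lborel. f x * fourier (\<lambda>\<xi>. (\<rho> \<xi> + \<tau> \<xi>) * inv_fourier \<phi> \<xi>) x)" .
    qed (use Lp_space_add[OF p g(1) h(1)] in blast)
  qed (use C D in \<open>auto simp: distrib_right intro!: schwartz_add Lp_multiplier_schwartz \<rho> \<tau>\<close>)
qed

text \<open>Composition of the two operators; on the dual side this uses that the inverse Fourier
  transform undoes the Fourier transform on Schwartz functions.\<close>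

lemma Lp_multiplier_mult:
  fixes \<rho> \<tau> :: "'a::euclidean_space \<Rightarrow> complex"
  assumes \<rho>: "Lp_multiplier p \<rho>" and \<tau>: "Lp_multiplier p \<tau>"
  shows "Lp_multiplier p (\<lambda>\<xi>. \<rho> \<xi> * \<tau> \<xi>)"
proof -
  obtain C where C: "C \<ge> 0" "\<And>f. f \<in> Lp_space p \<Longrightarrow> \<exists>g\<in>Lp_space p. Lp_norm p g \<le> C * Lp_norm p f \<and> multiplier_image \<rho> f g"
    by (rule Lp_multiplierE[OF \<rho>]) (rule that; blast)
  obtain D where D: "D \<ge> 0" "\<And>f. f \<in> Lp_space p \<Longrightarrow> \<exists>g\<in>Lp_space p. Lp_norm p g \<le> D * Lp_norm p f \<and> multiplier_image \<tau> f g"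
    by (rule Lp_multiplierE[OF \<tau>]) (rule that; blast)
  show ?thesis
    unfolding Lp_multiplier_def
  proof (intro conjI ballI exI[of _ "D * C"])
    show "(\<lambda>\<xi>. \<rho> \<xi> * \<tau> \<xi> * \<psi> \<xi>) \<in> schwartz" if "\<psi> \<in> schwartz" for \<psi>
      using Lp_multiplier_schwartz[OF \<rho> Lp_multiplier_schwartz[OF \<tau> that]] by (simp add: mult.assoc)
    fix f :: "'a \<Rightarrow> complex" assume f: "f \<in> Lp_space p"
    obtain g where g: "g \<in> Lp_space p" "Lp_norm p g \<le> C * Lp_norm p f" "multiplier_image \<rho> f g"
      using C(2)[OF f] by blast
    obtain h where h: "h \<in> Lp_space p" "Lp_norm p h \<le> D * Lp_norm p g" "multiplier_image \<tau> g h"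
      using D(2)[OF g(1)] by blast
    show "\<exists>g\<in>Lp_space p. Lp_norm p g \<le> D * C * Lp_norm p f \<and> multiplier_image (\<lambda>\<xi>. \<rho> \<xi> * \<tau> \<xi>) f g"
    proof (intro bexI[OF _ h(1)] conjI ballI)
      show "Lp_norm p h \<le> D * C * Lp_norm p f"
        using h(2) mult_left_mono[OF g(2) D(1)] by (simp add: mult.assoc)
      fix \<phi> :: "'a \<Rightarrow> complex" assume \<phi>: "\<phi> \<in> schwartz"
      have S: "(\<lambda>\<xi>. \<tau> \<xi> * inv_fourier \<phi> \<xi>) \<in> schwartz"
        using Lp_multiplier_schwartz \<tau> inv_fourier_schwartz \<phi> by blast
      show "(LINT x|lborel. h x * \<phi> x) = (LINT x|lborel. f x * fourier (\<lambda>\<xi>. \<rho> \<xi> * \<tau> \<xi> * inv_fourier \<phi> \<xi>) x)"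
        unfolding h(3)[rule_format, OF \<phi>] g(3)[rule_format, OF fourier_schwartz[OF S]] inv_fourier_fourier[OF S] by (simp add: mult.assoc)
    qed
  qed (use C D in auto)
qed

lemma integral_lborel_shift:
  fixes h :: "'a::euclidean_space \<Rightarrow> 'b::{banach, second_countable_topology}"
  assumes "h \<in> borel_measurable borel"
  shows "(LINT y|lborel. h (y + v)) = (LINT y|lborel. h y)"
  using integral_lborel_affine[OF assms, of 1 v] by (simp add: add.commute)

text \<open>If \<open>\<rho>\<close> is a superposition of characters, then the operator with symbol
  \<open>\<rho>\<close> averages translations: the dual operator sends \<open>\<phi>\<close> to
  \<open>\<integral> W \<phi>(\<cdot> + X)\<close> by Fourier inversion, and Fubini's theorem moves
  the average to \<open>f\<close>.\<close>

lemma translation_average_duality: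
  fixes f :: "'a::euclidean_space \<Rightarrow> complex" and W :: "'b \<Rightarrow> complex"
  assumes M: "sigma_finite_measure M" and W: "integrable M W" and X: "X \<in> borel_measurable M"
    and \<rho>: "\<And>\<xi>. \<rho> \<xi> = (LINT \<omega>|M. W \<omega> * cis (- 2 * pi * (X \<omega> \<bullet> \<xi>)))"
    and f: "f \<in> L1_plus_Linf" and \<phi>: "\<phi> \<in> schwartz"
  shows "(LINT z|lborel. (LINT \<omega>|M. W \<omega> * f (z - X \<omega>)) * \<phi> z)
       = (LINT y|lborel. f y * fourier (\<lambda>\<xi>. \<rho> \<xi> * inv_fourier \<phi> \<xi>) y)"
proof -
  let ?J = "\<lambda>\<omega> y. W \<omega> * (f y * \<phi> (y + X \<omega>))"
  interpret M: sigma_finite_measure M by fact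
  interpret P: pair_sigma_finite M "lborel :: 'a measure" ..
  define \<psi> where "\<psi> = inv_fourier \<phi>"
  let ?I = "\<lambda>y \<omega> \<xi>. W \<omega> * \<psi> \<xi> * cis (- 2 * pi * (\<xi> \<bullet> (y + X \<omega>)))"
  have \<psi>: "\<psi> \<in> schwartz" unfolding \<psi>_def by (rule inv_fourier_schwartz[OF \<phi>])
  note [measurable] = X borel_measurable_integrable[OF W] L1_plus_Linf_measurable[OF f]
    schwartz_measurable[OF \<phi>] schwartz_measurable[OF \<psi>]
  have fourier_eq: "fourier (\<lambda>\<xi>. \<rho> \<xi> * \<psi> \<xi>) y = (LINT \<omega>|M. W \<omega> * \<phi> (y + X \<omega>))" for y
  proof -
    have int: "integrable (M \<Otimes>\<^sub>M lborel) (\<lambda>(\<omega>, \<xi>). ?I y \<omega> \<xi>)"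
    proof (rule P.Fubini_integrable)
      show "integrable M (\<lambda>\<omega>. LINT \<xi>|lborel. norm (case (\<omega>, \<xi>) of (\<omega>, \<xi>) \<Rightarrow> ?I y \<omega> \<xi>))"
        using W by (simp add: norm_mult)
      show "AE \<omega> in M. integrable lborel (\<lambda>\<xi>. case (\<omega>, \<xi>) of (\<omega>, \<xi>) \<Rightarrow> ?I y \<omega> \<xi>)"
        using schwartz_integrable[OF \<psi>] by (auto intro!: integrable_mult_cis)
    qed measurable
    have "fourier (\<lambda>\<xi>. \<rho> \<xi> * \<psi> \<xi>) y = (LINT \<xi>|lborel. LINT \<omega>|M. ?I y \<omega> \<xi>)"
      unfolding fourier_eq_osc osc_transform_def
    proof (rule Bochner_Integration.integral_cong)
      fix \<xi> :: 'a
      have "\<rho> \<xi> * \<psi> \<xi> * cis (- 2 * pi * (\<xi> \<bullet> y)) = (LINT \<omega>|M. (W \<omega> * cis (- 2 * pi * (X \<omega> \<bullet> \<xi>))) * (\<psi> \<xi> * cis (- 2 * pi * (\<xi> \<bullet> y))))"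
        unfolding \<rho> mult.assoc[of "integral\<^sup>L M _"] by (rule integral_mult_left_zero[symmetric])
      also have "\<dots> = (LINT \<omega>|M. ?I y \<omega> \<xi>)"
      proof (rule Bochner_Integration.integral_cong)
        fix \<omega>
        have "cis (- 2 * pi * (X \<omega> \<bullet> \<xi>)) * cis (- 2 * pi * (\<xi> \<bullet> y)) = cis (- 2 * pi * (\<xi> \<bullet> (y + X \<omega>)))"
          by (simp add: cis_mult inner_add_right inner_commute algebra_simps)
        then show "(W \<omega> * cis (- 2 * pi * (X \<omega> \<bullet> \<xi>))) * (\<psi> \<xi> * cis (- 2 * pi * (\<xi> \<bullet> y))) = ?I y \<omega> \<xi>"
          by (metis (no_types, lifting) mult.assoc mult.left_commute)
      qed simp
      finally show "\<rho> \<xi> * \<psi> \<xi> * cis (- 2 * pi * (\<xi> \<bullet> y)) = (LINT \<omega>|M. ?I y \<omega> \<xi>)" .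
    qed simp
    also have "\<dots> = (LINT \<omega>|M. LINT \<xi>|lborel. ?I y \<omega> \<xi>)"
      by (rule P.Fubini_integral[OF int])
    also have "\<dots> = (LINT \<omega>|M. W \<omega> * \<phi> (y + X \<omega>))"
    proof (rule Bochner_Integration.integral_cong)
      fix \<omega>
      have "(LINT \<xi>|lborel. ?I y \<omega> \<xi>) = W \<omega> * fourier \<psi> (y + X \<omega>)"
        unfolding fourier_eq_osc osc_transform_def by (simp add: mult.assoc del: mult_minus_left)
      then show "(LINT \<xi>|lborel. ?I y \<omega> \<xi>) = W \<omega> * \<phi> (y + X \<omega>)"
        by (simp add: \<psi>_def fourier_inv_fourier[OF \<phi>])
    qed simp
    finally show ?thesis .
  qed
  obtain a b where ab: "a \<ge> 0" "integrable lborel b" "\<And>x. 0 \<le> b x" "AE x in lborel. norm (f x) \<le> a + b x"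
    using L1_plus_LinfE[OF f] by metis
  obtain K where K: "K > 0" "\<And>x. norm (\<phi> x) \<le> K"
    using schwartz_bounded[OF \<phi>] by metis
  define B where "B = a * (LINT x|lborel. norm (\<phi> x)) + K * (LINT x|lborel. b x)"
  have shift_int: "integrable lborel (\<lambda>y. \<phi> (y + v))" for v
    using integrable_lborel_affine[OF schwartz_integrable[OF \<phi>], of 1 v] by (simp add: add.commute)
  have dom: "AE y in lborel. norm (f y * \<phi> (y + v)) \<le> a * norm (\<phi> (y + v)) + K * b y" for v
    using ab(4)
  proof eventually_elim
    case (elim y)
    have "norm (f y * \<phi> (y + v)) \<le> (a + b y) * norm (\<phi> (y + v))"
      unfolding norm_mult by (intro mult_right_mono elim) auto
    also have "\<dots> \<le> a * norm (\<phi> (y + v)) + K * b y"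
      using mult_left_mono[OF K(2)[of "y + v"] ab(3)[of y]] by (simp add: distrib_right mult.commute)
    finally show ?case .
  qed
  have dom_int: "integrable lborel (\<lambda>y. a * norm (\<phi> (y + v)) + K * b y)" for v
    using shift_int ab by simp
  have int_v: "integrable lborel (\<lambda>y. f y * \<phi> (y + v))" for v
  proof (rule Bochner_Integration.integrable_bound[OF dom_int[of v]])
    show "AE y in lborel. norm (f y * \<phi> (y + v)) \<le> norm (a * norm (\<phi> (y + v)) + K * b y)"
      using dom[of v] by eventually_elim simp
  qed measurable
  have bound_v: "(LINT y|lborel. norm (f y * \<phi> (y + v))) \<le> B" for v
  proof -
    have "(LINT y|lborel. norm (f y * \<phi> (y + v))) \<le> (LINT y|lborel. a * norm (\<phi> (y + v)) + K * b y)"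
      by (rule integral_mono_AE[OF integrable_norm[OF int_v] dom_int dom])
    also have "\<dots> = B"
      using shift_int ab integral_lborel_shift[of "\<lambda>y. norm (\<phi> y)" v] by (simp add: B_def)
    finally show ?thesis .
  qed
  have int: "integrable (M \<Otimes>\<^sub>M lborel) (\<lambda>(\<omega>, y). ?J \<omega> y)"
  proof (rule P.Fubini_integrable)
    show "integrable M (\<lambda>\<omega>. LINT y|lborel. norm (case (\<omega>, y) of (\<omega>, y) \<Rightarrow> ?J \<omega> y))"
    proof (rule Bochner_Integration.integrable_bound)
      show "integrable M (\<lambda>\<omega>. B * norm (W \<omega>))" using W by simp
      show "AE \<omega> in M. norm (LINT y|lborel. norm (case (\<omega>, y) of (\<omega>, y) \<Rightarrow> ?J \<omega> y)) \<le> norm (B * norm (W \<omega>))"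
      proof (rule AE_I2)
        fix \<omega>
        have "(LINT y|lborel. norm (?J \<omega> y)) = norm (W \<omega>) * (LINT y|lborel. norm (f y * \<phi> (y + X \<omega>)))"
          by (simp add: norm_mult)
        also have "\<dots> \<le> norm (W \<omega>) * B"
          by (intro mult_left_mono bound_v) simp
        finally show "norm (LINT y|lborel. norm (case (\<omega>, y) of (\<omega>, y) \<Rightarrow> ?J \<omega> y)) \<le> norm (B * norm (W \<omega>))"
          by (simp add: mult.commute integral_nonneg_AE)
      qed
    qed measurable
    show "AE \<omega> in M. integrable lborel (\<lambda>y. case (\<omega>, y) of (\<omega>, y) \<Rightarrow> ?J \<omega> y)"
      using int_v by simp
  qed measurable
  have int': "integrable (M \<Otimes>\<^sub>M lborel) (\<lambda>(\<omega>, z). W \<omega> * (f (z - X \<omega>) * \<phi> z))"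
  proof (rule P.Fubini_integrable)
    have "(LINT z|lborel. norm (W \<omega> * (f (z - X \<omega>) * \<phi> z))) = (LINT y|lborel. norm (?J \<omega> y))" for \<omega>
      by (subst integral_lborel_shift[symmetric, where v = "X \<omega>"]) auto
    then show "integrable M (\<lambda>\<omega>. LINT z|lborel. norm (case (\<omega>, z) of (\<omega>, z) \<Rightarrow> W \<omega> * (f (z - X \<omega>) * \<phi> z)))"
      using P.integrable_fst'[OF integrable_norm[OF int]] by simp
    have "integrable lborel (\<lambda>z. f (z - v) * \<phi> z)" for v
      using integrable_lborel_affine[OF int_v[of v], of 1 "- v"] by simp
    then show "AE \<omega> in M. integrable lborel (\<lambda>z. case (\<omega>, z) of (\<omega>, z) \<Rightarrow> W \<omega> * (f (z - X \<omega>) * \<phi> z))"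
      by simp
  qed measurable
  have "(LINT z|lborel. (LINT \<omega>|M. W \<omega> * f (z - X \<omega>)) * \<phi> z) = (LINT z|lborel. LINT \<omega>|M. W \<omega> * (f (z - X \<omega>) * \<phi> z))"
    by (simp add: mult.assoc flip: integral_mult_left_zero)
  also have "\<dots> = (LINT \<omega>|M. LINT z|lborel. W \<omega> * (f (z - X \<omega>) * \<phi> z))"
    by (rule P.Fubini_integral[OF int'])
  also have "\<dots> = (LINT \<omega>|M. LINT y|lborel. ?J \<omega> y)"
  proof (rule Bochner_Integration.integral_cong[OF refl])
    fix \<omega>
    show "(LINT z|lborel. W \<omega> * (f (z - X \<omega>) * \<phi> z)) = (LINT y|lborel. ?J \<omega> y)"
      by (subst integral_lborel_shift[symmetric, where v = "X \<omega>"]) simp_all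
  qed
  also have "\<dots> = (LINT y|lborel. LINT \<omega>|M. ?J \<omega> y)"
    by (rule P.Fubini_integral[OF int, symmetric])
  also have "\<dots> = (LINT y|lborel. f y * fourier (\<lambda>\<xi>. \<rho> \<xi> * \<psi> \<xi>) y)"
  proof (rule Bochner_Integration.integral_cong)
    fix y
    have "(LINT \<omega>|M. ?J \<omega> y) = (LINT \<omega>|M. f y * (W \<omega> * \<phi> (y + X \<omega>)))"
      by (simp add: mult_ac)
    then show "(LINT \<omega>|M. ?J \<omega> y) = f y * fourier (\<lambda>\<xi>. \<rho> \<xi> * \<psi> \<xi>) y"
      by (simp add: fourier_eq)
  qed simp
  finally show ?thesis by (simp add: \<psi>_def)
qed

text \<open>Jensen's inequality at each point, followed by Tonelli's theorem and the translation
  invariance of Lebesgue measure.\<close>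

lemma translation_average_Lp_bound:
  fixes f :: "'a::euclidean_space \<Rightarrow> complex" and W :: "'b \<Rightarrow> complex"
  assumes M: "sigma_finite_measure M" and W: "integrable M W" and X: "X \<in> borel_measurable M"
    and p: "1 \<le> p" "p \<noteq> \<infinity>" and f: "f \<in> Lp_space p"
    and A: "(LINT \<omega>|M. norm (W \<omega>)) \<le> A" "0 < A"
  shows "(\<lambda>z. LINT \<omega>|M. W \<omega> * f (z - X \<omega>)) \<in> Lp_space p \<and>
    Lp_norm p (\<lambda>z. LINT \<omega>|M. W \<omega> * f (z - X \<omega>)) \<le> A * Lp_norm p f"
proof -
  interpret M: sigma_finite_measure M by fact
  interpret P: pair_sigma_finite M "lborel :: 'a measure" ..
  have [measurable]: "f \<in> borel_measurable borel" using f by (simp add: Lp_space_def)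
  note [measurable] = X borel_measurable_integrable[OF W]
  define q where "q = enn2real p"
  have q: "1 \<le> q" unfolding q_def using p by (rule enn2real_exponent_ge_1)
  define g where "g z = (LINT \<omega>|M. W \<omega> * f (z - X \<omega>))" for z
  have [measurable]: "g \<in> borel_measurable borel"
    unfolding g_def[abs_def] by measurable
  define I where "I = nn_power_integral q f"
  let ?v = "\<lambda>z \<omega>. norm (W \<omega>) * norm (f (z - X \<omega>)) powr q"
  let ?V = "\<lambda>z \<omega>. ennreal (norm (W \<omega>)) * ennreal (norm (f (z - X \<omega>)) powr q)"
  have pointwise: "ennreal (norm (g z) powr q)
      \<le> ennreal (A powr (q - 1)) * (\<integral>\<^sup>+ \<omega>. ?V z \<omega> \<partial>M)" (is "_ \<le> _ * ?J") for z
  proof (cases "?J = \<infinity>")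
    case True
    then show ?thesis using A by (simp add: ennreal_mult_top)
  next
    case False
    have ihq: "integrable M (\<lambda>\<omega>. ?v z \<omega>)"
      using False by (intro integrableI_bounded) (auto simp: ennreal_mult less_top)
    have ih: "integrable M (\<lambda>\<omega>. norm (W \<omega>) * norm (f (z - X \<omega>)))"
    proof (rule Bochner_Integration.integrable_bound)
      show "integrable M (\<lambda>\<omega>. norm (W \<omega>) + ?v z \<omega>)"
        using W ihq by simp
      have "t \<le> 1 + t powr q" if "0 \<le> t" for t :: real
        using powr_above_tangent[OF q that, of 1] q that
        by (smt (verit) mult_left_mono mult_cancel_right1 powr_one_eq_one mult.commute mult_le_cancel_right2 powr_ge_zero mult_1)
      then have "norm (W \<omega>) * norm (f (z - X \<omega>)) \<le> norm (W \<omega>) * (1 + norm (f (z - X \<omega>)) powr q)" for \<omega>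
        by (intro mult_left_mono) auto
      then show "AE \<omega> in M. norm (norm (W \<omega>) * norm (f (z - X \<omega>))) \<le> norm (norm (W \<omega>) + ?v z \<omega>)"
        by (simp add: distrib_left)
    qed measurable
    have "norm (g z) \<le> (LINT \<omega>|M. norm (W \<omega>) * norm (f (z - X \<omega>)))"
      unfolding g_def by (rule norm_integral_le[OF ih]) (simp add: norm_mult)
    then have "norm (g z) powr q \<le> (LINT \<omega>|M. norm (W \<omega>) * norm (f (z - X \<omega>))) powr q"
      using q by (intro powr_mono2) auto
    also have "\<dots> \<le> A powr (q - 1) * (LINT \<omega>|M. ?v z \<omega>)"
      using W by (intro powr_integral_le q ih ihq A) auto
    finally have "ennreal (norm (g z) powr q) \<le> ennreal (A powr (q - 1)) * ennreal (LINT \<omega>|M. ?v z \<omega>)"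
      by (simp add: ennreal_leI flip: ennreal_mult')
    also have "ennreal (LINT \<omega>|M. ?v z \<omega>) = ?J"
      using ihq by (subst nn_integral_eq_integral[symmetric]) (auto simp: ennreal_mult)
    finally show ?thesis .
  qed
  have shift: "(\<integral>\<^sup>+ z. ennreal (norm (f (z - v)) powr q) \<partial>lborel) = I" for v
  proof -
    have "I = (\<integral>\<^sup>+ x. ennreal (norm (f x) powr q) \<partial>distr lborel borel ((+) (- v)))"
      unfolding I_def by (simp add: lborel_distr_plus)
    also have "\<dots> = (\<integral>\<^sup>+ z. ennreal (norm (f (z - v)) powr q) \<partial>lborel)"
      by (subst nn_integral_distr) auto
    finally show ?thesis by simp
  qed
  have "(\<integral>\<^sup>+ z. ennreal (norm (g z) powr q) \<partial>lborel)
      \<le> (\<integral>\<^sup>+ z. ennreal (A powr (q - 1)) * (\<integral>\<^sup>+ \<omega>. ?V z \<omega> \<partial>M) \<partial>lborel)"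
    by (intro nn_integral_mono pointwise)
  also have "\<dots> = ennreal (A powr (q - 1)) * (\<integral>\<^sup>+ z. (\<integral>\<^sup>+ \<omega>. ?V z \<omega> \<partial>M) \<partial>lborel)"
    by (rule nn_integral_cmult) measurable
  also have "(\<integral>\<^sup>+ z. (\<integral>\<^sup>+ \<omega>. ?V z \<omega> \<partial>M) \<partial>lborel)
      = (\<integral>\<^sup>+ \<omega>. (\<integral>\<^sup>+ z. ?V z \<omega> \<partial>lborel) \<partial>M)"
    by (rule P.Fubini') measurable
  also have "\<dots> = (\<integral>\<^sup>+ \<omega>. ennreal (norm (W \<omega>)) * I \<partial>M)"
    by (subst nn_integral_cmult) (auto simp: shift)
  also have "\<dots> = (\<integral>\<^sup>+ \<omega>. ennreal (norm (W \<omega>)) \<partial>M) * I"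
    by (rule nn_integral_multc) measurable
  also have "(\<integral>\<^sup>+ \<omega>. ennreal (norm (W \<omega>)) \<partial>M) = ennreal (LINT \<omega>|M. norm (W \<omega>))"
    using W by (intro nn_integral_eq_integral) auto
  also have "ennreal (A powr (q - 1)) * (ennreal (LINT \<omega>|M. norm (W \<omega>)) * I) \<le> ennreal (A powr (q - 1)) * (ennreal A * I)"
    by (intro mult_left_mono mult_right_mono ennreal_leI A) auto
  also have "\<dots> = ennreal (A powr q) * I"
    using A by (simp add: powr_diff mult.assoc[symmetric] flip: ennreal_mult)
  finally show ?thesis
    unfolding g_def[symmetric] I_def q_def using A by (intro Lp_bound_from_nn_integral p f) auto
qed

lemma Lp_multiplier_translation_average:
  fixes \<rho> :: "'a::euclidean_space \<Rightarrow> complex" and W :: "'b \<Rightarrow> complex"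
  assumes M: "sigma_finite_measure M" and W: "integrable M W" and X: "X \<in> borel_measurable M"
    and \<rho>: "\<And>\<xi>. \<rho> \<xi> = (LINT \<omega>|M. W \<omega> * cis (- 2 * pi * (X \<omega> \<bullet> \<xi>)))"
    and symb: "\<rho> \<in> symbols" and p: "1 \<le> p"
  shows "Lp_multiplier p \<rho>"
proof -
  \<comment> \<open>The summand \<open>1\<close> makes the constant positive even for \<open>W =
    0\<close>.\<close>
  define A where "A = (LINT \<omega>|M. norm (W \<omega>)) + 1"
  have A: "(LINT \<omega>|M. norm (W \<omega>)) \<le> A" "0 < A"
  proof -
    have "0 \<le> (LINT \<omega>|M. norm (W \<omega>))" by (rule Bochner_Integration.integral_nonneg) simp
    then show "(LINT \<omega>|M. norm (W \<omega>)) \<le> A" "0 < A" unfolding A_def by linarith+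
  qed
  interpret M: sigma_finite_measure M by fact
  note [measurable] = X borel_measurable_integrable[OF W]
  show ?thesis
    unfolding Lp_multiplier_def
  proof (intro conjI ballI exI[of _ A])
    fix f :: "'a \<Rightarrow> complex" assume f: "f \<in> Lp_space p"
    have [measurable]: "f \<in> borel_measurable borel" using f by (simp add: Lp_space_def)
    have fL: "f \<in> L1_plus_Linf" by (rule Lp_space_L1_plus_Linf[OF f p])
    show "\<exists>g\<in>Lp_space p. Lp_norm p g \<le> A * Lp_norm p f \<and> multiplier_image \<rho> f g"
    proof (cases "p = \<infinity>")
      case False
      then show ?thesis
        using translation_average_Lp_bound[OF M W X p False f A]
          translation_average_duality[OF M W X \<rho> fL] by blast
    next
      case True
      define K where "K = enn2real (ess_norm f)"
      have fin: "ess_norm f < \<infinity>" using f True by (simp add: Lp_space_def)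
      have K: "0 \<le> K" by (simp add: K_def)
      \<comment> \<open>An everywhere bounded representative: otherwise each translate of
        \<open>f\<close> would exceed \<open>K\<close> on a null set of its own.\<close>
      define f' where "f' x = (if norm (f x) \<le> K then f x else 0)" for x
      have [measurable]: "f' \<in> borel_measurable borel" unfolding f'_def[abs_def] by measurable
      have f'K: "norm (f' x) \<le> K" for x using K by (simp add: f'_def)
      have "AE x in lborel. ennreal (norm (f x)) \<le> ess_norm f"
        by (rule esssup_AE)
      then have ff': "AE x in lborel. f' x = f x"
      proof eventually_elim
        case (elim x)
        have "ennreal (norm (f x)) \<le> ennreal K" using elim fin by (simp add: K_def less_top)
        then show ?case using K by (simp add: f'_def ennreal_le_iff)
      qed
      have f'L: "f' \<in> L1_plus_Linf"
        unfolding L1_plus_Linf_def using K f'K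
        by (intro CollectI conjI exI[of _ K] exI[of _ "\<lambda>_. 0"]) auto
      define g where "g z = (LINT \<omega>|M. W \<omega> * f' (z - X \<omega>))" for z
      have [measurable]: "g \<in> borel_measurable borel"
        unfolding g_def[abs_def] by measurable
      have "norm (g z) \<le> A * K" for z
      proof -
        have "norm (g z) \<le> (LINT \<omega>|M. norm (W \<omega>) * K)"
          unfolding g_def by (rule norm_integral_le) (use W f'K in \<open>auto simp: norm_mult intro!: mult_left_mono\<close>)
        also have "\<dots> \<le> A * K" using A K by (simp add: mult_right_mono)
        finally show ?thesis .
      qed
      then have le: "ess_norm g \<le> ennreal (A * K)"
        by (intro esssup_I) (auto intro!: ennreal_leI)
      then have "g \<in> Lp_space p"
        using True by (auto simp: Lp_space_def intro: order.strict_trans1)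
      moreover have "Lp_norm p g \<le> A * Lp_norm p f"
        using enn2real_mono[OF le] True K A by (simp add: Lp_norm_def K_def)
      moreover have "(LINT x|lborel. g x * \<phi> x) = (LINT x|lborel. f x * fourier (\<lambda>\<xi>. \<rho> \<xi> * inv_fourier \<phi> \<xi>) x)"
        if \<phi>: "\<phi> \<in> schwartz" for \<phi>
      proof -
        have "fourier (\<lambda>\<xi>. \<rho> \<xi> * inv_fourier \<phi> \<xi>) \<in> schwartz"
          by (intro fourier_schwartz schwartz_symbol_mult symb inv_fourier_schwartz \<phi>)
        note [measurable] = schwartz_measurable[OF this]
        have "(LINT x|lborel. g x * \<phi> x) = (LINT x|lborel. f' x * fourier (\<lambda>\<xi>. \<rho> \<xi> * inv_fourier \<phi> \<xi>) x)"
          unfolding g_def by (rule translation_average_duality[OF M W X \<rho> f'L \<phi>])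
        also have "\<dots> = (LINT x|lborel. f x * fourier (\<lambda>\<xi>. \<rho> \<xi> * inv_fourier \<phi> \<xi>) x)"
          using ff' by (intro integral_cong_AE) auto
        finally show ?thesis .
      qed
      ultimately show ?thesis by blast
    qed
  qed (use A in \<open>auto intro: schwartz_symbol_mult symb\<close>)
qed

text \<open>The heat kernel representation exhibits the symbol as a superposition of
  characters.\<close>

lemma Lp_multiplier_laplace_L1:
  assumes H: "H \<in> laplace_L1" and p: "1 \<le> p"
    and symb: "(\<lambda>\<xi>::'a::euclidean_space. complex_of_real (H (4 * pi\<^sup>2 * (norm \<xi>)\<^sup>2))) \<in> symbols"
  shows "Lp_multiplier p (\<lambda>\<xi>::'a. complex_of_real (H (4 * pi\<^sup>2 * (norm \<xi>)\<^sup>2)))"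
proof -
  obtain w where w: "integrable lborel w" "\<And>t. t \<ge> 0 \<Longrightarrow> H t = (LINT r|lborel. w r * exp (- (\<bar>r\<bar> * t)))"
    using H by (auto simp: laplace_L1_def)
  show ?thesis
  proof (rule Lp_multiplier_translation_average[where M = "lborel :: (real \<times> 'a) measure"
        and W = "\<lambda>(r, y). complex_of_real (w r * gauss y)" and X = "\<lambda>(r, y). (2 * sqrt pi * sqrt \<bar>r\<bar>) *\<^sub>R y"])
    show "sigma_finite_measure (lborel :: (real \<times> 'a) measure)" by (rule sigma_finite_lborel)
    show "(\<lambda>(r, y). (2 * sqrt pi * sqrt \<bar>r\<bar>) *\<^sub>R y) \<in> borel_measurable (lborel :: (real \<times> 'a) measure)"
      unfolding lborel_prod[symmetric] by measurable
    fix \<xi> :: 'a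
    show "complex_of_real (H (4 * pi\<^sup>2 * (norm \<xi>)\<^sup>2)) = (LINT \<omega>|lborel. (case \<omega> of (r, y) \<Rightarrow> complex_of_real (w r * gauss y))
        * cis (- 2 * pi * ((case \<omega> of (r, y) \<Rightarrow> (2 * sqrt pi * sqrt \<bar>r\<bar>) *\<^sub>R y) \<bullet> \<xi>)))"
      using laplace_L1_radial(2)[OF w(1), of \<xi>] w(2)[of "4 * pi\<^sup>2 * (norm \<xi>)\<^sup>2"]
      by (simp add: case_prod_unfold)
  qed (use p symb laplace_L1_radial(1)[OF w(1)] in auto)
qed

section \<open>Comparison of the logarithmic Bessel symbols\<close>

lemma log_bessel_symbol_symbols: "1 < lam \<Longrightarrow> log_bessel_symbol s lam \<in> symbols"
  unfolding log_bessel_symbol_def[abs_def] of_real_mult by (intro symbols.mult symbols.powr symbols.ln)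

lemma Lp_multiplier_powr_ratio:
  assumes p: "1 \<le> p" and lam: "1 < lam1" "lam1 < lam2"
  shows "Lp_multiplier p (\<lambda>\<xi>::'a::euclidean_space. complex_of_real
     (((shifted_square lam1 \<xi>) / (shifted_square lam2 \<xi>)) powr a))"
proof -
  define H where "H t = ((lam1 + t) / (lam2 + t)) powr a - 1" for t
  have pos: "1 < shifted_square lam1 \<xi>" "1 < shifted_square lam2 \<xi>" for \<xi> :: 'a
    using lam by (auto intro!: shifted_square_gt_1)
  have eq: "complex_of_real (H (4 * pi\<^sup>2 * (norm \<xi>)\<^sup>2)) = of_real ((shifted_square lam1 \<xi>) powr a) *
      of_real ((shifted_square lam2 \<xi>) powr (- a)) + (-1)" for \<xi> :: 'a
    using pos[of \<xi>] by (simp add: H_def powr_divide powr_minus_divide)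
  have "Lp_multiplier p (\<lambda>\<xi>::'a. complex_of_real (H (4 * pi\<^sup>2 * (norm \<xi>)\<^sup>2)))"
  proof (rule Lp_multiplier_laplace_L1[OF _ p])
    show "H \<in> laplace_L1" unfolding H_def[abs_def] using lam by (intro laplace_L1_powr_ratio) auto
    show "(\<lambda>\<xi>::'a. complex_of_real (H (4 * pi\<^sup>2 * (norm \<xi>)\<^sup>2))) \<in> symbols"
      unfolding eq using lam by (intro symbols.add symbols.mult symbols.powr symbols.const) auto
  qed
  from Lp_multiplier_add[OF p this Lp_multiplier_const[OF p, of 1]]
  show ?thesis by (simp add: H_def)
qed

lemma Lp_multiplier_ln_ratio:
  assumes p: "1 \<le> p" and lam: "1 < lam1" "lam1 < lam2"
  shows "Lp_multiplier p (\<lambda>\<xi>::'a::euclidean_space. complex_of_real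
     (ln ((shifted_square lam1 \<xi>) / (shifted_square lam2 \<xi>))))"
proof (rule Lp_multiplier_laplace_L1[OF _ p])
  show "(\<lambda>t. ln ((lam1 + t) / (lam2 + t))) \<in> laplace_L1" using lam by (intro laplace_L1_ln_ratio) auto
  have pos: "1 < shifted_square lam1 \<xi>" "1 < shifted_square lam2 \<xi>" for \<xi> :: 'a
    using lam by (auto intro!: shifted_square_gt_1)
  have eq: "complex_of_real (ln ((shifted_square lam1 \<xi>) / (shifted_square lam2 \<xi>)))
     = of_real (ln (shifted_square lam1 \<xi>)) + (-1) * of_real (ln (shifted_square lam2 \<xi>))" for \<xi> :: 'a
    using pos[of \<xi>] by (subst ln_div) auto
  show "(\<lambda>\<xi>::'a. complex_of_real (ln ((shifted_square lam1 \<xi>) / (shifted_square lam2 \<xi>)))) \<in> symbols"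
    unfolding eq using lam by (intro symbols.add symbols.mult symbols.ln symbols.const) auto
qed

lemma Lp_multiplier_inverse_ln:
  assumes p: "1 \<le> p" and lam: "1 < lam"
  shows "Lp_multiplier p (\<lambda>\<xi>::'a::euclidean_space. complex_of_real (inverse (ln (shifted_square lam \<xi>))))"
  by (rule Lp_multiplier_laplace_L1[OF laplace_L1_inverse_ln[OF lam] p symbols.inverse_ln[OF lam]])

text \<open>Both quotients are assembled from three factors: a power of \<open>w1/w2\<close>, its
  logarithm, and a reciprocal logarithm.\<close>

lemma Lp_multiplier_symbol_ratio:
  assumes p: "1 \<le> p" and lam: "1 < lam1" "lam1 < lam2"
  shows "\<exists>\<rho> :: 'a::euclidean_space \<Rightarrow> complex. Lp_multiplier p \<rho> \<and> (\<forall>\<xi>. log_bessel_symbol s lam1 \<xi> = log_bessel_symbol s lam2 \<xi> * \<rho> \<xi>)"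
    and "\<exists>\<rho> :: 'a::euclidean_space \<Rightarrow> complex. Lp_multiplier p \<rho> \<and> (\<forall>\<xi>. log_bessel_symbol s lam2 \<xi> = log_bessel_symbol s lam1 \<xi> * \<rho> \<xi>)"
proof -
  define w1 w2 where "w1 \<xi> = shifted_square lam1 \<xi>" and "w2 \<xi> = shifted_square lam2 \<xi>" for \<xi> :: 'a
  have pos: "1 < w1 \<xi>" "1 < w2 \<xi>" for \<xi>
    unfolding w1_def w2_def using lam by (auto intro!: shifted_square_gt_1)
  have lnpos: "0 < ln (w1 \<xi>)" "0 < ln (w2 \<xi>)" for \<xi> using pos[of \<xi>] by auto
  have ln_ratio: "ln (w1 \<xi> / w2 \<xi>) = ln (w1 \<xi>) - ln (w2 \<xi>)" for \<xi>
    using pos[of \<xi>] by (subst ln_div) auto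
  have P: "Lp_multiplier p (\<lambda>\<xi>. complex_of_real ((w1 \<xi> / w2 \<xi>) powr a))" for a
    unfolding w1_def w2_def by (rule Lp_multiplier_powr_ratio[OF p lam])
  have L: "Lp_multiplier p (\<lambda>\<xi>. complex_of_real (ln (w1 \<xi> / w2 \<xi>)))"
    unfolding w1_def w2_def by (rule Lp_multiplier_ln_ratio[OF p lam])
  have E: "Lp_multiplier p (\<lambda>\<xi>. complex_of_real (inverse (ln (w1 \<xi>))))"
    "Lp_multiplier p (\<lambda>\<xi>. complex_of_real (inverse (ln (w2 \<xi>))))"
    unfolding w1_def w2_def using lam by (intro Lp_multiplier_inverse_ln p; simp)+
  have m: "log_bessel_symbol s lam1 \<xi> = of_real (w1 \<xi> powr s * ln (w1 \<xi>))"
    "log_bessel_symbol s lam2 \<xi> = of_real (w2 \<xi> powr s * ln (w2 \<xi>))" for \<xi>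
    by (simp_all add: log_bessel_symbol_def w1_def w2_def)
  have 1: "w1 \<xi> powr s * ln (w1 \<xi>) = w2 \<xi> powr s * ln (w2 \<xi>) *
      ((w1 \<xi> / w2 \<xi>) powr s * (1 + ln (w1 \<xi> / w2 \<xi>) * inverse (ln (w2 \<xi>))))" for \<xi>
    using pos[of \<xi>] lnpos[of \<xi>] by (simp add: ln_ratio powr_divide field_simps)
  have 2: "w2 \<xi> powr s * ln (w2 \<xi>) = w1 \<xi> powr s * ln (w1 \<xi>) *
      ((w1 \<xi> / w2 \<xi>) powr (- s) * (1 + (-1) * (ln (w1 \<xi> / w2 \<xi>) * inverse (ln (w1 \<xi>)))))" for \<xi>
    using pos[of \<xi>] lnpos[of \<xi>] by (simp add: ln_ratio powr_divide powr_minus field_simps)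
  have "Lp_multiplier p (\<lambda>\<xi>. complex_of_real ((w1 \<xi> / w2 \<xi>) powr s) *
      (1 + complex_of_real (ln (w1 \<xi> / w2 \<xi>)) * complex_of_real (inverse (ln (w2 \<xi>)))))"
    by (intro Lp_multiplier_mult Lp_multiplier_add p P L E Lp_multiplier_const)
  then show "\<exists>\<rho> :: 'a \<Rightarrow> complex. Lp_multiplier p \<rho> \<and> (\<forall>\<xi>. log_bessel_symbol s lam1 \<xi> = log_bessel_symbol s lam2 \<xi> * \<rho> \<xi>)"
    unfolding m 1 by (intro exI conjI allI) auto
  have "Lp_multiplier p (\<lambda>\<xi>. complex_of_real ((w1 \<xi> / w2 \<xi>) powr (- s)) *
      (1 + (-1) * (complex_of_real (ln (w1 \<xi> / w2 \<xi>)) * complex_of_real (inverse (ln (w1 \<xi>))))))"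
    by (intro Lp_multiplier_mult Lp_multiplier_add p P L E Lp_multiplier_const)
  then show "\<exists>\<rho> :: 'a \<Rightarrow> complex. Lp_multiplier p \<rho> \<and> (\<forall>\<xi>. log_bessel_symbol s lam2 \<xi> = log_bessel_symbol s lam1 \<xi> * \<rho> \<xi>)"
    unfolding m 2 by (intro exI conjI allI) auto
qed

lemma log_bessel_op_apply:
  assumes lam: "1 < lam" and \<phi>: "\<phi> \<in> schwartz"
  shows "log_bessel_op s lam u \<phi> = u (fourier (\<lambda>\<xi>. log_bessel_symbol s lam \<xi> * inv_fourier \<phi> \<xi>))"
proof -
  have "(\<lambda>\<xi>. log_bessel_symbol s lam \<xi> * inv_fourier \<phi> \<xi>) \<in> schwartz"
    by (intro schwartz_symbol_mult log_bessel_symbol_symbols lam inv_fourier_schwartz \<phi>)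
  then show ?thesis
    using \<phi> inv_fourier_schwartz[OF \<phi>]
    by (simp add: log_bessel_op_def fourier_multiplier_def distr_inv_fourier_def distr_mult_def distr_fourier_def)
qed

lemma log_bessel_op_undefined: "\<phi> \<notin> schwartz \<Longrightarrow> log_bessel_op s lam u \<phi> = undefined"
  by (simp add: log_bessel_op_def fourier_multiplier_def distr_inv_fourier_def)

text \<open>The operator for \<open>lam'\<close> is the one for \<open>lam\<close> followed by the
  multiplier \<open>\<rho>\<close>.\<close>

lemma log_bessel_op_transfer:
  fixes \<rho> :: "'a::euclidean_space \<Rightarrow> complex"
  assumes lam: "1 < lam" "1 < lam'" and \<rho>: "Lp_multiplier p \<rho>"
    and ratio: "\<And>\<xi>. log_bessel_symbol s lam' \<xi> = log_bessel_symbol s lam \<xi> * \<rho> \<xi>"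
  shows "\<exists>C\<ge>0. \<forall>u (f :: 'a \<Rightarrow> complex). f \<in> Lp_space p \<and> log_bessel_op s lam u = distr_of_fun f \<longrightarrow>
      (\<exists>g\<in>Lp_space p. log_bessel_op s lam' u = distr_of_fun g \<and> Lp_norm p g \<le> C * Lp_norm p f)"
proof -
  obtain C where C: "C \<ge> 0" "\<And>f. f \<in> Lp_space p \<Longrightarrow> \<exists>g\<in>Lp_space p. Lp_norm p g \<le> C * Lp_norm p f \<and> multiplier_image \<rho> f g"
    by (rule Lp_multiplierE[OF \<rho>]) (rule that; blast)
  show ?thesis
  proof (intro exI[of _ C] conjI allI impI; (elim conjE)?)
    fix u and f :: "'a \<Rightarrow> complex" assume f: "f \<in> Lp_space p" and u: "log_bessel_op s lam u = distr_of_fun f"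
    obtain g where g: "g \<in> Lp_space p" "Lp_norm p g \<le> C * Lp_norm p f" "multiplier_image \<rho> f g"
      using C(2)[OF f] by blast
    have "log_bessel_op s lam' u \<phi> = distr_of_fun g \<phi>" for \<phi>
    proof (cases "\<phi> \<in> schwartz")
      case True
      have S: "(\<lambda>\<xi>. \<rho> \<xi> * inv_fourier \<phi> \<xi>) \<in> schwartz"
        by (rule Lp_multiplier_schwartz[OF \<rho> inv_fourier_schwartz[OF True]])
      have "log_bessel_op s lam' u \<phi> = u (fourier (\<lambda>\<xi>. log_bessel_symbol s lam \<xi> * (\<rho> \<xi> * inv_fourier \<phi> \<xi>)))"
        by (simp add: log_bessel_op_apply[OF lam(2) True] ratio mult.assoc)
      also have "\<dots> = log_bessel_op s lam u (fourier (\<lambda>\<xi>. \<rho> \<xi> * inv_fourier \<phi> \<xi>))"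
        by (simp add: log_bessel_op_apply[OF lam(1) fourier_schwartz[OF S]] inv_fourier_fourier[OF S])
      also have "\<dots> = distr_of_fun g \<phi>"
        using fourier_schwartz[OF S] True by (simp add: u distr_of_fun_def g(3))
      finally show ?thesis .
    next
      case False
      then show ?thesis by (simp add: log_bessel_op_undefined distr_of_fun_def)
    qed
    then show "\<exists>g\<in>Lp_space p. log_bessel_op s lam' u = distr_of_fun g \<and> Lp_norm p g \<le> C * Lp_norm p f"
      using g by blast
  qed (use C in auto)
qed

text \<open>Both Fourier transforms are moved from the test function to \<open>u\<close> by Fubini's
  theorem.  In particular the image has a representing function in every Lebesgue space, so that its
  norm is not an unspecified value.\<close>

lemma log_bessel_op_schwartz:
  fixes u :: "'a::euclidean_space \<Rightarrow> complex"
  assumes lam: "1 < lam" and u: "u \<in> schwartz"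
  shows "log_bessel_op s lam (distr_of_fun u) = distr_of_fun (inv_fourier (\<lambda>\<xi>. log_bessel_symbol s lam \<xi> * fourier u \<xi>))"
proof
  fix \<phi> :: "'a \<Rightarrow> complex"
  show "log_bessel_op s lam (distr_of_fun u) \<phi> = distr_of_fun (inv_fourier (\<lambda>\<xi>. log_bessel_symbol s lam \<xi> * fourier u \<xi>)) \<phi>"
  proof (cases "\<phi> \<in> schwartz")
    case True
    have S1: "(\<lambda>\<xi>. log_bessel_symbol s lam \<xi> * inv_fourier \<phi> \<xi>) \<in> schwartz"
      and S2: "(\<lambda>\<xi>. log_bessel_symbol s lam \<xi> * fourier u \<xi>) \<in> schwartz"
      by (intro schwartz_symbol_mult log_bessel_symbol_symbols lam inv_fourier_schwartz fourier_schwartz True u)+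
    have "log_bessel_op s lam (distr_of_fun u) \<phi> = (LINT x|lborel. u x * fourier (\<lambda>\<xi>. log_bessel_symbol s lam \<xi> * inv_fourier \<phi> \<xi>) x)"
      using fourier_schwartz[OF S1] by (simp add: log_bessel_op_apply[OF lam True] distr_of_fun_def)
    also have "\<dots> = (LINT \<xi>|lborel. fourier u \<xi> * (log_bessel_symbol s lam \<xi> * inv_fourier \<phi> \<xi>))"
      unfolding fourier_eq_osc
      by (rule osc_transform_exchange[symmetric]) (intro schwartz_integrable u S1)+
    also have "\<dots> = (LINT \<xi>|lborel. (log_bessel_symbol s lam \<xi> * fourier u \<xi>) * inv_fourier \<phi> \<xi>)"
      by (simp add: mult_ac)
    also have "\<dots> = (LINT x|lborel. inv_fourier (\<lambda>\<xi>. log_bessel_symbol s lam \<xi> * fourier u \<xi>) x * \<phi> x)"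
      unfolding inv_fourier_eq_osc
      by (rule osc_transform_exchange[symmetric]) (intro schwartz_integrable S2 True)+
    finally show ?thesis using True by (simp add: distr_of_fun_def)
  next
    case False
    then show ?thesis by (simp add: log_bessel_op_undefined distr_of_fun_def)
  qed
qed

lemma log_bessel_space_norm_le:
  fixes \<rho> :: "'a::euclidean_space \<Rightarrow> complex"
  assumes p: "1 \<le> p" and lam: "1 < lam" "1 < lam'" and \<rho>: "Lp_multiplier p \<rho>"
    and ratio: "\<And>\<xi>. log_bessel_symbol s lam' \<xi> = log_bessel_symbol s lam \<xi> * \<rho> \<xi>"
  shows "(log_bessel_space p s lam :: (('a \<Rightarrow> complex) \<Rightarrow> complex) set) \<subseteq> log_bessel_space p s lam' \<and>
    (\<exists>C\<ge>0. \<forall>u\<in>(schwartz :: ('a \<Rightarrow> complex) set). log_bessel_norm p s lam' (distr_of_fun u) \<le> C * log_bessel_norm p s lam (distr_of_fun u))"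
proof -
  obtain C where C: "C \<ge> 0" "\<And>u f. f \<in> Lp_space p \<Longrightarrow> log_bessel_op s lam u = distr_of_fun f \<Longrightarrow>
      \<exists>g\<in>Lp_space p. log_bessel_op s lam' u = distr_of_fun (g :: 'a \<Rightarrow> complex) \<and> Lp_norm p g \<le> C * Lp_norm p f"
    using log_bessel_op_transfer[OF lam \<rho> ratio] by blast
  have "log_bessel_norm p s lam' (distr_of_fun u) \<le> C * log_bessel_norm p s lam (distr_of_fun u)"
    if u: "u \<in> (schwartz :: ('a \<Rightarrow> complex) set)" for u
  proof -
    define f where "f = inv_fourier (\<lambda>\<xi>. log_bessel_symbol s lam \<xi> * fourier u \<xi>)"
    have f: "f \<in> Lp_space p"
      unfolding f_def
      by (intro schwartz_Lp_space inv_fourier_schwartz schwartz_symbol_mult log_bessel_symbol_symbols lam fourier_schwartz u p)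
    have fu: "log_bessel_op s lam (distr_of_fun u) = distr_of_fun f"
      unfolding f_def by (rule log_bessel_op_schwartz[OF lam(1) u])
    obtain g where g: "g \<in> Lp_space p" "log_bessel_op s lam' (distr_of_fun u) = distr_of_fun g" "Lp_norm p g \<le> C * Lp_norm p f"
      using C(2)[OF f fu] by blast
    then show ?thesis
      by (simp add: log_bessel_norm_def fu distr_Lp_norm_distr_of_fun f p)
  qed
  moreover have "log_bessel_space p s lam \<subseteq> (log_bessel_space p s lam' :: (('a \<Rightarrow> complex) \<Rightarrow> complex) set)"
    using C(2) unfolding log_bessel_space_def distr_in_Lp_def by blast
  ultimately show ?thesis using C(1) by blast
qed

theorem proposition1p10:
  fixes p :: ennreal and s lam1 lam2 :: real
  assumes "s > 0" and "1 \<le> p" and "1 < lam1" and "lam1 < lam2"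
  shows "(log_bessel_space p s lam1 :: ((real^'n \<Rightarrow> complex) \<Rightarrow> complex) set)
           = log_bessel_space p s lam2 \<and>
         (\<exists>C\<ge>1. \<forall>u \<in> (schwartz :: (real^'n \<Rightarrow> complex) set).
            inverse C * log_bessel_norm p s lam2 (distr_of_fun u)
              \<le> log_bessel_norm p s lam1 (distr_of_fun u) \<and>
            log_bessel_norm p s lam1 (distr_of_fun u)
              \<le> C * log_bessel_norm p s lam2 (distr_of_fun u))"
proof -
  have lam: "1 < lam1" "1 < lam2" using assms by auto
  obtain \<rho> \<tau> :: "real^'n \<Rightarrow> complex" where \<rho>: "Lp_multiplier p \<rho>" "\<And>\<xi>. log_bessel_symbol s lam1 \<xi> = log_bessel_symbol s lam2 \<xi> * \<rho> \<xi>"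
    and \<tau>: "Lp_multiplier p \<tau>" "\<And>\<xi>. log_bessel_symbol s lam2 \<xi> = log_bessel_symbol s lam1 \<xi> * \<tau> \<xi>"
    using Lp_multiplier_symbol_ratio[OF assms(2-4), of s] by metis
  note 21 = log_bessel_space_norm_le[OF assms(2) lam(2,1) \<rho>]
  note 12 = log_bessel_space_norm_le[OF assms(2) lam(1,2) \<tau>]
  obtain A where A: "A \<ge> 0" "\<And>u. u \<in> (schwartz :: (real^'n \<Rightarrow> complex) set) \<Longrightarrow>
      log_bessel_norm p s lam1 (distr_of_fun u) \<le> A * log_bessel_norm p s lam2 (distr_of_fun u)"
    using 21 by blast
  obtain B where B: "B \<ge> 0" "\<And>u. u \<in> (schwartz :: (real^'n \<Rightarrow> complex) set) \<Longrightarrow>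
      log_bessel_norm p s lam2 (distr_of_fun u) \<le> B * log_bessel_norm p s lam1 (distr_of_fun u)"
    using 12 by blast
  have nonneg: "0 \<le> log_bessel_norm p s lam (distr_of_fun u)"
    if lam: "1 < lam" and u: "u \<in> (schwartz :: (real^'n \<Rightarrow> complex) set)" for lam u
  proof -
    have "inv_fourier (\<lambda>\<xi>. log_bessel_symbol s lam \<xi> * fourier u \<xi>) \<in> Lp_space p"
      by (intro schwartz_Lp_space inv_fourier_schwartz schwartz_symbol_mult log_bessel_symbol_symbols lam fourier_schwartz u assms)
    then show ?thesis
      using assms(2) by (simp add: log_bessel_norm_def log_bessel_op_schwartz[OF lam u] distr_Lp_norm_distr_of_fun Lp_norm_def)
  qed
  define C where "C = 1 + A + B"
  have C: "C \<ge> 1" "C \<ge> A" "C \<ge> B" using A B by (auto simp: C_def)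
  have "inverse C * log_bessel_norm p s lam2 (distr_of_fun u) \<le> log_bessel_norm p s lam1 (distr_of_fun u) \<and>
      log_bessel_norm p s lam1 (distr_of_fun u) \<le> C * log_bessel_norm p s lam2 (distr_of_fun u)"
    if u: "u \<in> (schwartz :: (real^'n \<Rightarrow> complex) set)" for u
  proof
    have "log_bessel_norm p s lam2 (distr_of_fun u) \<le> C * log_bessel_norm p s lam1 (distr_of_fun u)"
      by (rule order.trans[OF B(2)[OF u] mult_right_mono[OF C(3) nonneg[OF lam(1) u]]])
    then show "inverse C * log_bessel_norm p s lam2 (distr_of_fun u) \<le> log_bessel_norm p s lam1 (distr_of_fun u)"
      using C(1) by (simp add: field_simps)
    show "log_bessel_norm p s lam1 (distr_of_fun u) \<le> C * log_bessel_norm p s lam2 (distr_of_fun u)"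
      by (rule order.trans[OF A(2)[OF u] mult_right_mono[OF C(2) nonneg[OF lam(2) u]]])
  qed
  then show ?thesis using 12 21 C(1) by blast
qed

end
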